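(* Let $T>0$, $L\in\mathbb{N}$, and let $\psi:\mathbb{R}^L\times(0,\infty)\times\mathbb{R}\to\mathbb{R}$ satisfy the hypothesis on $\psi$ stated in the context, with the constants $M$ and $M_1$ defined there. Let $\mathbf{u},\hat{\mathbf{u}}\in G_R([0,T];\mathbb{R}^L)$ and $w,\hat w\in G_R[0,T]$ be given. Then there exist solutions $q,\hat q\in G_R[0,T]$ of the equations $$q(t)+\mathcal{P}(\mathbf{u})[q](t)=w(t),\qquad \hat q(t)+\mathcal{P}(\hat{\mathbf{u}})[\hat q](t)=\hat w(t),\qquad t\in[0,T],$$ and the inequality $$|q(t)-\hat q(t)|\le \mathrm{e}^{M}\left(|w-\hat w|_{[0,t]}+M_1\,\|\mathbf{u}-\hat{\mathbf{u}}\|_{[0,t]}\right)$$ holds for each $t\in[0,T]$.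
   Context: Regulated functions. A function $w$ on $[0,T]$ is regulated if both one-sided limits $w(t+),w(t-)$ exist at every $t\in[0,T]$, with the convention $w(T+)=w(T)$, $w(0-)=w(0)$. $G[0,T]$ is the space of real-valued regulated functions, $G_R[0,T]$ the space of right-continuous real-valued regulated functions, $G_R([0,T];\mathbb{R}^L)$ the space of right-continuous regulated functions with values in $\mathbb{R}^L$, and $BV_R[0,T]=BV[0,T]\cap G_R[0,T]$, where $BV[0,T]$ is the space of functions of bounded variation. Put $|w|_{[s,t]}=\sup_{\tau\in[s,t]}|w(\tau)|$ and $\|\mathbf{u}\|_{[s,t]}=\sup_{\tau\in[s,t]}\|\mathbf{u}(\tau)\|$, where $\|\cdot\|$ is the Euclidean norm in $\mathbb{R}^L$. Play operator. For $r>0$ and $q\in G_R[0,T]$, $\mathfrak{p}_r[q]=\xi_r$ denotes the unique $\xi_r\in BV_R[0,T]$ such that $|q(t)-\xi_r(t)|\le r$ for all $t\in[0,T]$, $\int_0^T(q(t)-\xi_r(t)-z(t))\,\mathrm{d}\xi_r(t)\ge 0$ (Kurzweil-Stieltjes integral) for every $z\in G[0,T]$ with $|z|_{[0,T]}\le r$, and $\xi_r(0)=\max\{q(0)-r,\min\{0,q(0)+r\}\}$. Hypothesis on $\psi$. $\psi$ is measurable; for almost every $(r,v)\in(0,\infty)\times\mathbb{R}$ the function $\mathbf{u}\mapsto\psi(\mathbf{u},r,v)$ is differentiable on $\mathbb{R}^L$ and for all $\mathbf{u}\in\mathbb{R}^L$: (i) $0\le\psi(\mathbf{u},r,v)\le\mu(r)$,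 where $\mu\in L^1(0,\infty)$ and $M=\int_0^\infty\mu(r)\,\mathrm{d}r$; (ii) $\|\nabla_{\mathbf{u}}\psi(\mathbf{u},r,v)\|\le K(r,v)$, where $K\in L^1((0,\infty)\times\mathbb{R})$ and $M_1=\int_0^\infty\int_{-\infty}^\infty K(r,v)\,\mathrm{d}v\,\mathrm{d}r$. Parameter-dependent Preisach operator. For $\mathbf{u}\in G_R([0,T];\mathbb{R}^L)$ and $q\in G_R[0,T]$, $$\mathcal{P}(\mathbf{u})[q](t)=\int_0^\infty\int_0^{\xi_r(t)}\psi(\mathbf{u}(t),r,v)\,\mathrm{d}v\,\mathrm{d}r,\qquad \xi_r=\mathfrak{p}_r[q],\quad t\in[0,T],$$ where the inner integral is oriented (one has $\xi_r(t)=0$ for $r\ge|q|_{[0,T]}$). *)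

theory Defs
  imports "HOL-Analysis.Analysis"
begin

text \<open>
  Functions on \<open>[0,T]\<close> are total functions on \<^typ>\<open>real\<close>; the predicates below only
  constrain their values on \<open>{0..T}\<close>.  The one-sided limits that are fixed by the
  conventions \<open>w(T+) = w(T)\<close> and \<open>w(0-) = w(0)\<close> impose no condition.
\<close>

definition regulated :: "real \<Rightarrow> (real \<Rightarrow> 'a::real_normed_vector) set" where
  "regulated T = {w. (\<forall>t\<in>{0..<T}. \<exists>l. (w \<longlongrightarrow> l) (at_right t)) \<and>
                     (\<forall>t\<in>{0<..T}. \<exists>l. (w \<longlongrightarrow> l) (at_left t))}"

definition regulated_right :: "real \<Rightarrow> (real \<Rightarrow> 'a::real_normed_vector) set" where
  "regulated_right T = {w \<in> regulated T. \<forall>t\<in>{0..<T}. (w \<longlongrightarrow> w t) (at_right t)}"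

definition bounded_var :: "real \<Rightarrow> (real \<Rightarrow> real) set" where
  "bounded_var T = {w. \<exists>C. \<forall>(n::nat) (s::nat \<Rightarrow> real).
      s 0 = 0 \<and> s n = T \<and> (\<forall>i<n. s i \<le> s (Suc i)) \<longrightarrow>
      (\<Sum>i<n. \<bar>w (s (Suc i)) - w (s i)\<bar>) \<le> C}"

definition sup_norm :: "real \<Rightarrow> real \<Rightarrow> (real \<Rightarrow> 'a::real_normed_vector) \<Rightarrow> real" where
  "sup_norm s t w = (SUP \<tau>\<in>{s..t}. norm (w \<tau>))"

text \<open>
  Kurzweil--Stieltjes integral of \<open>f\<close> with respect to \<open>g\<close>.  The members of a tagged
  division are pairs (tag, compact interval); degenerate intervals contribute \<open>0\<close>.
\<close>

definition has_KS_integral ::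
    "(real \<Rightarrow> real) \<Rightarrow> (real \<Rightarrow> real) \<Rightarrow> real \<Rightarrow> real \<Rightarrow> real \<Rightarrow> bool" where
  "has_KS_integral f g a b I \<longleftrightarrow>
     (\<forall>\<epsilon>>0. \<exists>\<gamma>. gauge \<gamma> \<and>
        (\<forall>p. p tagged_division_of {a..b} \<and> \<gamma> fine p \<longrightarrow>
           \<bar>(\<Sum>(x, J)\<in>p. f x * (g (Sup J) - g (Inf J))) - I\<bar> < \<epsilon>))"

definition is_play :: "real \<Rightarrow> real \<Rightarrow> (real \<Rightarrow> real) \<Rightarrow> (real \<Rightarrow> real) \<Rightarrow> bool" where
  "is_play T r q \<xi> \<longleftrightarrow>
     \<xi> \<in> bounded_var T \<inter> regulated_right T \<and>
     (\<forall>t\<in>{0..T}. \<bar>q t - \<xi> t\<bar> \<le> r) \<and>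
     (\<forall>z\<in>regulated T. sup_norm 0 T z \<le> r \<longrightarrow>
        (\<exists>I\<ge>0. has_KS_integral (\<lambda>t. q t - \<xi> t - z t) \<xi> 0 T I)) \<and>
     \<xi> 0 = max (q 0 - r) (min 0 (q 0 + r))"

text \<open>
  Restricting to \<^const>\<open>extensional\<close> functions fixes the irrelevant values off
  \<open>{0..T}\<close>, so that uniqueness on \<open>{0..T}\<close> is uniqueness as a total function.
\<close>

definition play :: "real \<Rightarrow> real \<Rightarrow> (real \<Rightarrow> real) \<Rightarrow> (real \<Rightarrow> real)" where
  "play T r q = (THE \<xi>. \<xi> \<in> extensional {0..T} \<and> is_play T r q \<xi>)"

text \<open>
  ``Measurable'' and ``almost every'' refer to the (complete) Lebesgue measure.
  Accordingly all integrals below are taken with respect to \<^term>\<open>lebesgue\<close>, not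
  \<^term>\<open>lborel\<close>, since sections of \<open>\<psi>\<close> need not be Borel measurable.
\<close>

definition preisach_density ::
    "(real ^ 'n \<Rightarrow> real \<Rightarrow> real \<Rightarrow> real) \<Rightarrow> (real \<Rightarrow> real) \<Rightarrow> (real \<Rightarrow> real \<Rightarrow> real) \<Rightarrow> bool" where
  "preisach_density \<psi> \<mu> K \<longleftrightarrow>
     (\<lambda>(u, r, v). \<psi> u r v) \<in> borel_measurable (lebesgue_on (UNIV \<times> {0<..} \<times> UNIV)) \<and>
     set_integrable lebesgue {0<..} \<mu> \<and>
     set_integrable lebesgue ({0<..} \<times> UNIV) (\<lambda>(r, v). K r v) \<and>
     (AE (r, v) in lebesgue_on ({0<..} \<times> UNIV). \<forall>u.
        0 \<le> \<psi> u r v \<and> \<psi> u r v \<le> \<mu> r \<and>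
        (\<exists>D. GDERIV (\<lambda>u. \<psi> u r v) u :> D \<and> norm D \<le> K r v))"

definition preisach ::
    "real \<Rightarrow> (real ^ 'n \<Rightarrow> real \<Rightarrow> real \<Rightarrow> real) \<Rightarrow> (real \<Rightarrow> real ^ 'n) \<Rightarrow>
     (real \<Rightarrow> real) \<Rightarrow> real \<Rightarrow> real" where
  "preisach T \<psi> u q t =
     (LINT r:{0<..}|lebesgue.
        interval_lebesgue_integral lebesgue 0 (ereal (play T r q t)) (\<lambda>v. \<psi> (u t) r v))"

end

theory Submission
  imports Defs
begin

text \<open>
  At a fixed time the plays of all radii form a single function of the radius, the memory state
  \<open>\<Lambda> t\<close>: it is 1-Lipschitz, \<open>\<Lambda> t 0 = q t\<close> and \<open>\<Lambda> t r = \<xi>\<^sub>r(t)\<close>.  The Preisach term is a functional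
  \<open>\<Phi>\<close> of the parameter and the memory state.  It is Lipschitz in the parameter with constant \<open>M\<^sub>1\<close>
  (\<open>preisach_functional_parameter_Lipschitz\<close>), and \<open>\<Phi>(\<phi>') - \<Phi>(\<phi>)\<close> is at most the integral of
  \<open>\<mu> * max 0 (\<phi>' - \<phi>)\<close> (\<open>preisach_functional_diff_le\<close>), which says at once that \<open>\<Phi>\<close> is monotone and
  Lipschitz in the state, level by level.

  Stability.  For two solutions the equations bound \<open>(q - q') + (\<Phi>(\<Lambda> t) - \<Phi>(\<Lambda>' t))\<close> by
  \<open>F = |w - w'| + M\<^sub>1 |u - u'|\<close>.  Suppose that the difference \<open>\<Lambda> t r - \<Lambda>' t r\<close> has just grown to a value
  \<open>\<delta> > 0\<close>.  Then one of the two plays of radius \<open>r\<close> is being pushed, \<open>\<Lambda> t r = q - r\<close> or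
  \<open>\<Lambda>' t r = q' + r\<close>, and the Lipschitz continuity in the radius gives \<open>\<Lambda> t s - \<Lambda>' t s \<ge> \<delta>\<close> for all
  \<open>s \<le> r\<close>.  So \<open>q - q' \<ge> \<delta>\<close>, and all radii below \<open>r\<close> enter the equation with the favourable sign:
  \<open>\<delta> \<le> F + \<integral>\<^sub>r\<^sup>\<infinity> \<mu> S\<close>, where \<open>S s\<close> is the supremum over time of the difference at radius \<open>s\<close>
  (\<open>update_difference_bound\<close>).  Hence \<open>S r \<le> F + \<integral>\<^sub>r\<^sup>\<infinity> \<mu> S\<close> for all \<open>r\<close>, and a Gronwall argument that
  runs backwards in the radius, not in time, yields \<open>S \<le> e\<^sup>M F\<close> (\<open>step_trajectory_stability\<close>).

  Existence.  A trajectory that is piecewise constant in time satisfies the equation at a grid point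
  if and only if a scalar equation with a strictly increasing continuous left-hand side holds.  On a
  fine grid the equation is then solved up to a small residual for all times.  The stability estimate
  applies to two such approximate solutions, even on different grids, and shows that they converge
  uniformly in time and radius.  The limit solves the equation, and the estimate passes to the limit.

  Identification.  It remains to see that each level of the limit is the play in the sense of the
  variational inequality.  The property \<open>obeys_play\<close> says that the play moves up only where
  \<open>q - \<xi>\<close> is nearly \<open>r\<close> and down only where it is nearly \<open>-r\<close>.  It survives uniform limits; it forces
  \<open>\<xi>\<close> to be monotone wherever \<open>q\<close> oscillates by less than \<open>r\<close>, hence to be of bounded variation; and it
  implies the variational inequality (\<open>obeys_play_imp_is_play\<close>), whose solution is unique
  (\<open>is_play_unique\<close>).
\<close>

section \<open>Regulated functions\<close>

text \<open>The guard \<open>0 \<le> y\<close> makes the left end point a degenerate case, in which any limit will do.\<close>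

lemma regulated_left_limit:
  assumes "w \<in> regulated T" "0 \<le> x" "x \<le> T"
  obtains l where "\<And>e. e > 0 \<Longrightarrow> \<exists>d>0. \<forall>y. x - d < y \<and> y < x \<and> 0 \<le> y \<longrightarrow> norm (w y - l) < e"
proof (cases "x = 0")
  case True
  show ?thesis
  proof (rule that)
    show "\<exists>d>0. \<forall>y. x - d < y \<and> y < x \<and> 0 \<le> y \<longrightarrow> norm (w y - 0) < e" for e
      by (rule exI[of _ 1]) (use True in auto)
  qed
next
  case False
  then obtain l where l: "(w \<longlongrightarrow> l) (at_left x)"
    using assms unfolding regulated_def mem_Collect_eq by (metis greaterThanAtMost_iff less_le)
  have "\<exists>d>0. \<forall>y. x - d < y \<and> y < x \<and> 0 \<le> y \<longrightarrow> norm (w y - l) < e" if "e > 0" for e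
  proof -
    have "eventually (\<lambda>y. dist (w y) l < e) (at_left x)"
      using l that by (rule tendstoD)
    then obtain b where "b < x" "\<forall>y>b. y < x \<longrightarrow> dist (w y) l < e"
      by (auto simp: eventually_at_left_field)
    then show ?thesis
      by (intro exI[of _ "x - b"]) (auto simp: dist_norm)
  qed
  then show ?thesis by (rule that)
qed

lemma regulated_local_left:
  assumes "w \<in> regulated T" "e > 0" "0 \<le> x" "x \<le> T"
  obtains d l where "d > 0" "\<And>y. x - d < y \<Longrightarrow> y < x \<Longrightarrow> 0 \<le> y \<Longrightarrow> norm (w y - l) < e"
  using regulated_left_limit[OF assms(1,3,4)] assms(2) by metis

lemma regulated_local_right:
  assumes "w \<in> regulated T" "e > 0" "0 \<le> x" "x \<le> T"
  obtains d l where "d > 0" "\<And>y. x < y \<Longrightarrow> y < x + d \<Longrightarrow> y \<le> T \<Longrightarrow> norm (w y - l) < e"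
proof (cases "x = T")
  case True
  show ?thesis by (rule that[of 1]) (use True in auto)
next
  case False
  then obtain l where "(w \<longlongrightarrow> l) (at_right x)"
    using assms unfolding regulated_def mem_Collect_eq by (metis atLeastLessThan_iff less_le)
  then have "eventually (\<lambda>y. dist (w y) l < e) (at_right x)"
    using assms(2) by (rule tendstoD)
  then obtain b where "b > x" "\<forall>y>x. y < b \<longrightarrow> dist (w y) l < e"
    by (auto simp: eventually_at_right_field)
  then show ?thesis
    by (intro that[of "b - x" l]) (auto simp: dist_norm)
qed

lemma regulated_right_continuous:
  assumes "w \<in> regulated_right T" "e > 0" "0 \<le> x"
  obtains d where "d > 0" "\<And>y. x \<le> y \<Longrightarrow> y < x + d \<Longrightarrow> y \<le> T \<Longrightarrow> norm (w y - w x) < e"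
proof (cases "x < T")
  case True
  then have "(w \<longlongrightarrow> w x) (at_right x)"
    using assms by (auto simp: regulated_right_def)
  then have "eventually (\<lambda>y. dist (w y) (w x) < e) (at_right x)"
    using \<open>e > 0\<close> by (rule tendstoD)
  then obtain b where b: "b > x" "\<forall>y>x. y < b \<longrightarrow> dist (w y) (w x) < e"
    by (auto simp: eventually_at_right_field)
  show ?thesis
  proof (rule that[of "b - x"])
    show "norm (w y - w x) < e" if "x \<le> y" "y < x + (b - x)" for y
      using b that \<open>e > 0\<close> by (cases "y = x") (auto simp: dist_norm)
  qed (use b in auto)
next
  case False
  show ?thesis
  proof (rule that[of 1])
    show "norm (w y - w x) < e" if "x \<le> y" "y \<le> T" for y
      using that False \<open>e > 0\<close> by (cases "y = x") auto
  qed simp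
qed

lemma regulated_right_imp_regulated: "w \<in> regulated_right T \<Longrightarrow> w \<in> regulated T"
  by (simp add: regulated_right_def)

text \<open>Bisection turns a statement about the whole interval into one about the neighbourhood of a point,
  where the one-sided limits control \<open>w\<close> on either side.\<close>

lemma regulated_bounded:
  assumes w: "w \<in> regulated T" and T: "0 \<le> T"
  obtains C where "\<And>t. t \<in> {0..T} \<Longrightarrow> norm (w t) \<le> C"
proof -
  define P where "P a b \<longleftrightarrow> (\<exists>C. \<forall>t\<in>{a..b} \<inter> {0..T}. norm (w t) \<le> C)" for a b
  have "P 0 T"
    using T
  proof (induction rule: Bolzano)
    case (trans a b c)
    then obtain C D where C: "\<forall>t\<in>{a..b} \<inter> {0..T}. norm (w t) \<le> C"
      and D: "\<forall>t\<in>{b..c} \<inter> {0..T}. norm (w t) \<le> D" by (auto simp: P_def)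
    have "norm (w t) \<le> max C D" if "t \<in> {a..c} \<inter> {0..T}" for t
      using C D that by (cases "t \<le> b") (auto simp: le_max_iff_disj)
    then show ?case unfolding P_def by blast
  next
    case (local x)
    obtain d l where d: "d > 0" "\<And>y. x - d < y \<Longrightarrow> y < x \<Longrightarrow> 0 \<le> y \<Longrightarrow> norm (w y - l) < 1"
      using regulated_local_left[OF w, of 1 x] local by auto
    obtain d' l' where d': "d' > 0" "\<And>y. x < y \<Longrightarrow> y < x + d' \<Longrightarrow> y \<le> T \<Longrightarrow> norm (w y - l') < 1"
      using regulated_local_right[OF w, of 1 x] local by auto
    have "P a b" if "a \<le> x" "x \<le> b" "b - a < min d d'" for a b
    proof -
      have "norm (w t) \<le> norm (w x) + norm l + norm l' + 1" if t: "t \<in> {a..b} \<inter> {0..T}" for t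
      proof -
        consider "t < x" | "t = x" | "t > x" by linarith
        then show ?thesis
        proof cases
          case 1
          then have "norm (w t - l) < 1" using d(2)[of t] t that \<open>b - a < min d d'\<close> \<open>x \<le> b\<close> by auto
          then show ?thesis using norm_triangle_sub[of "w t" l] norm_ge_zero[of "w x"] norm_ge_zero[of l'] by linarith
        next
          case 3
          then have "norm (w t - l') < 1" using d'(2)[of t] t that \<open>b - a < min d d'\<close> \<open>a \<le> x\<close> by auto
          then show ?thesis using norm_triangle_sub[of "w t" l'] norm_ge_zero[of "w x"] norm_ge_zero[of l] by linarith
        qed (simp add: add_nonneg_nonneg)
      qed
      then show ?thesis unfolding P_def by blast
    qed
    then show ?case using d(1) d'(1) by (intro exI[of _ "min d d'"]) auto
  qed
  then obtain C where "\<forall>t\<in>{0..T}. norm (w t) \<le> C" by (auto simp: P_def)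
  then show ?thesis using that[of C] by blast
qed

text \<open>On either side of a point the oscillation is small, so that locally only the point itself can be
  exceptional.\<close>

lemma regulated_finitely_many_large_jumps:
  assumes w: "w \<in> regulated T" and T: "0 \<le> T" and e: "e > 0"
  obtains E where "finite E"
    "\<And>x. x \<in> {0..T} - E \<Longrightarrow> \<exists>d>0. \<forall>y\<in>{0..T}. \<bar>y - x\<bar> < d \<longrightarrow> norm (w y - w x) < e"
proof -
  define good where "good x \<longleftrightarrow> (\<exists>d>0. \<forall>y\<in>{0..T}. \<bar>y - x\<bar> < d \<longrightarrow> norm (w y - w x) < e)" for x
  define P where "P a b \<longleftrightarrow> (\<exists>E. finite E \<and> (\<forall>x\<in>{a..b} \<inter> {0..T} - E. good x))" for a b
  have "P 0 T"
    using T
  proof (induction rule: Bolzano)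
    case (trans a b c)
    then obtain C D where C: "finite C" "\<forall>x\<in>{a..b} \<inter> {0..T} - C. good x"
      and D: "finite D" "\<forall>x\<in>{b..c} \<inter> {0..T} - D. good x" by (auto simp: P_def)
    have "good x" if "x \<in> {a..c} \<inter> {0..T} - (C \<union> D)" for x
      using C D that by (cases "x \<le> b") auto
    then show ?case unfolding P_def using C(1) D(1) by blast
  next
    case (local x)
    have e2: "e / 2 > 0" using e by simp
    obtain d l where d: "d > 0" "\<And>y. x - d < y \<Longrightarrow> y < x \<Longrightarrow> 0 \<le> y \<Longrightarrow> norm (w y - l) < e/2"
      using regulated_local_left[OF w e2, of x] local by auto
    obtain d' l' where d': "d' > 0" "\<And>y. x < y \<Longrightarrow> y < x + d' \<Longrightarrow> y \<le> T \<Longrightarrow> norm (w y - l') < e/2"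
      using regulated_local_right[OF w e2, of x] local by auto
    have tri: "norm (w a - w b) < e" if "norm (w a - m) < e/2" "norm (w b - m) < e/2" for a b m
      using norm_triangle_ineq4[of "w a - m" "w b - m"] that by simp
    have "P a b" if ab: "a \<le> x" "x \<le> b" "b - a < min d d'" for a b
    proof -
      have "good t" if t: "t \<in> {a..b} \<inter> {0..T} - {x}" for t
      proof (cases "t < x")
        case True
        have "norm (w y - w t) < e" if "y \<in> {0..T}" "\<bar>y - t\<bar> < min (x - t) (t - (x - d))" for y
          by (rule tri[OF d(2) d(2)]) (use that t ab True in \<open>auto simp: abs_if split: if_splits\<close>)
        moreover have "min (x - t) (t - (x - d)) > 0" using True t ab by auto
        ultimately show ?thesis unfolding good_def by blast
      next
        case False
        then have "t > x" using t by auto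
        have "norm (w y - w t) < e" if "y \<in> {0..T}" "\<bar>y - t\<bar> < min (t - x) ((x + d') - t)" for y
          by (rule tri[OF d'(2) d'(2)]) (use that t ab \<open>t > x\<close> in \<open>auto simp: abs_if split: if_splits\<close>)
        moreover have "min (t - x) ((x + d') - t) > 0" using \<open>t > x\<close> t ab by auto
        ultimately show ?thesis unfolding good_def by blast
      qed
      then show ?thesis unfolding P_def by (intro exI[of _ "{x}"]) auto
    qed
    then show ?case using d(1) d'(1) by (intro exI[of _ "min d d'"]) auto
  qed
  then obtain E where "finite E" "\<forall>x\<in>{0..T} - E. good x" by (auto simp: P_def)
  then show ?thesis using that[of E] by (auto simp: good_def)
qed

text \<open>By right continuity a cell of the grid may include its left end point, so that the value there
  represents \<open>w\<close> on the whole cell.\<close>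

lemma regulated_right_fine_grid:
  assumes w: "w \<in> regulated_right T" and T: "0 \<le> T" and e: "e > 0"
  obtains G where "finite G" "G \<subseteq> {0..T}"
    "\<And>t. t \<in> {0..T} \<Longrightarrow> \<exists>g\<in>G. g \<le> t \<and> (\<forall>y\<in>{g..t}. norm (w y - w g) < e)"
proof -
  define P where "P a b \<longleftrightarrow> (\<exists>G. finite G \<and> G \<subseteq> {0..T} \<and>
    (\<forall>t\<in>{a..b} \<inter> {0..T}. \<exists>g\<in>G. g \<le> t \<and> (\<forall>y\<in>{g..t}. norm (w y - w g) < e)))" for a b
  have "P 0 T"
    using T
  proof (induction rule: Bolzano)
    case (trans a b c)
    then obtain C where C: "finite C" "C \<subseteq> {0..T}" "\<forall>t\<in>{a..b} \<inter> {0..T}. \<exists>g\<in>C. g \<le> t \<and> (\<forall>y\<in>{g..t}. norm (w y - w g) < e)"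
      unfolding P_def by auto
    from trans obtain D where D: "finite D" "D \<subseteq> {0..T}" "\<forall>t\<in>{b..c} \<inter> {0..T}. \<exists>g\<in>D. g \<le> t \<and> (\<forall>y\<in>{g..t}. norm (w y - w g) < e)"
      unfolding P_def by auto
    have "\<exists>g\<in>C \<union> D. g \<le> t \<and> (\<forall>y\<in>{g..t}. norm (w y - w g) < e)" if "t \<in> {a..c} \<inter> {0..T}" for t
    proof (cases "t \<le> b")
      case True then show ?thesis using C(3) that by auto
    next
      case False then show ?thesis using D(3) that by auto
    qed
    then show ?case unfolding P_def using C(1,2) D(1,2) by (intro exI[of _ "C \<union> D"]) auto
  next
    case (local x)
    have e2: "e / 2 > 0" using e by simp
    obtain d l where d: "d > 0" "\<And>y. x - d < y \<Longrightarrow> y < x \<Longrightarrow> 0 \<le> y \<Longrightarrow> norm (w y - l) < e/2"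
      using regulated_local_left[OF regulated_right_imp_regulated[OF w] e2, of x] local by auto
    obtain d' where d': "d' > 0" "\<And>y. x \<le> y \<Longrightarrow> y < x + d' \<Longrightarrow> y \<le> T \<Longrightarrow> norm (w y - w x) < e"
      using regulated_right_continuous[OF w e, of x] local by auto
    have tri: "norm (w a - w b) < e" if "norm (w a - m) < e/2" "norm (w b - m) < e/2" for a b m
      using norm_triangle_ineq4[of "w a - m" "w b - m"] that by simp
    have "P a b" if ab: "a \<le> x" "x \<le> b" "b - a < min d d'" for a b
    proof -
      let ?G = "{max 0 a, x}"
      have "\<exists>g\<in>?G. g \<le> t \<and> (\<forall>y\<in>{g..t}. norm (w y - w g) < e)" if t: "t \<in> {a..b} \<inter> {0..T}" for t
      proof (cases "t < x")
        case True
        have "norm (w y - w (max 0 a)) < e" if "y \<in> {max 0 a..t}" for y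
          by (rule tri[OF d(2) d(2)]) (use that t ab True in auto)
        then show ?thesis using t by (intro bexI[of _ "max 0 a"]) auto
      next
        case False
        have "norm (w y - w x) < e" if "y \<in> {x..t}" for y
          by (rule d'(2)) (use that t ab in auto)
        then show ?thesis using False by (intro bexI[of _ x]) auto
      qed
      moreover have "?G \<subseteq> {0..T}" using local ab by auto
      ultimately show ?thesis unfolding P_def by (intro exI[of _ ?G]) auto
    qed
    then show ?case using d(1) d'(1) by (intro exI[of _ "min d d'"]) auto
  qed
  then obtain G where "finite G" "G \<subseteq> {0..T}"
    "\<forall>t\<in>{0..T}. \<exists>g\<in>G. g \<le> t \<and> (\<forall>y\<in>{g..t}. norm (w y - w g) < e)" by (auto simp: P_def)
  then show ?thesis using that[of G] by blast
qed

lemma regulated_diff: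
  "f \<in> regulated T \<Longrightarrow> g \<in> regulated T \<Longrightarrow> (\<lambda>t. f t - g t) \<in> regulated T"
proof -
  have "\<exists>l. ((\<lambda>t. f t - g t) \<longlongrightarrow> l) F" if "\<exists>l. (f \<longlongrightarrow> l) F" "\<exists>l. (g \<longlongrightarrow> l) F" for F
    using that tendsto_diff by blast
  then show "f \<in> regulated T \<Longrightarrow> g \<in> regulated T \<Longrightarrow> (\<lambda>t. f t - g t) \<in> regulated T"
    by (simp add: regulated_def)
qed

lemma regulated_right_diff:
  "f \<in> regulated_right T \<Longrightarrow> g \<in> regulated_right T \<Longrightarrow> (\<lambda>t. f t - g t) \<in> regulated_right T"
  unfolding regulated_right_def by (auto intro: regulated_diff tendsto_diff)

text \<open>The uniqueness proof for the play switches from one test function to another at a given time.\<close>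

lemma regulated_switch:
  assumes f: "f \<in> regulated T" and g: "g \<in> regulated T"
  shows "(\<lambda>y. if y \<le> t then f y else g y) \<in> regulated T"
proof -
  let ?h = "\<lambda>y. if y \<le> t then f y else g y"
  have "\<exists>l. (?h \<longlongrightarrow> l) (at_right x)" if "x \<in> {0..<T}" for x
  proof (cases "x < t")
    case True
    then have "eventually (\<lambda>y. ?h y = f y) (at_right x)"
      by (auto simp: eventually_at_right_field intro!: exI[of _ t])
    then show ?thesis using f that tendsto_cong[of ?h f "at_right x"] by (auto simp: regulated_def)
  next
    case False
    then have "eventually (\<lambda>y. ?h y = g y) (at_right x)"
      by (auto simp: eventually_at_right_field intro!: exI[of _ "x+1"])
    then show ?thesis using g that tendsto_cong[of ?h g "at_right x"] by (auto simp: regulated_def)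
  qed
  moreover have "\<exists>l. (?h \<longlongrightarrow> l) (at_left x)" if "x \<in> {0<..T}" for x
  proof (cases "x \<le> t")
    case True
    then have "eventually (\<lambda>y. ?h y = f y) (at_left x)"
      by (auto simp: eventually_at_left_field intro!: exI[of _ "x-1"])
    then show ?thesis using f that tendsto_cong[of ?h f "at_left x"] by (auto simp: regulated_def)
  next
    case False
    then have "eventually (\<lambda>y. ?h y = g y) (at_left x)"
      by (auto simp: eventually_at_left_field intro!: exI[of _ t])
    then show ?thesis using g that tendsto_cong[of ?h g "at_left x"] by (auto simp: regulated_def)
  qed
  ultimately show ?thesis by (auto simp: regulated_def)
qed

lemma sup_norm_upper:
  assumes "w \<in> regulated T" "t \<le> T" "\<tau> \<in> {0..t}"
  shows "norm (w \<tau>) \<le> sup_norm 0 t w"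
proof -
  obtain C where C: "\<And>t. t \<in> {0..T} \<Longrightarrow> norm (w t) \<le> C"
    using regulated_bounded[OF assms(1)] assms by force
  have "bdd_above ((\<lambda>\<tau>. norm (w \<tau>)) ` {0..t})"
    by (rule bdd_aboveI[of _ C]) (use C assms in auto)
  then show ?thesis unfolding sup_norm_def using assms(3) by (rule cSUP_upper[rotated])
qed

lemma limit_exists_if_Cauchy:
  fixes f :: "real \<Rightarrow> 'a::banach"
  assumes F: "F \<noteq> bot"
    and "\<And>e. e > 0 \<Longrightarrow> \<exists>P. eventually P F \<and> (\<forall>x y. P x \<and> P y \<longrightarrow> dist (f x) (f y) < e)"
  shows "\<exists>l. (f \<longlongrightarrow> l) F"
proof -
  have "cauchy_filter (filtermap f F)"
    using assms(2) by (auto simp: cauchy_filter_metric_filtermap)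
  moreover have "filtermap f F \<noteq> bot" using F by (simp add: filtermap_bot_iff)
  ultimately obtain l where "filtermap f F \<le> nhds l"
    using complete_UNIV[where 'a='a] unfolding complete_uniform by fastforce
  then show ?thesis by (auto simp: filterlim_def)
qed

lemma regulated_right_uniform_limit:
  fixes w :: "real \<Rightarrow> 'a::banach"
  assumes "\<And>e. e > 0 \<Longrightarrow> \<exists>v\<in>regulated_right T. \<forall>t\<in>{0..T}. norm (w t - v t) \<le> e"
  shows "w \<in> regulated_right T"
proof -
  have right: "(w \<longlongrightarrow> w x) (at_right x)" if x: "x \<in> {0..<T}" for x
  proof (rule tendstoI)
    fix e :: real assume e: "e > 0"
    then obtain v where v: "v \<in> regulated_right T" "\<forall>t\<in>{0..T}. norm (w t - v t) \<le> e/8"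
      using assms[of "e/8"] by auto
    obtain d where d: "d > 0" "\<And>y. x \<le> y \<Longrightarrow> y < x + d \<Longrightarrow> y \<le> T \<Longrightarrow> norm (v y - v x) < e/4"
      using regulated_right_continuous[OF v(1), of "e/4" x] x e by auto
    have "dist (w y) (w x) < e" if "x < y" "y < min T (x + d)" for y
    proof -
      have "norm (w y - w x) = norm ((w y - v y) + (v y - v x) - (w x - v x))" by simp
      also have "\<dots> \<le> norm (w y - v y) + norm (v y - v x) + norm (w x - v x)"
        by (meson norm_triangle_ineq norm_triangle_ineq4 order_trans add_right_mono)
      also have "\<dots> < e" using v(2)[rule_format, of y] v(2)[rule_format, of x] d(2)[of y] that x e by auto
      finally show ?thesis by (simp add: dist_norm)
    qed
    then show "eventually (\<lambda>y. dist (w y) (w x) < e) (at_right x)"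
      unfolding eventually_at_right_field using x d(1) by (intro exI[of _ "min T (x + d)"]) auto
  qed
  have left: "\<exists>l. (w \<longlongrightarrow> l) (at_left x)" if x: "x \<in> {0<..T}" for x
  proof (rule limit_exists_if_Cauchy)
    fix e :: real assume e: "e > 0"
    then obtain v where v: "v \<in> regulated_right T" "\<forall>t\<in>{0..T}. norm (w t - v t) \<le> e/8"
      using assms[of "e/8"] by auto
    have e8: "e / 8 > 0" using e by simp
    obtain d l where d: "d > 0" "\<And>y. x - d < y \<Longrightarrow> y < x \<Longrightarrow> 0 \<le> y \<Longrightarrow> norm (v y - l) < e/8"
      using regulated_local_left[OF regulated_right_imp_regulated[OF v(1)] e8, of x] x by auto
    have near: "norm (w y - l) < e / 4" if "max 0 (x - d) < y" "y < x" for y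
    proof -
      have "norm (w y - l) \<le> norm (w y - v y) + norm (v y - l)"
        using norm_triangle_ineq[of "w y - v y" "v y - l"] by simp
      also have "\<dots> < e / 4" using v(2)[rule_format, of y] d(2)[of y] that x by auto
      finally show ?thesis .
    qed
    have "dist (w y) (w z) < e" if "max 0 (x - d) < y \<and> y < x" "max 0 (x - d) < z \<and> z < x" for y z
      using near[of y] near[of z] norm_triangle_ineq4[of "w y - l" "w z - l"] that e by (simp add: dist_norm)
    moreover have "eventually (\<lambda>y. max 0 (x - d) < y \<and> y < x) (at_left x)"
      unfolding eventually_at_left_field using x d(1) by (intro exI[of _ "max 0 (x - d)"]) auto
    ultimately show "\<exists>P. eventually P (at_left x) \<and> (\<forall>y z. P y \<and> P z \<longrightarrow> dist (w y) (w z) < e)"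
      by (intro exI[of _ "\<lambda>y. max 0 (x - d) < y \<and> y < x"]) blast
  qed simp
  show ?thesis unfolding regulated_right_def regulated_def using left right by blast
qed

section \<open>The Kurzweil--Stieltjes integral\<close>

lemma tagged_division_memE:
  fixes a b x :: real
  assumes "p tagged_division_of {a..b}" "(x, J) \<in> p"
  obtains c d where "J = {c..d}" "a \<le> c" "c \<le> x" "x \<le> d" "d \<le> b"
proof -
  obtain c d where J: "J = {c..d}"
    using tagged_division_ofD(4)[OF assms] by auto
  have "x \<in> J" "J \<subseteq> {a..b}"
    using tagged_division_ofD(2,3)[OF assms] by auto
  then show ?thesis using J that by auto
qed

lemma tagged_division_telescope:
  fixes H :: "real \<Rightarrow> real"
  assumes "0 \<le> T" "p tagged_division_of {0..T}"
  shows "(\<Sum>(x, J)\<in>p. H (Sup J) - H (Inf J)) = H T - H 0"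
  using additive_tagged_division_1[OF assms] .

text \<open>If each summand over a short interval is at most the increment of \<open>H\<close>, a fine Riemann sum
  telescopes.  An error at a single tag is paid for by a small jump of \<open>H\<close> at that tag, which avoids
  counting the intervals that share it.\<close>

lemma straddle:
  fixes A :: "real \<Rightarrow> real \<Rightarrow> real \<Rightarrow> real"
  assumes T: "0 \<le> T"
    and loc: "\<And>x. x \<in> {0..T} \<Longrightarrow> \<exists>\<delta>>0. \<forall>c d. 0 \<le> c \<and> c \<le> x \<and> x \<le> d \<and> d \<le> T \<and> x - c < \<delta> \<and> d - x < \<delta>
       \<longrightarrow> A x c d \<le> H d - H c"
  obtains \<gamma> where "gauge \<gamma>"
    "\<And>p. p tagged_division_of {0..T} \<Longrightarrow> \<gamma> fine p \<Longrightarrow> (\<Sum>(x, J)\<in>p. A x (Inf J) (Sup J)) \<le> H T - H 0"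
proof -
  obtain \<delta> where \<delta>: "\<And>x. x \<in> {0..T} \<Longrightarrow> \<delta> x > 0"
    "\<And>x c d. x \<in> {0..T} \<Longrightarrow> 0 \<le> c \<Longrightarrow> c \<le> x \<Longrightarrow> x \<le> d \<Longrightarrow> d \<le> T \<Longrightarrow> x - c < \<delta> x \<Longrightarrow> d - x < \<delta> x
       \<Longrightarrow> A x c d \<le> H d - H c"
    using loc by metis
  define \<gamma> where "\<gamma> = (\<lambda>x. ball x (if x \<in> {0..T} then \<delta> x else 1))"
  show ?thesis
  proof (rule that[of \<gamma>])
    show "gauge \<gamma>" unfolding \<gamma>_def by (rule gauge_ball_dependent) (use \<delta>(1) in auto)
    fix p assume p: "p tagged_division_of {0..T}" "\<gamma> fine p"
    have "(\<Sum>(x, J)\<in>p. A x (Inf J) (Sup J)) \<le> (\<Sum>(x, J)\<in>p. H (Sup J) - H (Inf J))"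
    proof (rule sum_mono, clarify)
      fix x J assume xJ: "(x, J) \<in> p"
      obtain c d where J: "J = {c..d}" "0 \<le> c" "c \<le> x" "x \<le> d" "d \<le> T"
        using tagged_division_memE[OF p(1) xJ] .
      have "J \<subseteq> ball x (\<delta> x)" using fineD[OF p(2) xJ] J by (auto simp: \<gamma>_def)
      moreover have "c \<in> J" "d \<in> J" using J by auto
      ultimately have "c \<in> ball x (\<delta> x)" "d \<in> ball x (\<delta> x)" by blast+
      then show "A x (Inf J) (Sup J) \<le> H (Sup J) - H (Inf J)"
        using \<delta>(2)[of x c d] J by (auto simp: dist_real_def)
    qed
    then show "(\<Sum>(x, J)\<in>p. A x (Inf J) (Sup J)) \<le> H T - H 0"
      using tagged_division_telescope[OF T p(1)] by simp
  qed
qed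

lemma has_KS_integralD:
  assumes "has_KS_integral f g a b I" "\<epsilon> > 0"
  obtains \<gamma> where "gauge \<gamma>"
    "\<And>p. p tagged_division_of {a..b} \<Longrightarrow> \<gamma> fine p \<Longrightarrow>
       \<bar>(\<Sum>(x, J)\<in>p. f x * (g (Sup J) - g (Inf J))) - I\<bar> < \<epsilon>"
proof -
  obtain \<gamma> where "gauge \<gamma> \<and> (\<forall>p. p tagged_division_of {a..b} \<and> \<gamma> fine p \<longrightarrow>
       \<bar>(\<Sum>(x, J)\<in>p. f x * (g (Sup J) - g (Inf J))) - I\<bar> < \<epsilon>)"
    using assms(1)[unfolded has_KS_integral_def, rule_format, OF assms(2)] ..
  then show ?thesis using that[of \<gamma>] by blast
qed

lemma fine_common:
  assumes "gauge \<gamma>" "gauge \<gamma>'"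
  obtains p where "p tagged_division_of {a..b::real}" "\<gamma> fine p" "\<gamma>' fine p"
  using fine_division_exists_real[OF gauge_Int[OF assms], of a b] unfolding fine_Int by metis

text \<open>Here \<open>H\<close> is the indefinite integral and \<open>V\<close> collects the errors.\<close>

lemma has_KS_integral_straddle:
  assumes T: "0 \<le> T"
    and loc: "\<And>\<epsilon>. \<epsilon> > 0 \<Longrightarrow> \<exists>V. V T - V 0 < \<epsilon> \<and> (\<forall>x\<in>{0..T}. \<exists>\<delta>>0. \<forall>c d.
       0 \<le> c \<and> c \<le> x \<and> x \<le> d \<and> d \<le> T \<and> x - c < \<delta> \<and> d - x < \<delta>
       \<longrightarrow> \<bar>f x * (g d - g c) - (H d - H c)\<bar> \<le> V d - V c)"
  shows "has_KS_integral f g 0 T (H T - H 0)"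
  unfolding has_KS_integral_def
proof (intro allI impI)
  fix \<epsilon> :: real assume "\<epsilon> > 0"
  from loc[OF this] obtain V where V: "V T - V 0 < \<epsilon>"
    and l: "\<And>x. x \<in> {0..T} \<Longrightarrow> \<exists>\<delta>>0. \<forall>c d.
       0 \<le> c \<and> c \<le> x \<and> x \<le> d \<and> d \<le> T \<and> x - c < \<delta> \<and> d - x < \<delta>
       \<longrightarrow> \<bar>f x * (g d - g c) - (H d - H c)\<bar> \<le> V d - V c" by blast
  let ?A = "\<lambda>x c d. \<bar>f x * (g d - g c) - (H d - H c)\<bar>"
  obtain \<gamma> where \<gamma>: "gauge \<gamma>" "\<And>p. p tagged_division_of {0..T} \<Longrightarrow> \<gamma> fine p \<Longrightarrow>
      (\<Sum>(x, J)\<in>p. ?A x (Inf J) (Sup J)) \<le> V T - V 0"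
    using straddle[where A="?A" and H=V, OF T l] by blast
  show "\<exists>\<gamma>. gauge \<gamma> \<and> (\<forall>p. p tagged_division_of {0..T} \<and> \<gamma> fine p \<longrightarrow>
      \<bar>(\<Sum>(x, J)\<in>p. f x * (g (Sup J) - g (Inf J))) - (H T - H 0)\<bar> < \<epsilon>)"
  proof (intro exI[of _ \<gamma>] conjI allI impI \<gamma>(1), elim conjE)
    fix p assume p: "p tagged_division_of {0..T}" "\<gamma> fine p"
    have "(\<Sum>(x, J)\<in>p. f x * (g (Sup J) - g (Inf J))) - (H T - H 0)
        = (\<Sum>(x, J)\<in>p. f x * (g (Sup J) - g (Inf J)) - (H (Sup J) - H (Inf J)))"
      unfolding tagged_division_telescope[OF T p(1), of H, symmetric]
      by (simp add: sum_subtractf case_prod_beta)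
    also have "\<bar>\<dots>\<bar> \<le> (\<Sum>(x, J)\<in>p. ?A x (Inf J) (Sup J))"
      by (rule order_trans[OF sum_abs]) (simp add: case_prod_beta)
    also have "\<dots> < \<epsilon>" using \<gamma>(2)[OF p] V by simp
    finally show "\<bar>(\<Sum>(x, J)\<in>p. f x * (g (Sup J) - g (Inf J))) - (H T - H 0)\<bar> < \<epsilon>" .
  qed
qed

lemma has_KS_integral_zero: "has_KS_integral (\<lambda>x. 0) g a b 0"
  unfolding has_KS_integral_def by (auto intro!: exI[of _ "\<lambda>x. ball x 1"] gauge_ball)

lemma has_KS_integral_add:
  assumes "has_KS_integral f1 g a b I1" "has_KS_integral f2 g a b I2"
  shows "has_KS_integral (\<lambda>x. f1 x + f2 x) g a b (I1 + I2)"
  unfolding has_KS_integral_def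
proof (intro allI impI)
  fix \<epsilon> :: real assume "\<epsilon> > 0"
  then have e2: "\<epsilon> / 2 > 0" by simp
  obtain \<gamma>1 where \<gamma>1: "gauge \<gamma>1" "\<And>p. p tagged_division_of {a..b} \<Longrightarrow> \<gamma>1 fine p \<Longrightarrow>
       \<bar>(\<Sum>(x, J)\<in>p. f1 x * (g (Sup J) - g (Inf J))) - I1\<bar> < \<epsilon>/2"
    using has_KS_integralD[OF assms(1) e2] by blast
  obtain \<gamma>2 where \<gamma>2: "gauge \<gamma>2" "\<And>p. p tagged_division_of {a..b} \<Longrightarrow> \<gamma>2 fine p \<Longrightarrow>
       \<bar>(\<Sum>(x, J)\<in>p. f2 x * (g (Sup J) - g (Inf J))) - I2\<bar> < \<epsilon>/2"
    using has_KS_integralD[OF assms(2) e2] by blast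
  show "\<exists>\<gamma>. gauge \<gamma> \<and> (\<forall>p. p tagged_division_of {a..b} \<and> \<gamma> fine p \<longrightarrow>
      \<bar>(\<Sum>(x, J)\<in>p. (f1 x + f2 x) * (g (Sup J) - g (Inf J))) - (I1 + I2)\<bar> < \<epsilon>)"
  proof (intro exI[of _ "\<lambda>x. \<gamma>1 x \<inter> \<gamma>2 x"] conjI allI impI gauge_Int \<gamma>1(1) \<gamma>2(1), elim conjE)
    fix p assume p: "p tagged_division_of {a..b}" "(\<lambda>x. \<gamma>1 x \<inter> \<gamma>2 x) fine p"
    have "(\<Sum>(x, J)\<in>p. (f1 x + f2 x) * (g (Sup J) - g (Inf J)))
        = (\<Sum>(x, J)\<in>p. f1 x * (g (Sup J) - g (Inf J))) + (\<Sum>(x, J)\<in>p. f2 x * (g (Sup J) - g (Inf J)))"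
      by (simp add: sum.distrib case_prod_beta distrib_right)
    then show "\<bar>(\<Sum>(x, J)\<in>p. (f1 x + f2 x) * (g (Sup J) - g (Inf J))) - (I1 + I2)\<bar> < \<epsilon>"
      using \<gamma>1(2)[OF p(1)] \<gamma>2(2)[OF p(1)] p(2) by (auto simp: fine_Int abs_if split: if_splits)
  qed
qed

lemma has_KS_integral_mult:
  assumes "has_KS_integral f g a b I"
  shows "has_KS_integral (\<lambda>x. k * f x) g a b (k * I)"
  unfolding has_KS_integral_def
proof (intro allI impI)
  fix \<epsilon> :: real assume e: "\<epsilon> > 0"
  then have e2: "\<epsilon> / (\<bar>k\<bar> + 1) > 0" by (simp add: add_nonneg_pos)
  obtain \<gamma> where \<gamma>: "gauge \<gamma>" "\<And>p. p tagged_division_of {a..b} \<Longrightarrow> \<gamma> fine p \<Longrightarrow>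
       \<bar>(\<Sum>(x, J)\<in>p. f x * (g (Sup J) - g (Inf J))) - I\<bar> < \<epsilon> / (\<bar>k\<bar> + 1)"
    using has_KS_integralD[OF assms e2] by blast
  show "\<exists>\<gamma>. gauge \<gamma> \<and> (\<forall>p. p tagged_division_of {a..b} \<and> \<gamma> fine p \<longrightarrow>
      \<bar>(\<Sum>(x, J)\<in>p. (k * f x) * (g (Sup J) - g (Inf J))) - k * I\<bar> < \<epsilon>)"
  proof (intro exI[of _ \<gamma>] conjI allI impI \<gamma>(1), elim conjE)
    fix p assume p: "p tagged_division_of {a..b}" "\<gamma> fine p"
    let ?S = "(\<Sum>(x, J)\<in>p. f x * (g (Sup J) - g (Inf J)))"
    have "(\<Sum>(x, J)\<in>p. (k * f x) * (g (Sup J) - g (Inf J))) - k * I = k * (?S - I)"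
      by (simp add: sum_distrib_left case_prod_beta mult.assoc right_diff_distrib)
    moreover have "\<bar>k * (?S - I)\<bar> \<le> (\<bar>k\<bar> + 1) * \<bar>?S - I\<bar>"
      by (simp add: abs_mult mult_right_mono)
    moreover have "(\<bar>k\<bar> + 1) * \<bar>?S - I\<bar> < \<epsilon>"
      using \<gamma>(2)[OF p] by (simp add: pos_less_divide_eq mult.commute add_nonneg_pos)
    ultimately show "\<bar>(\<Sum>(x, J)\<in>p. (k * f x) * (g (Sup J) - g (Inf J))) - k * I\<bar> < \<epsilon>" by simp
  qed
qed

text \<open>Two integrators are treated at once because the inequalities for two competing plays can only be
  exploited after they have been added.\<close>

lemma has_KS_integral_straddle_le:
  assumes T: "0 \<le> T"
    and 1: "has_KS_integral f1 g1 0 T I1" and 2: "has_KS_integral f2 g2 0 T I2"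
    and loc: "\<And>x. x \<in> {0..T} \<Longrightarrow> \<exists>\<delta>>0. \<forall>c d. 0 \<le> c \<and> c \<le> x \<and> x \<le> d \<and> d \<le> T \<and> x - c < \<delta> \<and> d - x < \<delta>
       \<longrightarrow> f1 x * (g1 d - g1 c) + f2 x * (g2 d - g2 c) \<le> H d - H c"
  shows "I1 + I2 \<le> H T - H 0"
proof (rule field_le_epsilon)
  fix \<epsilon> :: real assume "\<epsilon> > 0"
  then have e2: "\<epsilon> / 2 > 0" by simp
  obtain \<gamma>1 where \<gamma>1: "gauge \<gamma>1" "\<And>p. p tagged_division_of {0..T} \<Longrightarrow> \<gamma>1 fine p \<Longrightarrow>
       \<bar>(\<Sum>(x, J)\<in>p. f1 x * (g1 (Sup J) - g1 (Inf J))) - I1\<bar> < \<epsilon>/2"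
    using has_KS_integralD[OF 1 e2] by blast
  obtain \<gamma>2 where \<gamma>2: "gauge \<gamma>2" "\<And>p. p tagged_division_of {0..T} \<Longrightarrow> \<gamma>2 fine p \<Longrightarrow>
       \<bar>(\<Sum>(x, J)\<in>p. f2 x * (g2 (Sup J) - g2 (Inf J))) - I2\<bar> < \<epsilon>/2"
    using has_KS_integralD[OF 2 e2] by blast
  let ?A = "\<lambda>x c d. f1 x * (g1 d - g1 c) + f2 x * (g2 d - g2 c)"
  obtain \<gamma> where \<gamma>: "gauge \<gamma>" "\<And>p. p tagged_division_of {0..T} \<Longrightarrow> \<gamma> fine p \<Longrightarrow>
      (\<Sum>(x, J)\<in>p. ?A x (Inf J) (Sup J)) \<le> H T - H 0"
    using straddle[where A="?A" and H=H, OF T loc] by blast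
  obtain p where p: "p tagged_division_of {0..T}" "\<gamma> fine p" "(\<lambda>x. \<gamma>1 x \<inter> \<gamma>2 x) fine p"
    using fine_common[OF \<gamma>(1) gauge_Int[OF \<gamma>1(1) \<gamma>2(1)]] .
  have "(\<Sum>(x, J)\<in>p. ?A x (Inf J) (Sup J))
     = (\<Sum>(x, J)\<in>p. f1 x * (g1 (Sup J) - g1 (Inf J))) + (\<Sum>(x, J)\<in>p. f2 x * (g2 (Sup J) - g2 (Inf J)))"
    by (simp add: sum.distrib case_prod_beta)
  moreover have "\<gamma>1 fine p" "\<gamma>2 fine p" using p(3) by (auto simp: fine_Int)
  ultimately show "I1 + I2 \<le> H T - H 0 + \<epsilon>"
    using \<gamma>(2)[OF p(1,2)] \<gamma>1(2)[OF p(1)] \<gamma>2(2)[OF p(1)] by linarith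
qed

text \<open>For sums over tagged divisions a dominating function is handier than a supremum over partitions,
  because its increments telescope.\<close>

definition increments_dominated :: "real \<Rightarrow> (real \<Rightarrow> real) \<Rightarrow> (real \<Rightarrow> real) \<Rightarrow> bool" where
  "increments_dominated T g V \<longleftrightarrow> (\<forall>c d. 0 \<le> c \<and> c \<le> d \<and> d \<le> T \<longrightarrow> \<bar>g d - g c\<bar> \<le> V d - V c)"

lemma increments_dominatedD:
  "increments_dominated T g V \<Longrightarrow> 0 \<le> c \<Longrightarrow> c \<le> d \<Longrightarrow> d \<le> T \<Longrightarrow> \<bar>g d - g c\<bar> \<le> V d - V c"
  by (simp add: increments_dominated_def)

lemma increments_dominated_imp_bounded_var:
  assumes "increments_dominated T g V"
  shows "g \<in> bounded_var T"
  unfolding bounded_var_def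
proof (intro CollectI exI[of _ "V T - V 0"] allI impI, elim conjE)
  fix n and s :: "nat \<Rightarrow> real"
  assume s: "s 0 = 0" "s n = T" "\<forall>i<n. s i \<le> s (Suc i)"
  have mono: "s i \<le> s j" if "i \<le> j" "j \<le> n" for i j
    using that by (induction j rule: dec_induct) (use s(3) in \<open>auto intro: order_trans\<close>)
  have "(\<Sum>i<n. \<bar>g (s (Suc i)) - g (s i)\<bar>) \<le> (\<Sum>i<n. V (s (Suc i)) - V (s i))"
    using mono[of 0] mono[of _ n] s by (intro sum_mono increments_dominatedD[OF assms]) auto
  also have "\<dots> = V T - V 0" using s(1,2) sum_lessThan_telescope[of "\<lambda>i. V (s i)" n] by simp
  finally show "(\<Sum>i<n. \<bar>g (s (Suc i)) - g (s i)\<bar>) \<le> V T - V 0" .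
qed

text \<open>The variation function works: appending the point \<open>d\<close> to a partition of \<open>[0,c]\<close> gives a partition
  of \<open>[0,d]\<close>.\<close>

lemma bounded_var_imp_increments_dominated:
  assumes "g \<in> bounded_var T"
  obtains V where "increments_dominated T g V"
proof -
  obtain C where C: "\<And>n s. s 0 = 0 \<Longrightarrow> s n = T \<Longrightarrow> \<forall>i<n. s i \<le> s (Suc i) \<Longrightarrow>
      (\<Sum>i<n. \<bar>g (s (Suc i)) - g (s i)\<bar>) \<le> C" for s :: "nat \<Rightarrow> real"
    using assms unfolding bounded_var_def by blast
  define W where "W t = {(\<Sum>i<n. \<bar>g (s (Suc i)) - g (s i)\<bar>) | n s. s 0 = 0 \<and> s n = t \<and> (\<forall>i<n. s i \<le> s (Suc i))}" for t
  have ext: "x + \<bar>g d - g c\<bar> \<in> W d" if x: "x \<in> W c" and cd: "c \<le> d" for x c d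
  proof -
    obtain n s where s: "x = (\<Sum>i<n. \<bar>g (s (Suc i)) - g (s i)\<bar>)" "s 0 = 0" "s n = c" "\<forall>i<n. s i \<le> s (Suc i)"
      using x unfolding W_def by blast
    define s' where "s' = s(Suc n := d)"
    have "x + \<bar>g d - g c\<bar> = (\<Sum>i<Suc n. \<bar>g (s' (Suc i)) - g (s' i)\<bar>)"
      using s by (simp add: s'_def)
    moreover have "s' 0 = 0" "s' (Suc n) = d" "\<forall>i<Suc n. s' i \<le> s' (Suc i)"
      using s cd by (auto simp: s'_def less_Suc_eq)
    ultimately show ?thesis unfolding W_def by blast
  qed
  have bdd: "bdd_above (W t)" if "t \<le> T" for t
  proof (rule bdd_aboveI[of _ C])
    fix x assume "x \<in> W t"
    from ext[OF this that] have "x + \<bar>g T - g t\<bar> \<le> C" unfolding W_def using C by auto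
    then show "x \<le> C" by linarith
  qed
  have ne: "W t \<noteq> {}" if "0 \<le> t" for t
  proof -
    have "0 \<in> W 0" unfolding W_def by (auto intro!: exI[of _ 0] exI[of _ "\<lambda>_. 0"])
    from ext[OF this that] show ?thesis by blast
  qed
  have "increments_dominated T g (\<lambda>t. Sup (W t))"
    unfolding increments_dominated_def
  proof (intro allI impI, elim conjE)
    fix c d assume cd: "0 \<le> c" "c \<le> d" "d \<le> T"
    have "Sup (W c) \<le> Sup (W d) - \<bar>g d - g c\<bar>"
    proof (rule cSup_least[OF ne[OF cd(1)]])
      fix x assume "x \<in> W c"
      from cSup_upper[OF ext[OF this cd(2)] bdd[OF cd(3)]] show "x \<le> Sup (W d) - \<bar>g d - g c\<bar>" by simp
    qed
    then show "\<bar>g d - g c\<bar> \<le> Sup (W d) - Sup (W c)" by simp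
  qed
  then show ?thesis by (rule that)
qed

text \<open>The indefinite integral follows \<open>g\<close> up to \<open>t\<close> and then stays at the left limit of \<open>g\<close> at \<open>t\<close>.\<close>

lemma has_KS_integral_lessThan:
  assumes g: "g \<in> regulated_right T" and t: "0 \<le> t" "t \<le> T"
  shows "\<exists>I. has_KS_integral (indicator {..<t}) g 0 T I"
proof -
  have T: "0 \<le> T" using t by simp
  obtain l where l: "\<And>e. e > 0 \<Longrightarrow> \<exists>d>0. \<forall>y. t - d < y \<and> y < t \<and> 0 \<le> y \<longrightarrow> \<bar>g y - l\<bar> < e"
    using regulated_left_limit[OF regulated_right_imp_regulated[OF g] t] unfolding real_norm_def by metis
  define H where "H y = (if y < t then g y else l)" for y
  have "has_KS_integral (indicator {..<t}) g 0 T (H T - H 0)"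
  proof (rule has_KS_integral_straddle[OF T])
    fix \<epsilon> :: real assume e: "\<epsilon> > 0"
    define V where "V y = \<epsilon> / 2 * of_bool (t \<le> y)" for y
    have "V T - V 0 < \<epsilon>" using e t by (auto simp: V_def)
    moreover have "\<exists>\<delta>>0. \<forall>c d. 0 \<le> c \<and> c \<le> x \<and> x \<le> d \<and> d \<le> T \<and> x - c < \<delta> \<and> d - x < \<delta>
       \<longrightarrow> \<bar>indicator {..<t} x * (g d - g c) - (H d - H c)\<bar> \<le> V d - V c" if x: "x \<in> {0..T}" for x
    proof -
      consider "x < t" | "x = t" | "x > t" by linarith
      then show ?thesis
      proof cases
        case 1
        then show ?thesis by (intro exI[of _ "t - x"]) (auto simp: H_def V_def)
      next
        case 2
        obtain d where d: "d > 0" "\<forall>y. t - d < y \<and> y < t \<and> 0 \<le> y \<longrightarrow> \<bar>g y - l\<bar> < \<epsilon>/2"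
          using l[of "\<epsilon>/2"] e by auto
        have "\<bar>indicator {..<t} x * (g d' - g c) - (H d' - H c)\<bar> \<le> V d' - V c"
          if "0 \<le> c" "c \<le> x" "x \<le> d'" "x - c < d" for c d'
          using d(2)[rule_format, of c] that 2 e
          by (cases "c = t") (auto simp: H_def V_def abs_minus_commute)
        then show ?thesis using d(1) by blast
      next
        case 3
        then show ?thesis by (intro exI[of _ "x - t"]) (auto simp: H_def V_def)
      qed
    qed
    ultimately show "\<exists>V. V T - V 0 < \<epsilon> \<and> (\<forall>x\<in>{0..T}. \<exists>\<delta>>0. \<forall>c d. 0 \<le> c \<and> c \<le> x \<and> x \<le> d \<and> d \<le> T \<and> x - c < \<delta> \<and> d - x < \<delta>
       \<longrightarrow> \<bar>indicator {..<t} x * (g d - g c) - (H d - H c)\<bar> \<le> V d - V c)" by blast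
  qed
  then show ?thesis by blast
qed

text \<open>Since \<open>g\<close> is right-continuous, the integral is the jump of \<open>g\<close> from its left limit at \<open>t\<close>.\<close>

lemma has_KS_integral_singleton:
  assumes g: "g \<in> regulated_right T" and t: "0 \<le> t" "t \<le> T"
  shows "\<exists>I. has_KS_integral (indicator {t}) g 0 T I"
proof -
  have T: "0 \<le> T" using t by simp
  obtain l where l: "\<And>e. e > 0 \<Longrightarrow> \<exists>d>0. \<forall>y. t - d < y \<and> y < t \<and> 0 \<le> y \<longrightarrow> \<bar>g y - l\<bar> < e"
    using regulated_left_limit[OF regulated_right_imp_regulated[OF g] t] unfolding real_norm_def by metis
  define H where "H y = (if y < t then 0 else g t - l)" for y
  have "has_KS_integral (indicator {t}) g 0 T (H T - H 0)"
  proof (rule has_KS_integral_straddle[OF T])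
    fix \<epsilon> :: real assume e: "\<epsilon> > 0"
    define V where "V y = \<epsilon> / 3 * (of_bool (t \<le> y) + of_bool (t < y))" for y
    have "V T - V 0 < \<epsilon>" using e t by (auto simp: V_def)
    moreover have "\<exists>\<delta>>0. \<forall>c d. 0 \<le> c \<and> c \<le> x \<and> x \<le> d \<and> d \<le> T \<and> x - c < \<delta> \<and> d - x < \<delta>
       \<longrightarrow> \<bar>indicator {t} x * (g d - g c) - (H d - H c)\<bar> \<le> V d - V c" if x: "x \<in> {0..T}" for x
    proof -
      consider "x < t" | "x = t" | "x > t" by linarith
      then show ?thesis
      proof cases
        case 1
        then show ?thesis by (intro exI[of _ "t - x"]) (auto simp: H_def V_def)
      next
        case 2
        obtain d1 where d1: "d1 > 0" "\<And>y. t - d1 < y \<Longrightarrow> y < t \<Longrightarrow> 0 \<le> y \<Longrightarrow> \<bar>g y - l\<bar> < \<epsilon>/3"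
          using l[of "\<epsilon>/3"] e by auto
        obtain d2 where d2: "d2 > 0" "\<And>y. t \<le> y \<Longrightarrow> y < t + d2 \<Longrightarrow> y \<le> T \<Longrightarrow> \<bar>g y - g t\<bar> < \<epsilon>/3"
          using regulated_right_continuous[OF g _ t(1), of "\<epsilon>/3"] e by auto
        have "\<bar>indicator {t} x * (g d - g c) - (H d - H c)\<bar> \<le> V d - V c"
          if "0 \<le> c" "c \<le> x" "x \<le> d" "d \<le> T" "x - c < min d1 d2" "d - x < min d1 d2" for c d
          using d1(2)[of c] d2(2)[of d] that 2 e
          by (cases "c = t"; cases "d = t") (auto simp: H_def V_def abs_if split: if_splits)
        then show ?thesis using d1(1) d2(1) by (intro exI[of _ "min d1 d2"]) auto
      next
        case 3
        then show ?thesis by (intro exI[of _ "x - t"]) (auto simp: H_def V_def)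
      qed
    qed
    ultimately show "\<exists>V. V T - V 0 < \<epsilon> \<and> (\<forall>x\<in>{0..T}. \<exists>\<delta>>0. \<forall>c d. 0 \<le> c \<and> c \<le> x \<and> x \<le> d \<and> d \<le> T \<and> x - c < \<delta> \<and> d - x < \<delta>
       \<longrightarrow> \<bar>indicator {t} x * (g d - g c) - (H d - H c)\<bar> \<le> V d - V c)" by blast
  qed
  then show ?thesis by blast
qed

lemma Riemann_sum_bound:
  assumes dom: "increments_dominated T g V" and T: "0 \<le> T" and f: "\<And>x. x \<in> {0..T} \<Longrightarrow> \<bar>f x\<bar> \<le> e"
    and p: "p tagged_division_of {0..T}"
  shows "\<bar>\<Sum>(x, J)\<in>p. f x * (g (Sup J) - g (Inf J))\<bar> \<le> e * (V T - V 0)"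
proof -
  have "\<bar>\<Sum>(x, J)\<in>p. f x * (g (Sup J) - g (Inf J))\<bar> \<le> (\<Sum>(x, J)\<in>p. \<bar>f x * (g (Sup J) - g (Inf J))\<bar>)"
    by (rule order_trans[OF sum_abs]) (simp add: case_prod_beta)
  also have "\<dots> \<le> (\<Sum>(x, J)\<in>p. e * V (Sup J) - e * V (Inf J))"
  proof (rule sum_mono, clarify)
    fix x J assume xJ: "(x, J) \<in> p"
    obtain c d where J: "J = {c..d}" "0 \<le> c" "c \<le> x" "x \<le> d" "d \<le> T"
      using tagged_division_memE[OF p xJ] .
    have "\<bar>f x * (g d - g c)\<bar> \<le> e * (V d - V c)"
      unfolding abs_mult using f[of x] J increments_dominatedD[OF dom, of c d] by (intro mult_mono) auto
    then show "\<bar>f x * (g (Sup J) - g (Inf J))\<bar> \<le> e * V (Sup J) - e * V (Inf J)"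
      using J by (simp add: right_diff_distrib)
  qed
  also have "\<dots> = e * (V T - V 0)"
    using tagged_division_telescope[OF T p, of "\<lambda>y. e * V y"] by (simp add: right_diff_distrib)
  finally show ?thesis .
qed

lemma has_KS_integral_uniform_limit:
  assumes dom: "increments_dominated T g V" and T: "0 \<le> T"
    and approx: "\<And>e. e > 0 \<Longrightarrow> \<exists>\<phi> I. has_KS_integral \<phi> g 0 T I \<and> (\<forall>x\<in>{0..T}. \<bar>f x - \<phi> x\<bar> \<le> e)"
  shows "\<exists>I. has_KS_integral f g 0 T I"
proof -
  define W where "W = V T - V 0"
  have W: "W \<ge> 0" using increments_dominatedD[OF dom, of 0 T] T by (auto simp: W_def)
  have close: "\<bar>I1 - I2\<bar> \<le> (e1 + e2) * W"
    if 1: "has_KS_integral \<phi>1 g 0 T I1" "\<forall>x\<in>{0..T}. \<bar>f x - \<phi>1 x\<bar> \<le> e1"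
      and 2: "has_KS_integral \<phi>2 g 0 T I2" "\<forall>x\<in>{0..T}. \<bar>f x - \<phi>2 x\<bar> \<le> e2" for \<phi>1 \<phi>2 I1 I2 e1 e2
  proof (rule field_le_epsilon)
    fix \<epsilon> :: real assume e: "\<epsilon> > 0"
    have D: "has_KS_integral (\<lambda>x. \<phi>1 x + (-1) * \<phi>2 x) g 0 T (I1 + (-1) * I2)"
      by (intro has_KS_integral_add has_KS_integral_mult 1 2)
    obtain \<gamma> where \<gamma>: "gauge \<gamma>" "\<And>p. p tagged_division_of {0..T} \<Longrightarrow> \<gamma> fine p \<Longrightarrow>
       \<bar>(\<Sum>(x, J)\<in>p. (\<phi>1 x + (-1) * \<phi>2 x) * (g (Sup J) - g (Inf J))) - (I1 + (-1) * I2)\<bar> < \<epsilon>"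
      using has_KS_integralD[OF D e] by blast
    obtain p where p: "p tagged_division_of {0..T}" "\<gamma> fine p"
      using fine_common[OF \<gamma>(1) \<gamma>(1)] .
    have "\<bar>\<Sum>(x, J)\<in>p. (\<phi>1 x + (-1) * \<phi>2 x) * (g (Sup J) - g (Inf J))\<bar> \<le> (e1 + e2) * W"
      unfolding W_def
    proof (rule Riemann_sum_bound[OF dom T _ p(1)])
      fix x assume "x \<in> {0..T}"
      then have "\<bar>f x - \<phi>1 x\<bar> \<le> e1" "\<bar>f x - \<phi>2 x\<bar> \<le> e2" using 1 2 by auto
      then show "\<bar>\<phi>1 x + (-1) * \<phi>2 x\<bar> \<le> e1 + e2" by linarith
    qed
    then show "\<bar>I1 - I2\<bar> \<le> (e1 + e2) * W + \<epsilon>" using \<gamma>(2)[OF p] by linarith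
  qed
  have "\<exists>\<phi> I. has_KS_integral \<phi> g 0 T I \<and> (\<forall>x\<in>{0..T}. \<bar>f x - \<phi> x\<bar> \<le> inverse (Suc n))" for n
    by (rule approx) simp
  then obtain \<phi> I where \<phi>: "\<And>n. has_KS_integral (\<phi> n) g 0 T (I n)"
    "\<And>n. \<forall>x\<in>{0..T}. \<bar>f x - \<phi> n x\<bar> \<le> inverse (real (Suc n))" by metis
  have small: "(\<lambda>n. inverse (real (Suc n))) \<longlonglongrightarrow> 0" by (rule LIMSEQ_inverse_real_of_nat)
  have ex: "\<exists>n. inverse (real (Suc n)) * W < e" if "e > 0" for e
  proof -
    have "(\<lambda>n. inverse (real (Suc n)) * W) \<longlonglongrightarrow> 0 * W" by (intro tendsto_intros small)
    then have "eventually (\<lambda>n. inverse (real (Suc n)) * W < e) sequentially"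
      using that by (simp add: order_tendstoD(2))
    then show ?thesis by (auto simp: eventually_sequentially)
  qed
  have "Cauchy I"
  proof (rule metric_CauchyI)
    fix e :: real assume "e > 0"
    then obtain N where N: "inverse (real (Suc N)) * W < e / 2" using ex[of "e/2"] by auto
    have "dist (I m) (I n) < e" if "m \<ge> N" "n \<ge> N" for m n
    proof -
      have "\<bar>I m - I n\<bar> \<le> (inverse (real (Suc m)) + inverse (real (Suc n))) * W"
        by (rule close[OF \<phi> \<phi>])
      also have "\<dots> \<le> (inverse (real (Suc N)) + inverse (real (Suc N))) * W"
        using that W by (intro mult_right_mono add_mono le_imp_inverse_le) auto
      also have "\<dots> < e" using N by (simp add: distrib_right)
      finally show ?thesis by (simp add: dist_real_def)
    qed
    then show "\<exists>M. \<forall>m\<ge>M. \<forall>n\<ge>M. dist (I m) (I n) < e" by blast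
  qed
  then obtain L where L: "I \<longlonglongrightarrow> L" using Cauchy_convergent convergent_def by blast
  have IL: "\<bar>I n - L\<bar> \<le> inverse (real (Suc n)) * W" for n
  proof (rule tendsto_le)
    show "(\<lambda>m. (inverse (real (Suc n)) + inverse (real (Suc m))) * W) \<longlonglongrightarrow> inverse (real (Suc n)) * W"
      by (rule tendsto_eq_intros small refl | simp)+
    show "(\<lambda>m. \<bar>I n - I m\<bar>) \<longlonglongrightarrow> \<bar>I n - L\<bar>" by (intro tendsto_intros L)
    show "\<forall>\<^sub>F m in sequentially. \<bar>I n - I m\<bar> \<le> (inverse (real (Suc n)) + inverse (real (Suc m))) * W"
      by (intro always_eventually allI close[OF \<phi> \<phi>])
  qed simp
  have "has_KS_integral f g 0 T L"
    unfolding has_KS_integral_def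
  proof (intro allI impI)
    fix \<epsilon> :: real assume "\<epsilon> > 0"
    then obtain n where n: "inverse (real (Suc n)) * W < \<epsilon> / 3" using ex[of "\<epsilon>/3"] by auto
    have e3: "\<epsilon> / 3 > 0" using \<open>\<epsilon> > 0\<close> by simp
    obtain \<gamma> where \<gamma>: "gauge \<gamma>" "\<And>p. p tagged_division_of {0..T} \<Longrightarrow> \<gamma> fine p \<Longrightarrow>
       \<bar>(\<Sum>(x, J)\<in>p. \<phi> n x * (g (Sup J) - g (Inf J))) - I n\<bar> < \<epsilon> / 3"
      using has_KS_integralD[OF \<phi>(1)[of n] e3] by blast
    show "\<exists>\<gamma>. gauge \<gamma> \<and> (\<forall>p. p tagged_division_of {0..T} \<and> \<gamma> fine p \<longrightarrow>
        \<bar>(\<Sum>(x, J)\<in>p. f x * (g (Sup J) - g (Inf J))) - L\<bar> < \<epsilon>)"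
    proof (intro exI[of _ \<gamma>] conjI allI impI \<gamma>(1), elim conjE)
      fix p assume p: "p tagged_division_of {0..T}" "\<gamma> fine p"
      have "\<bar>\<Sum>(x, J)\<in>p. (f x - \<phi> n x) * (g (Sup J) - g (Inf J))\<bar> \<le> inverse (real (Suc n)) * W"
        unfolding W_def by (rule Riemann_sum_bound[OF dom T _ p(1)]) (use \<phi>(2) in auto)
      moreover have "(\<Sum>(x, J)\<in>p. (f x - \<phi> n x) * (g (Sup J) - g (Inf J)))
         = (\<Sum>(x, J)\<in>p. f x * (g (Sup J) - g (Inf J))) - (\<Sum>(x, J)\<in>p. \<phi> n x * (g (Sup J) - g (Inf J)))"
        by (simp add: sum_subtractf case_prod_beta left_diff_distrib)
      ultimately show "\<bar>(\<Sum>(x, J)\<in>p. f x * (g (Sup J) - g (Inf J))) - L\<bar> < \<epsilon>"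
        using \<gamma>(2)[OF p] IL[of n] n by linarith
    qed
  qed
  then show ?thesis by blast
qed

text \<open>Next to each point a regulated function is almost constant on either side, so that it is a uniform
  limit of combinations of indicators of points and open intervals.\<close>

lemma has_KS_integral_regulated:
  fixes f :: "real \<Rightarrow> real"
  assumes f: "f \<in> regulated T" and g: "g \<in> regulated_right T"
    and dom: "increments_dominated T g V" and T: "0 \<le> T"
  shows "\<exists>I. has_KS_integral f g 0 T I"
proof (rule has_KS_integral_uniform_limit[OF dom T])
  fix e :: real assume e: "e > 0"
  let ?int = "\<lambda>\<phi>. \<exists>I. has_KS_integral \<phi> g 0 T I"
  have add: "?int (\<lambda>x. \<phi> x + \<phi>' x)" if "?int \<phi>" "?int \<phi>'" for \<phi> \<phi>'
    using that has_KS_integral_add by blast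
  have mult: "?int (\<lambda>x. k * \<phi> x)" if "?int \<phi>" for \<phi> k
    using that has_KS_integral_mult by blast
  have ivl: "?int (indicator {s<..<t})" if "0 \<le> s" "s \<le> t" "t \<le> T" for s t
  proof -
    show ?thesis
    proof (cases "s < t")
      case True
      then have eq: "indicator {s<..<t} = (\<lambda>x. indicator {..<t} x + ((-1) * indicator {..<s} x + (-1) * indicator {s} x :: real))"
        by (auto simp: fun_eq_iff indicator_def)
      show ?thesis
        unfolding eq using that
        by (intro add mult has_KS_integral_lessThan[OF g] has_KS_integral_singleton[OF g]) auto
    next
      case False
      then have "indicator {s<..<t} = (\<lambda>x. 0 :: real)" by auto
      then show ?thesis using has_KS_integral_zero by metis
    qed
  qed
  define P where "P a b \<longleftrightarrow> (0 \<le> a \<and> b \<le> T \<longrightarrow>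
    (\<exists>\<phi>. ?int \<phi> \<and> (\<forall>x\<in>{a..<b}. \<bar>f x - \<phi> x\<bar> \<le> e) \<and> (\<forall>x. x \<notin> {a..<b} \<longrightarrow> \<phi> x = 0)))" for a b
  have "P 0 T"
    using T
  proof (induction rule: Bolzano)
    case (trans a b c)
    show ?case
      unfolding P_def
    proof (intro impI, elim conjE)
      assume ac: "0 \<le> a" "c \<le> T"
      obtain \<phi> where \<phi>: "?int \<phi>" "\<forall>x\<in>{a..<b}. \<bar>f x - \<phi> x\<bar> \<le> e" "\<forall>x. x \<notin> {a..<b} \<longrightarrow> \<phi> x = 0"
        using trans(1,3,4) ac unfolding P_def by auto
      obtain \<phi>' where \<phi>': "?int \<phi>'" "\<forall>x\<in>{b..<c}. \<bar>f x - \<phi>' x\<bar> \<le> e" "\<forall>x. x \<notin> {b..<c} \<longrightarrow> \<phi>' x = 0"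
        using trans(2,3,4) ac unfolding P_def by auto
      show "\<exists>\<phi>. ?int \<phi> \<and> (\<forall>x\<in>{a..<c}. \<bar>f x - \<phi> x\<bar> \<le> e) \<and> (\<forall>x. x \<notin> {a..<c} \<longrightarrow> \<phi> x = 0)"
      proof (intro exI[of _ "\<lambda>x. \<phi> x + \<phi>' x"] conjI ballI allI impI)
        show "?int (\<lambda>x. \<phi> x + \<phi>' x)" by (rule add[OF \<phi>(1) \<phi>'(1)])
        show "\<bar>f x - (\<phi> x + \<phi>' x)\<bar> \<le> e" if "x \<in> {a..<c}" for x
        proof (cases "x < b")
          case True
          then have "\<phi>' x = 0" using \<phi>'(3) by auto
          then show ?thesis using \<phi>(2) True that by auto
        next
          case False
          then have "\<phi> x = 0" using \<phi>(3) by auto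
          then show ?thesis using \<phi>'(2) False that by auto
        qed
        show "\<phi> x + \<phi>' x = 0" if "x \<notin> {a..<c}" for x
          using \<phi>(3) \<phi>'(3) that trans(3,4) by auto
      qed
    qed
  next
    case (local x)
    obtain d l where d: "d > 0" "\<And>y. x - d < y \<Longrightarrow> y < x \<Longrightarrow> 0 \<le> y \<Longrightarrow> norm (f y - l) < e"
      using regulated_local_left[OF f e, of x] local by auto
    obtain d' l' where d': "d' > 0" "\<And>y. x < y \<Longrightarrow> y < x + d' \<Longrightarrow> y \<le> T \<Longrightarrow> norm (f y - l') < e"
      using regulated_local_right[OF f e, of x] local by auto
    have "P a b" if ab: "a \<le> x" "x \<le> b" "b - a < min d d'" for a b
      unfolding P_def
    proof (intro impI, elim conjE)
      assume ab': "0 \<le> a" "b \<le> T"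
      \<comment> \<open>The factors \<open>of_bool\<close> drop the point values when the half-open cell next to them is empty.\<close>
      let ?\<phi> = "\<lambda>y. (of_bool (a < x) * f a) * indicator {a} y + (l * indicator {a<..<x} y +
         ((of_bool (x < b) * f x) * indicator {x} y + l' * indicator {x<..<b} y))"
      show "\<exists>\<phi>. ?int \<phi> \<and> (\<forall>x\<in>{a..<b}. \<bar>f x - \<phi> x\<bar> \<le> e) \<and> (\<forall>x. x \<notin> {a..<b} \<longrightarrow> \<phi> x = 0)"
      proof (intro exI[of _ ?\<phi>] conjI ballI allI impI)
        show "?int ?\<phi>"
          using ab ab' by (intro add mult ivl has_KS_integral_singleton[OF g]) auto
        show "\<bar>f y - ?\<phi> y\<bar> \<le> e" if y: "y \<in> {a..<b}" for y
        proof -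
          consider "y = a" "y < x" | "a < y" "y < x" | "y = x" | "x < y" using y by fastforce
          then show ?thesis
          proof cases
            case 2
            then show ?thesis using d(2)[of y] ab ab' by auto
          next
            case 4
            then show ?thesis using d'(2)[of y] ab ab' y by auto
          qed (use y ab e in auto)
        qed
        show "?\<phi> y = 0" if "y \<notin> {a..<b}" for y
          using that ab by (auto simp: indicator_def)
      qed
    qed
    then show ?case using d(1) d'(1) by (intro exI[of _ "min d d'"]) auto
  qed
  then obtain \<phi> where \<phi>: "?int \<phi>" "\<forall>x\<in>{0..<T}. \<bar>f x - \<phi> x\<bar> \<le> e" "\<forall>x. x \<notin> {0..<T} \<longrightarrow> \<phi> x = 0"
    by (auto simp: P_def)
  have "?int (\<lambda>x. \<phi> x + f T * indicator {T} x)"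
    using T by (intro add mult \<phi>(1) has_KS_integral_singleton[OF g]) auto
  moreover have "\<bar>f x - (\<phi> x + f T * indicator {T} x)\<bar> \<le> e" if "x \<in> {0..T}" for x
    using \<phi>(2,3) that e by (cases "x = T") auto
  ultimately show "\<exists>\<phi> I. has_KS_integral \<phi> g 0 T I \<and> (\<forall>x\<in>{0..T}. \<bar>f x - \<phi> x\<bar> \<le> e)" by blast
qed

section \<open>The variational inequality determines the play\<close>

text \<open>Testing each of two solutions with the other one up to time \<open>t\<close> and adding the two inequalities, one
  finds that the integral of \<open>f\<close> against \<open>f = \<xi> - \<eta>\<close> over \<open>[0,t]\<close> is at most \<open>0\<close>.  For a
  right-continuous \<open>f\<close> it is at least \<open>(f(t)\<^sup>2 - f(0)\<^sup>2) / 2\<close>, because a jump adds half its square.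
  As \<open>f(0) = 0\<close>, also \<open>f(t) = 0\<close>.\<close>

lemma is_play_unique:
  assumes T: "0 \<le> T" and q: "q \<in> regulated_right T"
    and \<xi>: "is_play T r q \<xi>" and \<eta>: "is_play T r q \<eta>" and t: "t \<in> {0..T}"
  shows "\<xi> t = \<eta> t"
proof -
  have \<xi>_reg: "\<xi> \<in> regulated_right T" and \<eta>_reg: "\<eta> \<in> regulated_right T"
    and \<xi>_var: "\<xi> \<in> bounded_var T" and \<eta>_var: "\<eta> \<in> bounded_var T"
    and \<xi>_near: "\<And>t. t \<in> {0..T} \<Longrightarrow> \<bar>q t - \<xi> t\<bar> \<le> r" and \<eta>_near: "\<And>t. t \<in> {0..T} \<Longrightarrow> \<bar>q t - \<eta> t\<bar> \<le> r"
    and \<xi>_ineq: "\<And>z. z \<in> regulated T \<Longrightarrow> sup_norm 0 T z \<le> r \<Longrightarrow> \<exists>I\<ge>0. has_KS_integral (\<lambda>t. q t - \<xi> t - z t) \<xi> 0 T I"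
    and \<eta>_ineq: "\<And>z. z \<in> regulated T \<Longrightarrow> sup_norm 0 T z \<le> r \<Longrightarrow> \<exists>I\<ge>0. has_KS_integral (\<lambda>t. q t - \<eta> t - z t) \<eta> 0 T I"
    and init: "\<xi> 0 = \<eta> 0"
    using \<xi> \<eta> by (auto simp: is_play_def)
  note reg = regulated_right_imp_regulated[OF q] regulated_right_imp_regulated[OF \<xi>_reg]
    regulated_right_imp_regulated[OF \<eta>_reg]
  obtain V1 where V1: "increments_dominated T \<xi> V1" using bounded_var_imp_increments_dominated[OF \<xi>_var] .
  obtain V2 where V2: "increments_dominated T \<eta> V2" using bounded_var_imp_increments_dominated[OF \<eta>_var] .
  define f where "f x = \<xi> x - \<eta> x" for x
  define V where "V x = V1 x + V2 x" for x
  have V: "increments_dominated T f V"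
    unfolding increments_dominated_def
  proof (intro allI impI, elim conjE)
    fix c d assume "0 \<le> c" "c \<le> d" "d \<le> T"
    with increments_dominatedD[OF V1] increments_dominatedD[OF V2] show "\<bar>f d - f c\<bar> \<le> V d - V c"
      unfolding f_def V_def by (smt (verit))
  qed
  have f_reg: "f \<in> regulated_right T" unfolding f_def by (intro regulated_right_diff \<xi>_reg \<eta>_reg)
  \<comment> \<open>Each solution is tested with the other one up to time \<open>t\<close> and with itself afterwards.\<close>
  define z1 where "z1 x = (if x \<le> t then q x - \<eta> x else q x - \<xi> x)" for x
  define z2 where "z2 x = (if x \<le> t then q x - \<xi> x else q x - \<eta> x)" for x
  have z1: "z1 \<in> regulated T" unfolding z1_def by (intro regulated_switch regulated_diff reg)
  have z2: "z2 \<in> regulated T" unfolding z2_def by (intro regulated_switch regulated_diff reg)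
  have z1r: "sup_norm 0 T z1 \<le> r" and z2r: "sup_norm 0 T z2 \<le> r"
    unfolding sup_norm_def using T \<xi>_near \<eta>_near by (auto intro!: cSUP_least simp: z1_def z2_def)
  obtain I1 where I1: "I1 \<ge> 0" "has_KS_integral (\<lambda>t. q t - \<xi> t - z1 t) \<xi> 0 T I1"
    using \<xi>_ineq[OF z1 z1r] by auto
  obtain I2 where I2: "I2 \<ge> 0" "has_KS_integral (\<lambda>t. q t - \<eta> t - z2 t) \<eta> 0 T I2"
    using \<eta>_ineq[OF z2 z2r] by auto
  have eq1: "q x - \<xi> x - z1 x = - of_bool (x \<le> t) * f x" for x by (simp add: z1_def f_def)
  have eq2: "q x - \<eta> x - z2 x = of_bool (x \<le> t) * f x" for x by (simp add: z2_def f_def)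
  define W where "W = V T - V 0"
  have W: "W \<ge> 0" using increments_dominatedD[OF V, of 0 T] T by (auto simp: W_def)
  have key: "(f t)\<^sup>2 / 2 \<le> \<epsilon> * W + \<epsilon>" if e: "\<epsilon> > 0" for \<epsilon>
  proof -
    \<comment> \<open>Minus half the squared difference, stopped at time \<open>t\<close>, plus errors that are small in total.\<close>
    define H where "H x = \<epsilon> * V x + \<epsilon> * of_bool (t < x) - (f (min x t))\<^sup>2 / 2" for x
    have "I1 + I2 \<le> H T - H 0"
    proof (rule has_KS_integral_straddle_le[OF T I1(2) I2(2)])
      fix x assume x: "x \<in> {0..T}"
      have incr: "- of_bool (x \<le> t) * f x * (\<xi> d - \<xi> c) + of_bool (x \<le> t) * f x * (\<eta> d - \<eta> c)
          = - of_bool (x \<le> t) * f x * (f d - f c)" for c d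
        by (simp add: f_def algebra_simps)
      have step: "\<exists>\<delta>>0. \<forall>c d. 0 \<le> c \<and> c \<le> x \<and> x \<le> d \<and> d \<le> T \<and> x - c < \<delta> \<and> d - x < \<delta>
         \<longrightarrow> - of_bool (x \<le> t) * f x * (f d - f c) \<le> H d - H c"
      proof -
        have right: "\<exists>\<delta>>0. \<forall>y. x \<le> y \<and> y \<le> T \<and> y - x < \<delta> \<longrightarrow> \<bar>f y - f x\<bar> < e'" if e': "e' > 0" for e'
        proof -
          obtain d where "d > 0" "\<And>y. x \<le> y \<Longrightarrow> y < x + d \<Longrightarrow> y \<le> T \<Longrightarrow> norm (f y - f x) < e'"
            using regulated_right_continuous[OF f_reg e', of x] x by auto
          then show ?thesis by (intro exI[of _ d]) auto
        qed
        have Vmono: "V c \<le> V d" if "0 \<le> c" "c \<le> d" "d \<le> T" for c d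
          using increments_dominatedD[OF V that] by linarith
        consider "x < t" | "x = t" | "x > t" by linarith
        then show ?thesis
        proof cases
          case 1
          obtain \<delta> where \<delta>: "\<delta> > 0" "\<And>y. x \<le> y \<Longrightarrow> y \<le> T \<Longrightarrow> y - x < \<delta> \<Longrightarrow> \<bar>f y - f x\<bar> < \<epsilon>"
            using right[OF e] by blast
          have "- of_bool (x \<le> t) * f x * (f d - f c) \<le> H d - H c"
            if cd: "0 \<le> c" "c \<le> x" "x \<le> d" "d \<le> T" "x - c < min \<delta> (t - x)" "d - x < min \<delta> (t - x)" for c d
          proof -
            define a b where "a = f x - f c" and "b = f d - f x"
            have b: "\<bar>b\<bar> < \<epsilon>" "\<bar>b\<bar> \<le> V d - V c"
              using \<delta>(2)[of d] increments_dominatedD[OF V, of x d] Vmono[of c x] cd by (auto simp: b_def)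
            have "b\<^sup>2 \<le> \<epsilon> * (V d - V c)"
              using mult_mono[of "\<bar>b\<bar>" \<epsilon> "\<bar>b\<bar>" "V d - V c"] b e by (simp add: power2_eq_square)
            then have "b\<^sup>2 / 2 - a\<^sup>2 / 2 \<le> \<epsilon> * V d - \<epsilon> * V c"
              using zero_le_power2[of a] zero_le_power2[of b] unfolding right_diff_distrib by linarith
            moreover have "- (f x * (f d - f c)) = - (f d)\<^sup>2 / 2 + (f c)\<^sup>2 / 2 - a\<^sup>2 / 2 + b\<^sup>2 / 2"
              by (simp add: a_def b_def power2_eq_square field_simps)
            ultimately show ?thesis
              using 1 cd by (simp add: H_def right_diff_distrib)
          qed
          then show ?thesis using \<delta>(1) 1 by (intro exI[of _ "min \<delta> (t - x)"]) auto
        next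
          case 2
          have pos: "\<epsilon> / (\<bar>f t\<bar> + 1) > 0" using e by (simp add: add_nonneg_pos)
          obtain \<delta> where \<delta>: "\<delta> > 0" "\<And>y. x \<le> y \<Longrightarrow> y \<le> T \<Longrightarrow> y - x < \<delta> \<Longrightarrow> \<bar>f y - f x\<bar> < \<epsilon> / (\<bar>f t\<bar> + 1)"
            using right[OF pos] by blast
          have "- of_bool (x \<le> t) * f x * (f d - f c) \<le> H d - H c"
            if cd: "0 \<le> c" "c \<le> x" "x \<le> d" "d \<le> T" "x - c < \<delta>" "d - x < \<delta>" for c d
          proof -
            have "\<bar>f t\<bar> * \<bar>f d - f t\<bar> \<le> (\<bar>f t\<bar> + 1) * \<bar>f d - f t\<bar>" by (intro mult_right_mono) auto
            also have "\<dots> \<le> \<epsilon> * of_bool (t < d)"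
              using \<delta>(2)[of d] cd 2 e by (cases "d = t") (auto simp: less_divide_eq mult.commute add_nonneg_pos)
            finally have "- (f t * (f d - f t)) \<le> \<epsilon> * of_bool (t < d)"
              using abs_ge_minus_self[of "f t * (f d - f t)"] by (simp add: abs_mult)
            moreover have "- (f t * (f d - f c)) = - (f t * (f d - f t)) - (f t)\<^sup>2 / 2 + (f c)\<^sup>2 / 2 - (f t - f c)\<^sup>2 / 2"
              by (simp add: power2_eq_square field_simps)
            moreover have "(f t - f c)\<^sup>2 \<ge> 0" by simp
            moreover have "\<epsilon> * V c \<le> \<epsilon> * V d" using Vmono[of c d] cd e by simp
            ultimately have "- (f t * (f d - f c)) \<le> \<epsilon> * of_bool (t < d) - (f t)\<^sup>2 / 2 + (f c)\<^sup>2 / 2 + (\<epsilon> * V d - \<epsilon> * V c)"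
              by linarith
            then show ?thesis
              using 2 cd by (simp add: H_def)
          qed
          then show ?thesis using \<delta>(1) by (intro exI[of _ \<delta>]) auto
        next
          case 3
          have "- of_bool (x \<le> t) * f x * (f d - f c) \<le> H d - H c"
            if cd: "0 \<le> c" "c \<le> x" "x \<le> d" "d \<le> T" "x - c < x - t" "d - x < x - t" for c d
          proof -
            have "\<epsilon> * V c \<le> \<epsilon> * V d" using Vmono[of c d] cd e by simp
            then show ?thesis using 3 cd by (simp add: H_def)
          qed
          then show ?thesis using 3 by (intro exI[of _ "x - t"]) auto
        qed
      qed
      show "\<exists>\<delta>>0. \<forall>c d. 0 \<le> c \<and> c \<le> x \<and> x \<le> d \<and> d \<le> T \<and> x - c < \<delta> \<and> d - x < \<delta> \<longrightarrow>
          (q x - \<xi> x - z1 x) * (\<xi> d - \<xi> c) + (q x - \<eta> x - z2 x) * (\<eta> d - \<eta> c) \<le> H d - H c"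
        unfolding eq1 eq2 incr by (rule step)
    qed
    moreover have "H T - H 0 \<le> \<epsilon> * W + \<epsilon> - (f t)\<^sup>2 / 2"
      using t e init by (cases "t = T") (auto simp: H_def W_def f_def right_diff_distrib min_def)
    ultimately show ?thesis using I1(1) I2(1) by linarith
  qed
  have "(f t)\<^sup>2 / 2 \<le> 0 + \<epsilon>" if "\<epsilon> > 0" for \<epsilon>
  proof -
    have "\<epsilon> / (W + 1) > 0" using that W by simp
    from key[OF this] have "(f t)\<^sup>2 / 2 \<le> \<epsilon> / (W + 1) * (W + 1)" by (simp add: distrib_left)
    then show ?thesis using W by simp
  qed
  then have "(f t)\<^sup>2 / 2 \<le> 0" by (rule field_le_epsilon)
  then show ?thesis by (simp add: f_def)
qed

lemma play_eqI:
  assumes T: "0 \<le> T" and q: "q \<in> regulated_right T"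
    and \<xi>: "is_play T r q \<xi>" and ext: "\<xi> \<in> extensional {0..T}"
  shows "play T r q = \<xi>"
  unfolding play_def
proof (rule the_equality)
  fix \<eta> assume "\<eta> \<in> extensional {0..T} \<and> is_play T r q \<eta>"
  then show "\<eta> = \<xi>"
    using is_play_unique[OF T q _ \<xi>] ext by (auto intro: extensionalityI)
qed (use \<xi> ext in auto)

section \<open>A characterisation of the play that is stable under uniform limits\<close>

text \<open>Contact with the boundary of the strip \<open>|q - \<xi>| \<le> r\<close> is only required up to a tolerance: when \<open>q\<close> jumps
  back at the end of a monotone stretch, contact is visible only in a left limit, and exact contact would
  not survive uniform limits.  The second condition on \<open>\<tau>\<close> excludes a contact that belongs to an earlier motion
  and does not explain the present one.\<close>

definition obeys_play :: "real \<Rightarrow> real \<Rightarrow> (real \<Rightarrow> real) \<Rightarrow> (real \<Rightarrow> real) \<Rightarrow> bool" where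
  "obeys_play T r q \<xi> \<longleftrightarrow>
     \<xi> 0 = max (q 0 - r) (min 0 (q 0 + r)) \<and>
     (\<forall>t\<in>{0..T}. \<bar>q t - \<xi> t\<bar> \<le> r) \<and>
     (\<forall>s t \<epsilon>. 0 \<le> s \<and> s < t \<and> t \<le> T \<and> \<epsilon> > 0 \<and> \<xi> s < \<xi> t \<longrightarrow>
        (\<exists>\<tau>\<in>{s<..t}. q \<tau> - \<xi> \<tau> \<ge> r - \<epsilon> \<and> \<xi> \<tau> \<ge> \<xi> t - \<epsilon>)) \<and>
     (\<forall>s t \<epsilon>. 0 \<le> s \<and> s < t \<and> t \<le> T \<and> \<epsilon> > 0 \<and> \<xi> t < \<xi> s \<longrightarrow>
        (\<exists>\<tau>\<in>{s<..t}. \<xi> \<tau> - q \<tau> \<ge> r - \<epsilon> \<and> \<xi> \<tau> \<le> \<xi> t + \<epsilon>))"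

lemma obeys_play_near: "obeys_play T r q \<xi> \<Longrightarrow> t \<in> {0..T} \<Longrightarrow> \<bar>q t - \<xi> t\<bar> \<le> r"
  by (simp add: obeys_play_def)

lemma obeys_play_increase:
  assumes "obeys_play T r q \<xi>" "0 \<le> s" "s \<le> t" "t \<le> T" "\<epsilon> > 0" "\<xi> s < \<xi> t"
  obtains \<tau> where "s < \<tau>" "\<tau> \<le> t" "q \<tau> - \<xi> \<tau> \<ge> r - \<epsilon>" "\<xi> \<tau> \<ge> \<xi> t - \<epsilon>"
proof -
  have "s < t" using assms(3,6) by (cases "s = t") auto
  then have "\<exists>\<tau>\<in>{s<..t}. q \<tau> - \<xi> \<tau> \<ge> r - \<epsilon> \<and> \<xi> \<tau> \<ge> \<xi> t - \<epsilon>"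
    using assms unfolding obeys_play_def by blast
  then show ?thesis using that by auto
qed

text \<open>The play is odd, so that upward and downward motion need not be treated separately.\<close>

lemma obeys_play_uminus:
  assumes "obeys_play T r q \<xi>" "0 \<le> r"
  shows "obeys_play T r (\<lambda>t. - q t) (\<lambda>t. - \<xi> t)"
proof -
  have "- \<xi> 0 = max (- q 0 - r) (min 0 (- q 0 + r))"
    using assms unfolding obeys_play_def by (auto simp: max_def min_def)
  moreover have "\<forall>t\<in>{0..T}. \<bar>- q t - - \<xi> t\<bar> \<le> r"
    using assms(1) unfolding obeys_play_def by (simp add: abs_minus_commute)
  moreover have "\<exists>\<tau>\<in>{s<..t}. - q \<tau> - - \<xi> \<tau> \<ge> r - \<epsilon> \<and> - \<xi> \<tau> \<ge> - \<xi> t - \<epsilon>"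
    if "0 \<le> s \<and> s < t \<and> t \<le> T \<and> \<epsilon> > 0 \<and> - \<xi> s < - \<xi> t" for s t \<epsilon>
  proof -
    have "\<exists>\<tau>\<in>{s<..t}. \<xi> \<tau> - q \<tau> \<ge> r - \<epsilon> \<and> \<xi> \<tau> \<le> \<xi> t + \<epsilon>"
      using assms(1) that unfolding obeys_play_def by (simp only: neg_less_iff_less)
    then show ?thesis by (elim bexE) (rule bexI, auto)
  qed
  moreover have "\<exists>\<tau>\<in>{s<..t}. - \<xi> \<tau> - - q \<tau> \<ge> r - \<epsilon> \<and> - \<xi> \<tau> \<le> - \<xi> t + \<epsilon>"
    if "0 \<le> s \<and> s < t \<and> t \<le> T \<and> \<epsilon> > 0 \<and> - \<xi> t < - \<xi> s" for s t \<epsilon>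
  proof -
    have "\<exists>\<tau>\<in>{s<..t}. q \<tau> - \<xi> \<tau> \<ge> r - \<epsilon> \<and> \<xi> \<tau> \<ge> \<xi> t - \<epsilon>"
      using assms(1) that unfolding obeys_play_def by (simp only: neg_less_iff_less)
    then show ?thesis by (elim bexE) (rule bexI, auto)
  qed
  ultimately show ?thesis unfolding obeys_play_def by blast
qed

lemma obeys_play_decrease:
  assumes "obeys_play T r q \<xi>" "0 \<le> r" "0 \<le> s" "s \<le> t" "t \<le> T" "\<epsilon> > 0" "\<xi> t < \<xi> s"
  obtains \<tau> where "s < \<tau>" "\<tau> \<le> t" "\<xi> \<tau> - q \<tau> \<ge> r - \<epsilon>" "\<xi> \<tau> \<le> \<xi> t + \<epsilon>"
proof -
  have "- \<xi> s < - \<xi> t" using assms by simp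
  from obeys_play_increase[OF obeys_play_uminus[OF assms(1,2)] assms(3-6) this]
  obtain \<tau> where "s < \<tau>" "\<tau> \<le> t" "- q \<tau> - - \<xi> \<tau> \<ge> r - \<epsilon>" "- \<xi> \<tau> \<ge> - \<xi> t - \<epsilon>" .
  then show ?thesis using that[of \<tau>] by auto
qed

text \<open>If \<open>\<xi>\<close> moved both up and down on \<open>S\<close>, there would be times in \<open>S\<close> with \<open>q\<close> near \<open>\<xi> + r\<close> and with \<open>q\<close>
  near \<open>\<xi> - r\<close>.  Since \<open>q\<close> varies by less than \<open>r\<close>, the values of \<open>\<xi>\<close> at these times differ, and the
  motion of \<open>\<xi>\<close> from one to the other requires a contact that makes \<open>q\<close> vary by almost \<open>2 * r\<close>.\<close>

lemma obeys_play_locally_monotone: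
  assumes play: "obeys_play T r q \<xi>" and r: "r > 0"
    and S: "S \<subseteq> {0..T}" "\<And>x y. x \<in> S \<Longrightarrow> y \<in> S \<Longrightarrow> {x..y} \<subseteq> S"
    and osc: "\<And>x y. x \<in> S \<Longrightarrow> y \<in> S \<Longrightarrow> \<bar>q x - q y\<bar> < r"
  shows "mono_on S \<xi> \<or> antimono_on S \<xi>"
proof (rule ccontr)
  assume "\<not> (mono_on S \<xi> \<or> antimono_on S \<xi>)"
  then have nm: "\<not> mono_on S \<xi>" "\<not> antimono_on S \<xi>" by auto
  obtain c d where c: "c \<in> S" "d \<in> S" "c \<le> d" "\<xi> d < \<xi> c"
    using nm(1) unfolding monotone_on_def by (auto simp: not_le)
  obtain c' d' where c': "c' \<in> S" "d' \<in> S" "c' \<le> d'" "\<xi> c' < \<xi> d'"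
    using nm(2) unfolding monotone_on_def by (auto simp: not_le)
  define \<epsilon> where "\<epsilon> = r / 8"
  have e: "\<epsilon> > 0" "8 * \<epsilon> = r" using r by (auto simp: \<epsilon>_def)
  have r0: "0 \<le> r" using r by simp
  have sub: "x \<in> S" if "u \<in> S" "v \<in> S" "u \<le> x" "x \<le> v" for u v x
    using S(2)[OF that(1,2)] that by auto
  have ST: "0 \<le> x" "x \<le> T" if "x \<in> S" for x using S(1) that by auto
  obtain p where p: "c < p" "p \<le> d" "\<xi> p - q p \<ge> r - \<epsilon>" "\<xi> p \<le> \<xi> d + \<epsilon>"
    using obeys_play_decrease[OF play r0 ST(1)[OF c(1)] c(3) ST(2)[OF c(2)] e(1) c(4)] .
  obtain p' where p': "c' < p'" "p' \<le> d'" "q p' - \<xi> p' \<ge> r - \<epsilon>" "\<xi> p' \<ge> \<xi> d' - \<epsilon>"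
    using obeys_play_increase[OF play ST(1)[OF c'(1)] c'(3) ST(2)[OF c'(2)] e(1) c'(4)] .
  have pS: "p \<in> S" by (rule sub[OF c(1,2)]) (use p in auto)
  have p'S: "p' \<in> S" by (rule sub[OF c'(1,2)]) (use p' in auto)
  have lt: "\<xi> p' < \<xi> p" using osc[OF pS p'S] p(3) p'(3) e by linarith
  show False
  proof (cases "p' \<le> p")
    case True
    obtain x where x: "p' < x" "x \<le> p" "q x - \<xi> x \<ge> r - \<epsilon>" "\<xi> x \<ge> \<xi> p - \<epsilon>"
      using obeys_play_increase[OF play ST(1)[OF p'S] True ST(2)[OF pS] e(1) lt] .
    have "x \<in> S" using sub[OF p'S pS] x by auto
    then show False using osc[of x p] \<open>x \<in> S\<close> pS x p(3) e by linarith
  next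
    case False
    then have "p \<le> p'" by simp
    obtain x where x: "p < x" "x \<le> p'" "\<xi> x - q x \<ge> r - \<epsilon>" "\<xi> x \<le> \<xi> p' + \<epsilon>"
      using obeys_play_decrease[OF play r0 ST(1)[OF pS] \<open>p \<le> p'\<close> ST(2)[OF p'S] e(1) lt] .
    have "x \<in> S" using sub[OF pS p'S] x by auto
    then show False using osc[of p' x] \<open>x \<in> S\<close> p'S x p'(3) e by linarith
  qed
qed

text \<open>Every point has a neighbourhood in which \<open>q\<close> oscillates by less than \<open>r\<close> on either side of the point,
  and \<open>\<xi>\<close> is monotone on both sides.\<close>

lemma obeys_play_increments_dominated:
  assumes play: "obeys_play T r q \<xi>" and r: "r > 0" and T: "0 \<le> T"
    and q: "q \<in> regulated_right T" and \<xi>: "\<xi> \<in> regulated_right T"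
  obtains V where "increments_dominated T \<xi> V"
proof -
  obtain B where B: "\<And>t. t \<in> {0..T} \<Longrightarrow> \<bar>\<xi> t\<bar> \<le> B"
    using regulated_bounded[OF regulated_right_imp_regulated[OF \<xi>] T] by (auto simp: real_norm_def)
  define P where "P a b \<longleftrightarrow> (0 \<le> a \<and> b \<le> T \<longrightarrow>
    (\<exists>V. \<forall>c d. a \<le> c \<and> c \<le> d \<and> d \<le> b \<longrightarrow> \<bar>\<xi> d - \<xi> c\<bar> \<le> V d - V c))" for a b
  have "P 0 T"
    using T
  proof (induction rule: Bolzano)
    case (trans a b c)
    show ?case
      unfolding P_def
    proof (intro impI, elim conjE)
      assume ac: "0 \<le> a" "c \<le> T"
      obtain V where V: "\<forall>x y. a \<le> x \<and> x \<le> y \<and> y \<le> b \<longrightarrow> \<bar>\<xi> y - \<xi> x\<bar> \<le> V y - V x"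
        using trans(1,3,4) ac unfolding P_def by force
      obtain V' where V': "\<forall>x y. b \<le> x \<and> x \<le> y \<and> y \<le> c \<longrightarrow> \<bar>\<xi> y - \<xi> x\<bar> \<le> V' y - V' x"
        using trans(2,3,4) ac unfolding P_def by force
      show "\<exists>V. \<forall>x y. a \<le> x \<and> x \<le> y \<and> y \<le> c \<longrightarrow> \<bar>\<xi> y - \<xi> x\<bar> \<le> V y - V x"
      proof (intro exI[of _ "\<lambda>x. V (min x b) + V' (max x b)"] allI impI, elim conjE)
        fix x y assume xy: "a \<le> x" "x \<le> y" "y \<le> c"
        have "\<bar>\<xi> (min y b) - \<xi> (min x b)\<bar> \<le> V (min y b) - V (min x b)"
          using V xy trans(3,4) by auto
        moreover have "\<bar>\<xi> (max y b) - \<xi> (max x b)\<bar> \<le> V' (max y b) - V' (max x b)"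
          using V' xy trans(3,4) by auto
        moreover have "\<xi> y - \<xi> x = (\<xi> (min y b) - \<xi> (min x b)) + (\<xi> (max y b) - \<xi> (max x b))"
          by (auto simp: min_def max_def)
        ultimately show "\<bar>\<xi> y - \<xi> x\<bar> \<le> V (min y b) + V' (max y b) - (V (min x b) + V' (max x b))"
          by linarith
      qed
    qed
  next
    case (local x)
    have r2: "r / 2 > 0" using r by simp
    obtain d l where d: "d > 0" "\<And>y. x - d < y \<Longrightarrow> y < x \<Longrightarrow> 0 \<le> y \<Longrightarrow> norm (q y - l) < r / 2"
      using regulated_local_left[OF regulated_right_imp_regulated[OF q] r2, of x] local by auto
    obtain d' where d': "d' > 0" "\<And>y. x \<le> y \<Longrightarrow> y < x + d' \<Longrightarrow> y \<le> T \<Longrightarrow> norm (q y - q x) < r / 2"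
      using regulated_right_continuous[OF q r2, of x] local by auto
    have "P a b" if ab: "a \<le> x" "x \<le> b" "b - a < min d d'" for a b
      unfolding P_def
    proof (intro impI, elim conjE)
      assume ab': "0 \<le> a" "b \<le> T"
      have "mono_on {a..<x} \<xi> \<or> antimono_on {a..<x} \<xi>"
      proof (rule obeys_play_locally_monotone[OF play r])
        show "\<bar>q y - q z\<bar> < r" if "y \<in> {a..<x}" "z \<in> {a..<x}" for y z
          using d(2)[of y] d(2)[of z] that ab ab' by (auto simp: abs_if split: if_splits)
      qed (use ab ab' in auto)
      then obtain \<sigma> :: real where \<sigma>: "\<bar>\<sigma>\<bar> = 1" "\<And>y z. a \<le> y \<Longrightarrow> y \<le> z \<Longrightarrow> z < x \<Longrightarrow> \<bar>\<xi> z - \<xi> y\<bar> \<le> \<sigma> * \<xi> z - \<sigma> * \<xi> y"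
      proof (elim disjE)
        assume "mono_on {a..<x} \<xi>"
        then show ?thesis by (intro that[of 1]) (auto simp: monotone_on_def)
      next
        assume "antimono_on {a..<x} \<xi>"
        then show ?thesis by (intro that[of "-1"]) (auto simp: monotone_on_def)
      qed
      have "mono_on {x..b} \<xi> \<or> antimono_on {x..b} \<xi>"
      proof (rule obeys_play_locally_monotone[OF play r])
        show "\<bar>q y - q z\<bar> < r" if "y \<in> {x..b}" "z \<in> {x..b}" for y z
          using d'(2)[of y] d'(2)[of z] that ab ab' by (auto simp: abs_if split: if_splits)
      qed (use ab ab' in auto)
      then obtain \<sigma>' :: real where \<sigma>': "\<bar>\<sigma>'\<bar> = 1" "\<And>y z. x \<le> y \<Longrightarrow> y \<le> z \<Longrightarrow> z \<le> b \<Longrightarrow> \<bar>\<xi> z - \<xi> y\<bar> \<le> \<sigma>' * \<xi> z - \<sigma>' * \<xi> y"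
      proof (elim disjE)
        assume "mono_on {x..b} \<xi>"
        then show ?thesis by (intro that[of 1]) (auto simp: monotone_on_def)
      next
        assume "antimono_on {x..b} \<xi>"
        then show ?thesis by (intro that[of "-1"]) (auto simp: monotone_on_def)
      qed
      \<comment> \<open>The summand \<open>3 * B\<close> pays for a jump at \<open>x\<close>.\<close>
      let ?V = "\<lambda>y. if y < x then \<sigma> * \<xi> y else 3 * B + \<sigma>' * \<xi> y - \<sigma>' * \<xi> x"
      show "\<exists>V. \<forall>c d. a \<le> c \<and> c \<le> d \<and> d \<le> b \<longrightarrow> \<bar>\<xi> d - \<xi> c\<bar> \<le> V d - V c"
      proof (intro exI[of _ ?V] allI impI, elim conjE)
        fix y z assume yz: "a \<le> y" "y \<le> z" "z \<le> b"
        consider "z < x" | "x \<le> y" | "y < x" "x \<le> z" by linarith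
        then show "\<bar>\<xi> z - \<xi> y\<bar> \<le> ?V z - ?V y"
        proof cases
          case 3
          have "\<bar>\<sigma> * \<xi> y\<bar> \<le> B" using \<sigma>(1) B[of y] yz 3 ab ab' by (simp add: abs_mult)
          moreover have "\<bar>\<xi> y\<bar> \<le> B" "\<bar>\<xi> z\<bar> \<le> B" using B yz ab ab' by auto
          moreover have "0 \<le> \<sigma>' * \<xi> z - \<sigma>' * \<xi> x" using \<sigma>'(2)[of x z] 3 yz by auto
          ultimately show ?thesis using 3 by auto
        qed (use yz \<sigma>(2) \<sigma>'(2) in auto)
      qed
    qed
    then show ?case using d(1) d'(1) by (intro exI[of _ "min d d'"]) auto
  qed
  then obtain V where "\<forall>c d. 0 \<le> c \<and> c \<le> d \<and> d \<le> T \<longrightarrow> \<bar>\<xi> d - \<xi> c\<bar> \<le> V d - V c"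
    by (auto simp: P_def)
  then show ?thesis using that by (auto simp: increments_dominated_def)
qed

text \<open>Just before \<open>x\<close> the function \<open>\<xi>\<close> is still close to \<open>l\<close>, so that only contact at \<open>x\<close> itself explains
  the increase.\<close>

lemma obeys_play_upward_jump:
  assumes play: "obeys_play T r q \<xi>" and x: "0 < x" "x \<le> T"
    and l: "\<And>e. e > 0 \<Longrightarrow> \<exists>d>0. \<forall>y. x - d < y \<and> y < x \<and> 0 \<le> y \<longrightarrow> \<bar>\<xi> y - l\<bar> < e"
    and jump: "l < \<xi> x"
  shows "q x - \<xi> x \<ge> r"
proof (rule ccontr)
  assume "\<not> q x - \<xi> x \<ge> r"
  define \<epsilon> where "\<epsilon> = min ((r - (q x - \<xi> x)) / 2) ((\<xi> x - l) / 3)"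
  have e: "\<epsilon> > 0" "2 * \<epsilon> \<le> r - (q x - \<xi> x)" "3 * \<epsilon> \<le> \<xi> x - l"
    using jump \<open>\<not> q x - \<xi> x \<ge> r\<close> by (auto simp: \<epsilon>_def min_def)
  obtain d where d: "d > 0" "\<And>y. x - d < y \<Longrightarrow> y < x \<Longrightarrow> 0 \<le> y \<Longrightarrow> \<bar>\<xi> y - l\<bar> < \<epsilon>"
    using l[OF e(1)] by blast
  define c where "c = max 0 (x - d / 2)"
  have c: "0 \<le> c" "c < x" "x - d < c" using x d(1) by (auto simp: c_def)
  have "\<xi> c < \<xi> x" using d(2)[of c] c e by auto
  then obtain \<tau> where \<tau>: "c < \<tau>" "\<tau> \<le> x" "q \<tau> - \<xi> \<tau> \<ge> r - \<epsilon>" "\<xi> \<tau> \<ge> \<xi> x - \<epsilon>"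
    using obeys_play_increase[OF play c(1) less_imp_le[OF c(2)] x(2) e(1)] by auto
  show False
  proof (cases "\<tau> = x")
    case True
    then show ?thesis using \<tau>(3) e by auto
  next
    case False
    then show ?thesis using d(2)[of \<tau>] \<tau> c e by auto
  qed
qed

text \<open>If \<open>q\<close> hardly varies around the tag \<open>x\<close>, contact somewhere in the interval is almost contact at \<open>x\<close>;
  the integrand \<open>q - \<xi> - z\<close> is then nearly nonnegative at the tag, whatever the test function \<open>z\<close>.\<close>

lemma obeys_play_increasing_tag:
  assumes play: "obeys_play T r q \<xi>" and cx: "0 \<le> c" "c \<le> x" "x \<le> d" "d \<le> T" and less: "\<xi> c < \<xi> d"
    and near: "\<And>y. y \<in> {c..d} \<Longrightarrow> \<bar>q y - q x\<bar> < \<epsilon>" and e: "\<epsilon> > 0" "4 * \<epsilon> < r"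
  shows "q x - \<xi> x \<ge> r - 3 * \<epsilon>"
proof -
  have "c \<le> d" "0 \<le> r" using cx e by auto
  obtain \<tau> where \<tau>: "c < \<tau>" "\<tau> \<le> d" "q \<tau> - \<xi> \<tau> \<ge> r - \<epsilon>" "\<xi> \<tau> \<ge> \<xi> d - \<epsilon>"
    using obeys_play_increase[OF play cx(1) \<open>c \<le> d\<close> cx(4) e(1) less] .
  have "\<xi> x \<le> \<xi> d"
  proof (rule ccontr)
    assume "\<not> \<xi> x \<le> \<xi> d"
    then have lt: "\<xi> d < \<xi> x" by simp
    have "0 \<le> x" using cx by simp
    obtain p where p: "x < p" "p \<le> d" "\<xi> p - q p \<ge> r - \<epsilon>" "\<xi> p \<le> \<xi> d + \<epsilon>"
      using obeys_play_decrease[OF play \<open>0 \<le> r\<close> \<open>0 \<le> x\<close> cx(3,4) e(1) lt] .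
    show False using near[of p] near[of \<tau>] p \<tau> cx e by auto
  qed
  then show ?thesis using near[of \<tau>] \<tau> by auto
qed

text \<open>Where \<open>q\<close> jumps by less than \<open>\<epsilon>\<close> the summands are nearly nonnegative relative to the variation of
  \<open>\<xi>\<close>.  At the finitely many remaining tags the increment of \<open>\<xi>\<close> is, up to an error, its jump at the
  tag, and where this jump is not zero contact holds exactly.\<close>

lemma obeys_play_variational:
  assumes play: "obeys_play T r q \<xi>" and r: "r > 0" and T: "0 \<le> T"
    and q: "q \<in> regulated_right T" and \<xi>: "\<xi> \<in> regulated_right T"
    and z: "\<And>t. t \<in> {0..T} \<Longrightarrow> \<bar>z t\<bar> \<le> r"
    and I: "has_KS_integral (\<lambda>t. q t - \<xi> t - z t) \<xi> 0 T I"
  shows "I \<ge> 0"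
proof -
  obtain V where V: "increments_dominated T \<xi> V"
    using obeys_play_increments_dominated[OF play r T q \<xi>] .
  have Vmono: "V c \<le> V d" if "0 \<le> c" "c \<le> d" "d \<le> T" for c d
    using increments_dominatedD[OF V that] by linarith
  define W where "W = V T - V 0"
  have W: "W \<ge> 0" using Vmono[of 0 T] T by (auto simp: W_def)
  have play': "obeys_play T r (\<lambda>t. - q t) (\<lambda>t. - \<xi> t)" using play r by (simp add: obeys_play_uminus)
  have lower: "- I \<le> 3 * \<epsilon> * W + 2 * \<eta>'" if e: "\<epsilon> > 0" "4 * \<epsilon> < r" and h': "\<eta>' > 0" for \<epsilon> \<eta>'
  proof -
    obtain E where E: "finite E"
      "\<And>x. x \<in> {0..T} - E \<Longrightarrow> \<exists>d>0. \<forall>y\<in>{0..T}. \<bar>y - x\<bar> < d \<longrightarrow> norm (q y - q x) < \<epsilon>"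
      using regulated_finitely_many_large_jumps[OF regulated_right_imp_regulated[OF q] T e(1)] by blast
    define \<eta> where "\<eta> = \<eta>' / real (Suc (card E))"
    have h: "\<eta> > 0" using h' by (simp add: \<eta>_def)
    \<comment> \<open>Two unit jumps at each point of \<open>E\<close>, one for an interval that reaches the point from the left and
      one for an interval that leaves it to the right.\<close>
    define jumps where "jumps x = (\<Sum>e\<in>E. of_bool (e \<le> x) + of_bool (e < x) :: real)" for x
    define H where "H x = 3 * \<epsilon> * V x + \<eta> * jumps x" for x
    have jmono: "jumps c \<le> jumps d" if "c \<le> d" for c d
      unfolding jumps_def using that by (intro sum_mono add_mono) auto
    have jump: "jumps c + of_bool (c < x) + of_bool (x < d) \<le> jumps d" if "x \<in> E" "c \<le> x" "x \<le> d" for c d x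
    proof -
      have *: "jumps y = (of_bool (x \<le> y) + of_bool (x < y)) + (\<Sum>e\<in>E - {x}. of_bool (e \<le> y) + of_bool (e < y) :: real)" for y
        unfolding jumps_def by (rule sum.remove[OF E(1) that(1)])
      have "(\<Sum>e\<in>E - {x}. of_bool (e \<le> c) + of_bool (e < c) :: real) \<le> (\<Sum>e\<in>E - {x}. of_bool (e \<le> d) + of_bool (e < d))"
        using that by (intro sum_mono add_mono) auto
      then show ?thesis unfolding *[of c] *[of d] using that by (auto simp: of_bool_def)
    qed
    have "jumps T \<le> (\<Sum>e\<in>E. 2)" "jumps 0 \<ge> 0"
      unfolding jumps_def by (intro sum_mono) (auto simp: of_bool_def intro: sum_nonneg)
    then have jtot: "jumps T - jumps 0 \<le> 2 * real (card E)" by simp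
    have "\<eta> * (jumps T - jumps 0) \<le> \<eta> * (2 * real (Suc (card E)))"
      using jtot h by (intro mult_left_mono) auto
    also have "\<dots> = 2 * \<eta>'" by (simp add: \<eta>_def del: of_nat_Suc)
    finally have Htot: "H T - H 0 \<le> 3 * \<epsilon> * W + 2 * \<eta>'"
      by (simp add: H_def W_def right_diff_distrib)
    have "- 1 * I + 0 \<le> H T - H 0"
    proof (rule has_KS_integral_straddle_le[OF T has_KS_integral_mult[OF I] has_KS_integral_zero])
      fix x assume x: "x \<in> {0..T}"
      define A where "A = q x - \<xi> x - z x"
      have A: "\<bar>A\<bar> \<le> 2 * r" using obeys_play_near[OF play x] z[OF x] by (auto simp: A_def)
      have "\<exists>\<delta>>0. \<forall>c d. 0 \<le> c \<and> c \<le> x \<and> x \<le> d \<and> d \<le> T \<and> x - c < \<delta> \<and> d - x < \<delta> \<longrightarrow>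
          - A * (\<xi> d - \<xi> c) \<le> H d - H c"
      proof (cases "x \<in> E")
        case False
        then obtain \<delta> where \<delta>: "\<delta> > 0" "\<forall>y\<in>{0..T}. \<bar>y - x\<bar> < \<delta> \<longrightarrow> norm (q y - q x) < \<epsilon>"
          using E(2) x by blast
        have "- A * (\<xi> d - \<xi> c) \<le> H d - H c"
          if cd: "0 \<le> c" "c \<le> x" "x \<le> d" "d \<le> T" "x - c < \<delta>" "d - x < \<delta>" for c d
        proof -
          have near: "\<bar>q y - q x\<bar> < \<epsilon>" if "y \<in> {c..d}" for y
            using \<delta>(2)[rule_format, of y] that cd by auto
          have "- A * (\<xi> d - \<xi> c) \<le> 3 * \<epsilon> * \<bar>\<xi> d - \<xi> c\<bar>"
          proof (cases "\<xi> c" "\<xi> d" rule: linorder_cases)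
            case less
            have "A \<ge> - (3 * \<epsilon>)"
              using obeys_play_increasing_tag[OF play cd(1-4) less near e] z[OF x] by (auto simp: A_def)
            then have "- A * (\<xi> d - \<xi> c) \<le> 3 * \<epsilon> * (\<xi> d - \<xi> c)"
              using less by (intro mult_right_mono) auto
            then show ?thesis using less by simp
          next
            case greater
            then have less: "- \<xi> c < - \<xi> d" by simp
            have near': "\<bar>- q y - - q x\<bar> < \<epsilon>" if "y \<in> {c..d}" for y
              using near[OF that] by linarith
            have "- A \<ge> - (3 * \<epsilon>)"
              using obeys_play_increasing_tag[OF play' cd(1-4) less near' e] z[OF x] by (auto simp: A_def)
            then have "A * (\<xi> c - \<xi> d) \<le> 3 * \<epsilon> * (\<xi> c - \<xi> d)"
              using greater by (intro mult_right_mono) auto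
            then show ?thesis using greater by (simp add: algebra_simps)
          qed simp
          also have "\<dots> \<le> 3 * \<epsilon> * (V d - V c)"
            using increments_dominatedD[OF V, of c d] cd e by (intro mult_left_mono) auto
          also have "\<dots> \<le> H d - H c"
            using jmono[of c d] cd h by (simp add: H_def right_diff_distrib)
          finally show ?thesis .
        qed
        then show ?thesis using \<delta>(1) by blast
      next
        case True
        define \<kappa> where "\<kappa> = \<eta> / (2 * r)"
        have k: "\<kappa> > 0" "2 * r * \<kappa> = \<eta>" using h r by (auto simp: \<kappa>_def)
        obtain d1 where d1: "d1 > 0" "\<And>y. x \<le> y \<Longrightarrow> y < x + d1 \<Longrightarrow> y \<le> T \<Longrightarrow> \<bar>\<xi> y - \<xi> x\<bar> < \<kappa>"
          using regulated_right_continuous[OF \<xi> k(1), of x] x by auto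
        have right: "- A * (\<xi> d - \<xi> x) \<le> \<eta> * of_bool (x < d)" if "x \<le> d" "d < x + d1" "d \<le> T" for d
        proof (cases "d = x")
          case False
          have "\<bar>A\<bar> * \<bar>\<xi> d - \<xi> x\<bar> \<le> 2 * r * \<kappa>"
            using A d1(2)[OF that] r by (intro mult_mono) auto
          then show ?thesis using False that k abs_ge_minus_self[of "A * (\<xi> d - \<xi> x)"] by (simp add: abs_mult)
        qed simp
        obtain d2 where d2: "d2 > 0" "\<And>c. 0 \<le> c \<Longrightarrow> c \<le> x \<Longrightarrow> x - c < d2 \<Longrightarrow> - A * (\<xi> x - \<xi> c) \<le> \<eta> * of_bool (c < x)"
        proof (cases "x = 0")
          case True
          then show ?thesis using that[of 1] h by auto
        next
          case False
          then have x0: "0 < x" "x \<le> T" using x by auto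
          obtain l where l: "\<And>e. e > 0 \<Longrightarrow> \<exists>d>0. \<forall>y. x - d < y \<and> y < x \<and> 0 \<le> y \<longrightarrow> \<bar>\<xi> y - l\<bar> < e"
            using regulated_left_limit[OF regulated_right_imp_regulated[OF \<xi>], of x] x unfolding real_norm_def by auto
          have flip: "\<bar>- y - - l\<bar> = \<bar>y - l\<bar>" for y by linarith
          have l': "\<And>e. e > 0 \<Longrightarrow> \<exists>d>0. \<forall>y. x - d < y \<and> y < x \<and> 0 \<le> y \<longrightarrow> \<bar>- \<xi> y - - l\<bar> < e"
            unfolding flip by (rule l)
          have sign: "A * (\<xi> x - l) \<ge> 0"
          proof (cases l "\<xi> x" rule: linorder_cases)
            case less
            then show ?thesis
              using obeys_play_upward_jump[OF play x0 l less] z[OF x] by (auto simp: A_def)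
          next
            case greater
            then have "- l < - \<xi> x" by simp
            from obeys_play_upward_jump[OF play' x0 l' this] have "A \<le> 0"
              using z[OF x] by (auto simp: A_def)
            then show ?thesis using greater by (simp add: mult_nonpos_nonpos)
          qed simp
          obtain d where d: "d > 0" "\<And>y. x - d < y \<Longrightarrow> y < x \<Longrightarrow> 0 \<le> y \<Longrightarrow> \<bar>\<xi> y - l\<bar> < \<kappa>"
            using l[OF k(1)] by blast
          show ?thesis
          proof (rule that[OF d(1)])
            fix c assume c: "0 \<le> c" "c \<le> x" "x - c < d"
            show "- A * (\<xi> x - \<xi> c) \<le> \<eta> * of_bool (c < x)"
            proof (cases "c = x")
              case False
              have "\<bar>A\<bar> * \<bar>\<xi> c - l\<bar> \<le> 2 * r * \<kappa>"
                using A d(2)[of c] c False r by (intro mult_mono) auto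
              then have "A * (\<xi> c - l) \<le> \<eta>" using k abs_ge_self[of "A * (\<xi> c - l)"] by (simp add: abs_mult)
              moreover have "- A * (\<xi> x - \<xi> c) = A * (\<xi> c - l) - A * (\<xi> x - l)" by (simp add: algebra_simps)
              ultimately show ?thesis using sign False c by simp
            qed simp
          qed
        qed
        have "- A * (\<xi> d - \<xi> c) \<le> H d - H c"
          if cd: "0 \<le> c" "c \<le> x" "x \<le> d" "d \<le> T" "x - c < min d1 d2" "d - x < min d1 d2" for c d
        proof -
          have "- A * (\<xi> d - \<xi> c) = - A * (\<xi> d - \<xi> x) + - A * (\<xi> x - \<xi> c)" by (simp add: algebra_simps)
          also have "\<dots> \<le> \<eta> * of_bool (x < d) + \<eta> * of_bool (c < x)"
            using cd by (intro add_mono right d2(2)) auto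
          also have "\<dots> = \<eta> * (of_bool (c < x) + of_bool (x < d))" by (simp add: distrib_left)
          also have "\<dots> \<le> \<eta> * (jumps d - jumps c)"
            using jump[OF True cd(2,3)] h by (intro mult_left_mono) auto
          also have "\<dots> \<le> H d - H c"
            using Vmono[of c d] cd e by (simp add: H_def right_diff_distrib mult_left_mono)
          finally show ?thesis .
        qed
        then show ?thesis using d1(1) d2(1) by (intro exI[of _ "min d1 d2"]) auto
      qed
      then show "\<exists>\<delta>>0. \<forall>c d. 0 \<le> c \<and> c \<le> x \<and> x \<le> d \<and> d \<le> T \<and> x - c < \<delta> \<and> d - x < \<delta> \<longrightarrow>
          (- 1 * (q x - \<xi> x - z x)) * (\<xi> d - \<xi> c) + 0 * (\<xi> d - \<xi> c) \<le> H d - H c"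
        by (simp add: A_def)
    qed
    then show ?thesis using Htot by simp
  qed
  have "- I \<le> 0 + \<kappa>" if k: "\<kappa> > 0" for \<kappa>
  proof -
    define \<epsilon> where "\<epsilon> = min (r / 8) (\<kappa> / (6 * (W + 1)))"
    have "\<epsilon> > 0" using r k W by (auto simp: \<epsilon>_def)
    moreover have "\<epsilon> \<le> r / 8" unfolding \<epsilon>_def by (rule min.cobounded1)
    ultimately have e: "\<epsilon> > 0" "4 * \<epsilon> < r" using r by linarith+
    have "\<epsilon> \<le> \<kappa> / (6 * (W + 1))" by (simp add: \<epsilon>_def)
    then have "3 * \<epsilon> * (W + 1) \<le> \<kappa> / 2" using W by (simp add: le_divide_eq algebra_simps)
    then have "3 * \<epsilon> * W \<le> \<kappa> / 2" using e by (simp add: algebra_simps)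
    then show ?thesis using lower[OF e, of "\<kappa> / 4"] k by simp
  qed
  then have "- I \<le> 0" by (rule field_le_epsilon)
  then show ?thesis by simp
qed

lemma obeys_play_imp_is_play:
  assumes play: "obeys_play T r q \<xi>" and r: "r > 0" and T: "0 \<le> T"
    and q: "q \<in> regulated_right T" and \<xi>: "\<xi> \<in> regulated_right T"
  shows "is_play T r q \<xi>"
proof -
  obtain V where V: "increments_dominated T \<xi> V"
    using obeys_play_increments_dominated[OF play r T q \<xi>] .
  have "\<exists>I\<ge>0. has_KS_integral (\<lambda>t. q t - \<xi> t - z t) \<xi> 0 T I"
    if z: "z \<in> regulated T" "sup_norm 0 T z \<le> r" for z
  proof -
    have "(\<lambda>t. q t - \<xi> t - z t) \<in> regulated T"
      by (intro regulated_diff regulated_right_imp_regulated[OF q] regulated_right_imp_regulated[OF \<xi>] z)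
    from has_KS_integral_regulated[OF this \<xi> V T]
    obtain I where I: "has_KS_integral (\<lambda>t. q t - \<xi> t - z t) \<xi> 0 T I" by blast
    have "\<bar>z t\<bar> \<le> r" if "t \<in> {0..T}" for t
      using sup_norm_upper[OF z(1) order_refl that] z(2) by simp
    from obeys_play_variational[OF play r T q \<xi> this I] I show ?thesis by blast
  qed
  then show ?thesis
    using play \<xi> increments_dominated_imp_bounded_var[OF V]
    unfolding is_play_def obeys_play_def by blast
qed

section \<open>The Preisach functional of a memory state\<close>

lemma AE_lebesgue_iff: "(AE x in lebesgue. P x) \<longleftrightarrow> (AE x in lborel. P x)"
  by (rule AE_completion_iff)

lemma borel_measurable_lebesgue_AE:
  fixes f g :: "'a::euclidean_space \<Rightarrow> real"
  assumes "g \<in> borel_measurable borel" "AE x in lborel. f x = g x"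
  shows "f \<in> borel_measurable lebesgue"
proof (rule borel_measurable_AE)
  show "g \<in> borel_measurable lebesgue" using assms(1) by (simp add: measurable_completion)
  show "AE x in lebesgue. g x = f x" using assms(2) unfolding AE_lebesgue_iff by eventually_elim simp
qed

lemma integral_lebesgue_AE:
  fixes f g :: "'a::euclidean_space \<Rightarrow> real"
  assumes "g \<in> borel_measurable borel" "AE x in lborel. f x = g x"
  shows "integral\<^sup>L lebesgue f = integral\<^sup>L lborel g"
proof -
  have "integral\<^sup>L lebesgue f = integral\<^sup>L lebesgue g"
    using assms by (intro integral_cong_AE borel_measurable_lebesgue_AE[OF assms])
       (auto simp: AE_lebesgue_iff measurable_completion)
  also have "\<dots> = integral\<^sup>L lborel g" using assms(1) by (intro integral_completion) simp
  finally show ?thesis .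
qed

lemma AE_lborel_pair:
  fixes P :: "'a::euclidean_space \<times> 'b::euclidean_space \<Rightarrow> bool"
  assumes "AE p in lborel. P p"
  shows "AE x in lborel. AE y in lborel. P (x, y)"
  using assms unfolding lborel_prod[symmetric] by (rule lborel_pair.AE_pair)

text \<open>A set whose complement is a null set is dense.\<close>

lemma AE_lborel_accumulates:
  fixes a :: "'a::euclidean_space"
  assumes "AE x in lborel. P x"
  obtains X where "\<And>n::nat. P (X n)" "X \<longlonglongrightarrow> a"
proof -
  have "\<exists>x. P x \<and> dist x a < inverse (real (Suc n))" for n
  proof (rule ccontr)
    assume neg: "\<not> (\<exists>x. P x \<and> dist x a < inverse (real (Suc n)))"
    obtain N where N: "N \<in> null_sets lborel" "{x. \<not> P x} \<subseteq> N"
      using assms unfolding eventually_ae_filter by auto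
    have "ball a (inverse (real (Suc n))) \<subseteq> N"
      using neg N(2) by (auto simp: dist_commute)
    moreover have "negligible N" using N(1) by (simp add: negligible_iff_null_sets null_sets_completionI)
    ultimately have "negligible (ball a (inverse (real (Suc n))))" using negligible_subset by blast
    then show False using open_not_negligible[of "ball a (inverse (real (Suc n)))"] by auto
  qed
  then obtain X where X: "\<And>n. P (X n)" "\<And>n. dist (X n) a < inverse (real (Suc n))" by metis
  have "X \<longlonglongrightarrow> a"
    by (rule metric_tendsto_imp_tendsto[OF LIMSEQ_inverse_real_of_nat])
       (use X(2) in \<open>auto intro!: always_eventually simp: less_imp_le\<close>)
  then show ?thesis using X(1) that by blast
qed

context
  fixes \<psi> :: "real ^ 'n \<Rightarrow> real \<Rightarrow> real \<Rightarrow> real" and \<mu> :: "real \<Rightarrow> real" and K :: "real \<Rightarrow> real \<Rightarrow> real"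
  assumes density: "preisach_density \<psi> \<mu> K"
begin

lemma density_AE:
  "AE (r, v) in lborel. r > 0 \<longrightarrow> (\<forall>u. 0 \<le> \<psi> u r v \<and> \<psi> u r v \<le> \<mu> r \<and> (\<exists>D. GDERIV (\<lambda>u. \<psi> u r v) u :> D \<and> norm D \<le> K r v))"
proof -
  have "AE x in lebesgue. x \<in> {0<..} \<times> UNIV \<longrightarrow>
     (case x of (r, v) \<Rightarrow> \<forall>u. 0 \<le> \<psi> u r v \<and> \<psi> u r v \<le> \<mu> r \<and> (\<exists>D. GDERIV (\<lambda>u. \<psi> u r v) u :> D \<and> norm D \<le> K r v))"
    using density unfolding preisach_density_def
    by (subst AE_restrict_space_iff[symmetric]) (auto intro!: sets_completionI_sets borel_open open_Times)
  then show ?thesis unfolding AE_lebesgue_iff by eventually_elim auto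
qed

text \<open>This is the mean value inequality for the parameter.\<close>

lemma density_Lipschitz:
  "AE (r, v) in lborel. r > 0 \<longrightarrow> (\<forall>u u'. \<bar>\<psi> u r v - \<psi> u' r v\<bar> \<le> K r v * norm (u - u'))"
  using density_AE
proof eventually_elim
  case (elim p)
  obtain r v where p: "p = (r, v)" by force
  have "\<bar>\<psi> u r v - \<psi> u' r v\<bar> \<le> K r v * norm (u - u')" if r: "r > 0" for u u'
  proof -
    have "\<forall>u. \<exists>D. GDERIV (\<lambda>u. \<psi> u r v) u :> D \<and> norm D \<le> K r v" using elim p r by auto
    then obtain D where D: "\<And>u. GDERIV (\<lambda>u. \<psi> u r v) u :> D u" "\<And>u. norm (D u) \<le> K r v" by metis
    have "norm (\<psi> u r v - \<psi> u' r v) \<le> K r v * norm (u - u')"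
    proof (rule differentiable_bound[where S=UNIV and f'="\<lambda>u h. inner h (D u)"])
      show "((\<lambda>u. \<psi> u r v) has_derivative (\<lambda>h. inner h (D x))) (at x within UNIV)" for x
        using D(1)[of x] by (simp add: gderiv_def)
      show "onorm (\<lambda>h. inner h (D x)) \<le> K r v" for x
      proof (rule onorm_le)
        fix h
        have "norm (inner h (D x)) \<le> norm h * norm (D x)" using Cauchy_Schwarz_ineq2[of h "D x"] by simp
        also have "\<dots> \<le> K r v * norm h" using mult_left_mono[OF D(2)[of x] norm_ge_zero[of h]] by (simp add: mult.commute)
        finally show "norm (inner h (D x)) \<le> K r v * norm h" .
      qed
    qed auto
    then show ?thesis by simp
  qed
  then show ?case by (auto simp: p)
qed

text \<open>Measurability of \<open>\<psi>\<close> on the product only yields measurable sections for almost every \<open>u\<close>; since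
  such \<open>u\<close> are dense and \<open>\<psi>\<close> is continuous in \<open>u\<close>, every section is an almost everywhere limit of
  measurable ones.\<close>

lemma density_section_Borel:
  obtains g where "g \<in> borel_measurable borel" "AE (r, v) in lborel. r > 0 \<longrightarrow> \<psi> u r v = g (r, v)"
proof -
  let ?S = "UNIV \<times> {0<..} \<times> UNIV :: ((real ^ 'n) \<times> real \<times> real) set"
  let ?h = "\<lambda>x. if x \<in> ?S then (case x of (u, r, v) \<Rightarrow> \<psi> u r v) else 0"
  have S: "?S \<in> sets lebesgue"
    by (auto intro!: sets_completionI_sets borel_open open_Times)
  have "?h \<in> borel_measurable (lebesgue_on UNIV)"
    using density S unfolding preisach_density_def
    by (subst borel_measurable_if_lebesgue_on) auto
  then have "?h \<in> borel_measurable (completion lborel)" by (simp add: lebesgue_on_UNIV_eq)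
  from completion_ex_borel_measurable_real[OF this]
  obtain G where G: "G \<in> borel_measurable lborel" "AE x in lborel. ?h x = G x" by blast
  have "AE x in lborel. AE p in lborel. ?h (x, p) = G (x, p)"
    using AE_lborel_pair[OF G(2)] .
  from AE_lborel_accumulates[OF this, of u]
  obtain X where X: "\<And>n::nat. AE p in lborel. ?h (X n, p) = G (X n, p)" "X \<longlonglongrightarrow> u" by blast
  define g where "g p = lim (\<lambda>n. G (X n, p))" for p
  have "(\<lambda>p. G (x, p)) \<in> borel_measurable borel" for x
  proof -
    have "G \<in> borel_measurable borel" using G(1) by simp
    moreover have "(\<lambda>p. (x, p)) \<in> borel_measurable borel"
      by (intro borel_measurable_continuous_onI continuous_intros)
    ultimately show ?thesis by (rule measurable_compose[rotated])
  qed
  then have g: "g \<in> borel_measurable borel" unfolding g_def by (rule borel_measurable_lim_metric)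
  have "AE p in lborel. \<forall>n. ?h (X n, p) = G (X n, p)" using X(1) by (simp add: AE_all_countable)
  then have "AE (r, v) in lborel. r > 0 \<longrightarrow> \<psi> u r v = g (r, v)"
    using density_Lipschitz
  proof eventually_elim
    case (elim p)
    obtain r v where p: "p = (r, v)" by force
    have "\<psi> u r v = g (r, v)" if r: "r > 0"
    proof -
      have "(\<lambda>n. \<psi> (X n) r v) \<longlonglongrightarrow> \<psi> u r v"
      proof (rule metric_tendsto_imp_tendsto)
        show "(\<lambda>n. K r v * norm (X n - u)) \<longlonglongrightarrow> 0"
          using X(2) by (intro tendsto_mult_right_zero tendsto_norm_zero) (simp add: LIM_zero)
        show "\<forall>\<^sub>F n in sequentially. dist (\<psi> (X n) r v) (\<psi> u r v) \<le> dist (K r v * norm (X n - u)) 0"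
        proof (intro always_eventually allI)
          fix n
          have "\<bar>\<psi> (X n) r v - \<psi> u r v\<bar> \<le> K r v * norm (X n - u)" using elim(2) r by (auto simp: p)
          then show "dist (\<psi> (X n) r v) (\<psi> u r v) \<le> dist (K r v * norm (X n - u)) 0"
            by (simp add: dist_real_def)
        qed
      qed
      moreover have "\<psi> (X n) r v = G (X n, p)" for n using elim(1) r by (auto simp: p)
      ultimately show ?thesis unfolding g_def using p by (auto dest: limI)
    qed
    then show ?case by (auto simp: p)
  qed
  with g show ?thesis by (rule that)
qed

text \<open>A Borel version of the kernel, cut off at \<open>r \<le> 0\<close>, so that Fubini's theorem on the Borel product
  applies to it.\<close>

lemma density_kernel_integrable:
  obtains k where "k \<in> borel_measurable borel" "integrable lborel k"
    "AE (r, v) in lborel. r > 0 \<longrightarrow> K r v = k (r, v)" "\<And>r v. r \<le> 0 \<Longrightarrow> k (r, v) = 0"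
proof -
  let ?S = "{0<..} \<times> UNIV :: (real \<times> real) set"
  let ?h = "\<lambda>x. indicator ?S x *\<^sub>R (case x of (r, v) \<Rightarrow> K r v)"
  have int: "integrable lebesgue ?h"
    using density unfolding preisach_density_def set_integrable_def by blast
  then have "?h \<in> borel_measurable (completion lborel)" by (rule borel_measurable_integrable)
  from completion_ex_borel_measurable_real[OF this]
  obtain k where k: "k \<in> borel_measurable lborel" "AE x in lborel. ?h x = k x" by blast
  define k' where "k' p = indicator ?S p * k p" for p
  have S: "?S \<in> sets borel" by (auto intro!: borel_open open_Times)
  have k': "k' \<in> borel_measurable borel" unfolding k'_def using k(1) S by simp
  have eq: "AE x in lborel. ?h x = k' x"
    using k(2)
  proof eventually_elim
    case (elim x)
    then show ?case by (cases "x \<in> ?S") (auto simp: k'_def)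
  qed
  have "integrable lebesgue k'"
  proof (rule integrable_cong_AE_imp[OF int])
    show "k' \<in> borel_measurable lebesgue" using k' by (simp add: measurable_completion)
    show "AE x in lebesgue. ?h x = k' x" using eq unfolding AE_lebesgue_iff .
  qed
  then have "integrable lborel k'" using k' by (subst (asm) integrable_completion) auto
  moreover have "AE (r, v) in lborel. r > 0 \<longrightarrow> K r v = k' (r, v)"
    using eq by eventually_elim auto
  ultimately show ?thesis using that[of k'] k' by (auto simp: k'_def)
qed

end

text \<open>The signed indicator of the oriented interval from \<open>0\<close> to \<open>a\<close>.\<close>

definition oriented :: "real \<Rightarrow> real \<Rightarrow> real" where
  "oriented a v = indicator {0<..<a} v - indicator {a<..<0} v"

lemma oriented_measurable [measurable]:
  "(\<lambda>x. oriented (fst x) (snd x)) \<in> borel_measurable borel"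
proof -
  let ?A = "{x::real\<times>real. 0 < snd x} \<inter> {x. snd x < fst x}" and ?B = "{x::real\<times>real. fst x < snd x} \<inter> {x. snd x < 0}"
  have "open ?A" "open ?B"
    by (intro open_Int open_Collect_less continuous_intros)+
  then have "(\<lambda>x. indicator ?A x - indicator ?B x :: real) \<in> borel_measurable borel"
    by (intro borel_measurable_diff borel_measurable_indicator borel_open)
  moreover have "oriented (fst x) (snd x) = indicator ?A x - indicator ?B x" for x
    by (auto simp: oriented_def indicator_def)
  ultimately show ?thesis by simp
qed

lemma oriented_mono: "a \<le> b \<Longrightarrow> oriented a v \<le> oriented b v"
  by (auto simp: oriented_def indicator_def)

lemma oriented_diff_bound: "a \<le> b \<Longrightarrow> oriented b v - oriented a v \<le> indicator {a..b} v"
  by (auto simp: oriented_def indicator_def)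

lemma interval_lebesgue_integral_oriented:
  fixes f :: "real \<Rightarrow> real"
  shows "interval_lebesgue_integral M 0 (ereal a) f = (LINT v|M. oriented a v * f v)"
proof (cases "0 \<le> a")
  case True
  then have "einterval 0 (ereal a) = {0<..<a}" by (auto simp: einterval_def)
  then show ?thesis using True
    by (simp add: interval_lebesgue_integral_def set_lebesgue_integral_def oriented_def)
next
  case False
  then have "einterval (ereal a) 0 = {a<..<0}" by (auto simp: einterval_def)
  then show ?thesis using False
    by (simp add: interval_lebesgue_integral_def set_lebesgue_integral_def oriented_def)
qed

lemma oriented_integrable:
  fixes f :: "real \<Rightarrow> real"
  assumes "f \<in> borel_measurable lebesgue" "AE v in lebesgue. 0 \<le> f v \<and> f v \<le> m"
  shows "integrable lebesgue (\<lambda>v. oriented a v * f v)"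
proof (rule integrableI_bounded_set[where A="{- \<bar>a\<bar>..\<bar>a\<bar>}" and B=m])
  have "oriented a \<in> borel_measurable lebesgue"
    unfolding oriented_def by (intro borel_measurable_diff borel_measurable_indicator) auto
  then show "(\<lambda>v. oriented a v * f v) \<in> borel_measurable lebesgue" using assms(1) by simp
  show "AE v in lebesgue. v \<in> {- \<bar>a\<bar>..\<bar>a\<bar>} \<longrightarrow> norm (oriented a v * f v) \<le> m"
    using assms(2)
  proof eventually_elim
    case (elim v)
    have "\<bar>oriented a v\<bar> \<le> 1" by (auto simp: oriented_def indicator_def)
    then have "\<bar>oriented a v\<bar> * \<bar>f v\<bar> \<le> 1 * m" using elim by (intro mult_mono) auto
    then show ?case by (simp add: abs_mult)
  qed
  show "AE v in lebesgue. v \<notin> {- \<bar>a\<bar>..\<bar>a\<bar>} \<longrightarrow> oriented a v * f v = 0"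
    by (rule AE_I2) (auto simp: oriented_def indicator_def)
qed auto

text \<open>Increasing the upper limit increases the integral, by at most \<open>m\<close> per unit length; the positive part
  expresses both facts in one inequality.\<close>

lemma oriented_integral_diff:
  fixes f :: "real \<Rightarrow> real"
  assumes f: "f \<in> borel_measurable lebesgue" "AE v in lebesgue. 0 \<le> f v \<and> f v \<le> m"
  shows "(LINT v|lebesgue. oriented b v * f v) - (LINT v|lebesgue. oriented a v * f v) \<le> m * max 0 (b - a)"
proof -
  note int = oriented_integrable[OF f]
  have eq: "(LINT v|lebesgue. oriented b v * f v) - (LINT v|lebesgue. oriented a v * f v)
      = (LINT v|lebesgue. (oriented b v - oriented a v) * f v)"
    by (subst Bochner_Integration.integral_diff[symmetric]) (auto intro: int simp: left_diff_distrib)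
  have int': "integrable lebesgue (\<lambda>v. (oriented b v - oriented a v) * f v)"
    using Bochner_Integration.integrable_diff[OF int[of b] int[of a]] by (simp add: left_diff_distrib)
  show ?thesis
  proof (cases "a \<le> b")
    case True
    have "(LINT v|lebesgue. (oriented b v - oriented a v) * f v) \<le> (LINT v|lebesgue. indicator {a..b} v * m)"
    proof (rule integral_mono_AE[OF int'])
      show "integrable lebesgue (\<lambda>v. indicator {a..b} v * m)"
        by (intro integrable_mult_left integrable_real_indicator) (auto simp: emeasure_lborel_Icc_eq)
      show "AE v in lebesgue. (oriented b v - oriented a v) * f v \<le> indicator {a..b} v * m"
        using f(2) by eventually_elim
          (intro mult_mono; use oriented_diff_bound[OF True] oriented_mono[OF True] in auto)
    qed
    also have "\<dots> = m * (b - a)" using True by simp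
    finally show ?thesis using True eq by simp
  next
    case False
    have "(LINT v|lebesgue. (oriented b v - oriented a v) * f v) \<le> (LINT v|(lebesgue :: real measure). 0 :: real)"
    proof (rule integral_mono_AE[OF int'])
      show "AE v in lebesgue. (oriented b v - oriented a v) * f v \<le> 0"
        using f(2) by eventually_elim
          (use False oriented_mono[of b a] in \<open>auto intro!: mult_nonpos_nonneg\<close>)
    qed simp
    then show ?thesis using False eq by simp
  qed
qed

text \<open>The values of the plays of all radii at one time; they are meaningful for \<open>r \<ge> 0\<close> only.\<close>

definition memory_state :: "(real \<Rightarrow> real) \<Rightarrow> bool" where
  "memory_state \<phi> \<longleftrightarrow> (\<forall>r\<ge>0. \<forall>s\<ge>0. \<bar>\<phi> r - \<phi> s\<bar> \<le> \<bar>r - s\<bar>) \<and> (\<exists>C. \<forall>r\<ge>0. \<bar>\<phi> r\<bar> \<le> C)"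

definition preisach_functional ::
    "(real ^ 'n \<Rightarrow> real \<Rightarrow> real \<Rightarrow> real) \<Rightarrow> real ^ 'n \<Rightarrow> (real \<Rightarrow> real) \<Rightarrow> real" where
  "preisach_functional \<psi> u \<phi> =
     (LINT r:{0<..}|lebesgue. interval_lebesgue_integral lebesgue 0 (ereal (\<phi> r)) (\<psi> u r))"

lemma Lipschitz_continuous_on_nonneg:
  fixes \<phi> :: "real \<Rightarrow> real"
  assumes "\<And>r s. 0 \<le> r \<Longrightarrow> 0 \<le> s \<Longrightarrow> \<bar>\<phi> r - \<phi> s\<bar> \<le> C * \<bar>r - s\<bar>"
  shows "continuous_on {0..} \<phi>"
proof (rule continuous_onI)
  fix x e :: real assume x: "x \<in> {0..}" "e > 0"
  have "dist (\<phi> y) (\<phi> x) \<le> e" if "y \<in> {0..}" "dist y x < e / (\<bar>C\<bar> + 1)" for y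
  proof -
    have "\<bar>\<phi> y - \<phi> x\<bar> \<le> C * \<bar>y - x\<bar>" using assms x that by auto
    also have "\<dots> \<le> (\<bar>C\<bar> + 1) * \<bar>y - x\<bar>" by (intro mult_right_mono) auto
    also have "\<dots> \<le> e" using that(2) by (simp add: dist_real_def pos_less_divide_eq mult.commute add_nonneg_pos)
    finally show ?thesis by (simp add: dist_real_def)
  qed
  moreover have "e / (\<bar>C\<bar> + 1) > 0" using x(2) by (simp add: add_nonneg_pos)
  ultimately show "\<exists>d>0. \<forall>y\<in>{0..}. dist y x < d \<longrightarrow> dist (\<phi> y) (\<phi> x) \<le> e" by blast
qed

lemma memory_state_continuous: "memory_state \<phi> \<Longrightarrow> continuous_on {0..} \<phi>"
  by (rule Lipschitz_continuous_on_nonneg[where C=1]) (auto simp: memory_state_def)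

lemma memory_state_bounded:
  assumes "memory_state \<phi>"
  obtains C where "\<And>r. 0 \<le> r \<Longrightarrow> \<bar>\<phi> r\<bar> \<le> C"
  using assms by (auto simp: memory_state_def)

lemma Borel_if_continuous_on_nonneg:
  fixes b :: "real \<Rightarrow> real"
  assumes "continuous_on {0..} b"
  shows "(\<lambda>r. indicator {0<..} r * b r) \<in> borel_measurable borel"
proof -
  have "continuous_on {0<..} b" by (rule continuous_on_subset[OF assms]) auto
  then show ?thesis using borel_measurable_continuous_on_indicator[of "{0<..}" b] by auto
qed

context
  fixes \<psi> :: "real ^ 'n \<Rightarrow> real \<Rightarrow> real \<Rightarrow> real" and \<mu> :: "real \<Rightarrow> real" and K :: "real \<Rightarrow> real \<Rightarrow> real"
  assumes density: "preisach_density \<psi> \<mu> K"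
begin

lemma weight_integrable: "integrable lebesgue (\<lambda>r. indicator {0<..} r * \<mu> r)"
  using density by (simp add: preisach_density_def set_integrable_def)

lemma weight_mult_integrable:
  assumes b: "continuous_on {0..} b" "\<And>r. 0 \<le> r \<Longrightarrow> \<bar>b r\<bar> \<le> C"
  shows "set_integrable lebesgue {0<..} (\<lambda>r. \<mu> r * b r)"
proof -
  have b_meas: "(\<lambda>r. indicator {0<..} r * b r) \<in> borel_measurable lebesgue"
    using Borel_if_continuous_on_nonneg[OF b(1)] by (simp add: measurable_completion)
  have "integrable lebesgue (\<lambda>r. (indicator {0<..} r * \<mu> r) * (indicator {0<..} r * b r))"
  proof (rule Bochner_Integration.integrable_bound)
    show "integrable lebesgue (\<lambda>r. C * (indicator {0<..} r * \<mu> r))"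
      by (intro integrable_mult_right weight_integrable)
    show "(\<lambda>r. indicator {0<..} r * \<mu> r * (indicator {0<..} r * b r)) \<in> borel_measurable lebesgue"
      by (rule borel_measurable_times[OF borel_measurable_integrable[OF weight_integrable] b_meas])
    show "AE r in lebesgue. norm (indicator {0<..} r * \<mu> r * (indicator {0<..} r * b r)) \<le> norm (C * (indicator {0<..} r * \<mu> r))"
    proof (rule AE_I2)
      fix r :: real
      show "norm (indicator {0<..} r * \<mu> r * (indicator {0<..} r * b r)) \<le> norm (C * (indicator {0<..} r * \<mu> r))"
      proof (cases "r > 0")
        case True
        then have "\<bar>b r\<bar> \<le> \<bar>C\<bar>" using b(2)[of r] by simp
        then have "\<bar>\<mu> r\<bar> * \<bar>b r\<bar> \<le> \<bar>C\<bar> * \<bar>\<mu> r\<bar>" using mult_left_mono[of "\<bar>b r\<bar>" "\<bar>C\<bar>" "\<bar>\<mu> r\<bar>"] by (simp add: mult.commute)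
        then show ?thesis using True by (simp add: abs_mult)
      qed simp
    qed
  qed
  moreover have "(\<lambda>r. indicator {0<..} r * \<mu> r * (indicator {0<..} r * b r)) = (\<lambda>r. indicator {0<..} r *\<^sub>R (\<mu> r * b r))"
    by (auto simp: indicator_def)
  ultimately show ?thesis unfolding set_integrable_def by simp
qed

lemma section_AE:
  "AE r in lebesgue. r > 0 \<longrightarrow> \<psi> u r \<in> borel_measurable lebesgue \<and> (AE v in lebesgue. 0 \<le> \<psi> u r v \<and> \<psi> u r v \<le> \<mu> r)"
proof -
  obtain g where g: "g \<in> borel_measurable borel" "AE (r, v) in lborel. r > 0 \<longrightarrow> \<psi> u r v = g (r, v)"
    using density_section_Borel[OF density] .
  have "AE p in lborel. case p of (r, v) \<Rightarrow> r > 0 \<longrightarrow> \<psi> u r v = g (r, v) \<and> 0 \<le> \<psi> u r v \<and> \<psi> u r v \<le> \<mu> r"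
    using g(2) density_AE[OF density] by eventually_elim auto
  from AE_lborel_pair[OF this] show ?thesis
    unfolding AE_lebesgue_iff
  proof eventually_elim
    case (elim r)
    have gr: "(\<lambda>v. g (r, v)) \<in> borel_measurable borel"
    proof -
      have "(\<lambda>v::real. (r, v)) \<in> borel_measurable borel"
        by (intro borel_measurable_continuous_onI continuous_intros)
      then show ?thesis using g(1) by (rule measurable_compose)
    qed
    show ?case
    proof
      assume r: "r > 0"
      have "AE v in lborel. \<psi> u r v = g (r, v)" using elim by eventually_elim (use r in auto)
      moreover have "AE v in lborel. 0 \<le> \<psi> u r v \<and> \<psi> u r v \<le> \<mu> r" using elim by eventually_elim (use r in auto)
      ultimately show "\<psi> u r \<in> borel_measurable lebesgue \<and> (AE v in lborel. 0 \<le> \<psi> u r v \<and> \<psi> u r v \<le> \<mu> r)"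
        using borel_measurable_lebesgue_AE[OF gr] by blast
    qed
  qed
qed

text \<open>The sign is inherited from \<open>0 \<le> \<psi> \<le> \<mu>\<close> at an arbitrary parameter value.\<close>

lemma weight_nonneg: "AE r in lebesgue. r > 0 \<longrightarrow> 0 \<le> \<mu> r"
  using section_AE[of undefined]
proof eventually_elim
  case (elim r)
  show ?case
  proof
    assume "r > 0"
    then have ae: "AE v in (lebesgue :: real measure). 0 \<le> \<mu> r" using elim by (auto elim: eventually_mono)
    show "0 \<le> \<mu> r"
    proof (rule ccontr)
      assume "\<not> 0 \<le> \<mu> r"
      then have "AE v in (lborel :: real measure). False" using ae unfolding AE_lebesgue_iff by simp
      from AE_lborel_accumulates[OF this, of 0] show False by blast
    qed
  qed
qed

lemma inner_integral_diff:
  "AE r in lebesgue. r > 0 \<longrightarrow> (\<forall>a b. interval_lebesgue_integral lebesgue 0 (ereal b) (\<psi> u r) -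
     interval_lebesgue_integral lebesgue 0 (ereal a) (\<psi> u r) \<le> \<mu> r * max 0 (b - a))"
  using section_AE[of u]
  by eventually_elim (auto simp: interval_lebesgue_integral_oriented intro!: oriented_integral_diff)

text \<open>Measurability in \<open>r\<close> is not inherited from the sections; it comes from Fubini's theorem for a Borel
  version of \<open>\<psi>\<close>, multiplied by the signed indicator of the region below the graph of \<open>\<phi>\<close>.\<close>

lemma preisach_integrand_integrable:
  assumes \<phi>: "memory_state \<phi>"
  shows "set_integrable lebesgue {0<..} (\<lambda>r. interval_lebesgue_integral lebesgue 0 (ereal (\<phi> r)) (\<psi> u r))"
proof -
  let ?J = "\<lambda>r. interval_lebesgue_integral lebesgue 0 (ereal (\<phi> r)) (\<psi> u r)"
  obtain C where C: "\<And>r. 0 \<le> r \<Longrightarrow> \<bar>\<phi> r\<bar> \<le> C" using memory_state_bounded[OF \<phi>] by blast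
  obtain g where g: "g \<in> borel_measurable borel" "AE (r, v) in lborel. r > 0 \<longrightarrow> \<psi> u r v = g (r, v)"
    using density_section_Borel[OF density] .
  define \<phi>' where "\<phi>' r = indicator {0<..} r * \<phi> r" for r
  have l': "\<phi>' \<in> borel_measurable borel"
    unfolding \<phi>'_def by (rule Borel_if_continuous_on_nonneg[OF memory_state_continuous[OF \<phi>]])
  define F where "F r = (LINT v|lborel. oriented (\<phi>' r) v * g (r, v))" for r
  have meas2: "(\<lambda>(r, v). oriented (\<phi>' r) v * g (r, v)) \<in> borel_measurable (borel :: (real \<times> real) measure)"
  proof -
    have "(\<lambda>p. (\<phi>' (fst p), snd p)) \<in> borel_measurable (borel :: (real \<times> real) measure)"
      by (intro borel_measurable_Pair measurable_compose[OF _ l']; intro borel_measurable_continuous_onI continuous_intros)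
    from measurable_compose[OF this oriented_measurable]
    have "(\<lambda>p. oriented (\<phi>' (fst p)) (snd p)) \<in> borel_measurable (borel :: (real \<times> real) measure)" by simp
    from borel_measurable_times[OF this g(1)] show ?thesis by (simp add: case_prod_beta')
  qed
  have F: "F \<in> borel_measurable borel"
  proof -
    have "F \<in> borel_measurable lborel"
      unfolding F_def
      by (rule lborel.borel_measurable_lebesgue_integral) (use meas2 in \<open>simp add: lborel_prod\<close>)
    then show ?thesis by simp
  qed
  have eq: "AE r in lborel. indicator {0<..} r * ?J r = indicator {0<..} r * F r"
    using AE_lborel_pair[OF g(2)]
  proof eventually_elim
    case (elim r)
    show ?case
    proof (cases "r > 0")
      case True
      have gr: "(\<lambda>v. oriented (\<phi>' r) v * g (r, v)) \<in> borel_measurable borel"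
      proof -
        have "(\<lambda>v::real. (r, v)) \<in> borel_measurable borel"
          by (intro borel_measurable_continuous_onI continuous_intros)
        from measurable_compose[OF this meas2] show ?thesis by simp
      qed
      have ae: "AE v in lborel. oriented (\<phi> r) v * \<psi> u r v = oriented (\<phi>' r) v * g (r, v)"
        using elim by eventually_elim (use True in \<open>auto simp: \<phi>'_def\<close>)
      show ?thesis
        using integral_lebesgue_AE[OF gr ae] by (simp add: interval_lebesgue_integral_oriented F_def)
    qed simp
  qed
  have Fi: "(\<lambda>r. indicator {0<..} r * F r) \<in> borel_measurable borel"
    using F by (intro borel_measurable_times) auto
  have "integrable lebesgue (\<lambda>r. indicator {0<..} r * ?J r)"
  proof (rule Bochner_Integration.integrable_bound)
    show "integrable lebesgue (\<lambda>r. C * (indicator {0<..} r * \<mu> r))"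
      by (intro integrable_mult_right weight_integrable)
    show "(\<lambda>r. indicator {0<..} r * ?J r) \<in> borel_measurable lebesgue"
      by (rule borel_measurable_lebesgue_AE[OF Fi eq])
    show "AE r in lebesgue. norm (indicator {0<..} r * ?J r) \<le> norm (C * (indicator {0<..} r * \<mu> r))"
      using inner_integral_diff[of u] weight_nonneg
    proof eventually_elim
      case (elim r)
      show ?case
      proof (cases "r > 0")
        case True
        have J0: "interval_lebesgue_integral lebesgue 0 (ereal 0) (\<psi> u r) = 0"
          unfolding interval_lebesgue_integral_oriented by (simp add: oriented_def)
        have "?J r \<le> \<mu> r * max 0 (\<phi> r)" "- ?J r \<le> \<mu> r * max 0 (- \<phi> r)"
          using elim(1)[rule_format, OF True, of "\<phi> r" 0] elim(1)[rule_format, OF True, of 0 "\<phi> r"] J0 by auto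
        moreover have "\<mu> r * max 0 (\<phi> r) \<le> \<mu> r * C" "\<mu> r * max 0 (- \<phi> r) \<le> \<mu> r * C"
          using C[of r] elim(2) True by (auto intro!: mult_left_mono)
        ultimately have "\<bar>?J r\<bar> \<le> \<mu> r * C" by linarith
        then show ?thesis using True by (simp add: mult.commute)
      qed simp
    qed
  qed
  then show ?thesis by (simp add: set_integrable_def)
qed

text \<open>The dynamics only uses the dependence on the state through this inequality: the right-hand side
  vanishes when \<open>\<phi>' \<le> \<phi>\<close>, is Lipschitz in general, and only sees the radii at which \<open>\<phi>' > \<phi>\<close>.\<close>

lemma preisach_functional_diff_le:
  assumes "memory_state \<phi>" "memory_state \<phi>'"
  shows "preisach_functional \<psi> u \<phi>' - preisach_functional \<psi> u \<phi> \<le>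
    (LINT r:{0<..}|lebesgue. \<mu> r * max 0 (\<phi>' r - \<phi> r))"
proof -
  note int = preisach_integrand_integrable[OF assms(1), of u] preisach_integrand_integrable[OF assms(2), of u]
  obtain C where C: "\<And>r. 0 \<le> r \<Longrightarrow> \<bar>\<phi> r\<bar> \<le> C" using memory_state_bounded[OF assms(1)] by blast
  obtain C' where C': "\<And>r. 0 \<le> r \<Longrightarrow> \<bar>\<phi>' r\<bar> \<le> C'" using memory_state_bounded[OF assms(2)] by blast
  have "preisach_functional \<psi> u \<phi>' - preisach_functional \<psi> u \<phi> =
     (LINT r:{0<..}|lebesgue. interval_lebesgue_integral lebesgue 0 (ereal (\<phi>' r)) (\<psi> u r) -
        interval_lebesgue_integral lebesgue 0 (ereal (\<phi> r)) (\<psi> u r))"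
    unfolding preisach_functional_def using int by (simp add: set_integral_diff(2))
  also have "\<dots> \<le> (LINT r:{0<..}|lebesgue. \<mu> r * max 0 (\<phi>' r - \<phi> r))"
  proof (rule set_integral_mono_AE)
    show "set_integrable lebesgue {0<..} (\<lambda>r. \<mu> r * max 0 (\<phi>' r - \<phi> r))"
    proof (rule weight_mult_integrable)
      show "continuous_on {0..} (\<lambda>r. max 0 (\<phi>' r - \<phi> r))"
        by (intro continuous_intros memory_state_continuous assms)
      show "\<bar>max 0 (\<phi>' r - \<phi> r)\<bar> \<le> C + C'" if "0 \<le> r" for r
        using C[OF that] C'[OF that] by auto
    qed
    show "AE r\<in>{0<..} in lebesgue. interval_lebesgue_integral lebesgue 0 (ereal (\<phi>' r)) (\<psi> u r) -
        interval_lebesgue_integral lebesgue 0 (ereal (\<phi> r)) (\<psi> u r) \<le> \<mu> r * max 0 (\<phi>' r - \<phi> r)"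
      using inner_integral_diff[of u] by eventually_elim auto
  qed (use int in \<open>simp add: set_integral_diff(1)\<close>)
  finally show ?thesis .
qed

lemma preisach_functional_parameter_Lipschitz:
  assumes "memory_state \<phi>"
  shows "\<bar>preisach_functional \<psi> u \<phi> - preisach_functional \<psi> u' \<phi>\<bar> \<le>
    (LINT r:{0<..}|lebesgue. (LINT v|lebesgue. K r v)) * norm (u - u')"
proof -
  note int = preisach_integrand_integrable[OF assms, of u] preisach_integrand_integrable[OF assms, of u']
  obtain k where k: "k \<in> borel_measurable borel" "integrable lborel k"
    "AE (r, v) in lborel. r > 0 \<longrightarrow> K r v = k (r, v)" "\<And>r v. r \<le> 0 \<Longrightarrow> k (r, v) = 0"
    using density_kernel_integrable[OF density] by blast
  have k2: "integrable (lborel \<Otimes>\<^sub>M lborel) k" using k(2) by (simp add: lborel_prod)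
  define k1 where "k1 r = (LINT v|lborel. k (r, v))" for r
  have k1: "integrable lborel k1" unfolding k1_def by (rule lborel_pair.integrable_fst'[OF k2])
  have k1_meas: "k1 \<in> borel_measurable borel" using k1 by (auto dest: borel_measurable_integrable)
  have section_k: "(\<lambda>v. k (r, v)) \<in> borel_measurable borel" for r
  proof -
    have "(\<lambda>v::real. (r, v)) \<in> borel_measurable borel"
      by (intro borel_measurable_continuous_onI continuous_intros)
    then show ?thesis using k(1) by (rule measurable_compose)
  qed
  have kern: "AE r in lebesgue. r > 0 \<longrightarrow> integrable lebesgue (K r) \<and> (LINT v|lebesgue. K r v) = k1 r"
    using AE_lborel_pair[OF k(3)] lborel_pair.AE_integrable_fst'[OF k2] unfolding AE_lebesgue_iff
  proof eventually_elim
    case (elim r)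
    show ?case
    proof
      assume r: "r > 0"
      have ae: "AE v in lborel. K r v = k (r, v)" using elim(1) by eventually_elim (use r in auto)
      have "integrable lebesgue (\<lambda>v. k (r, v))"
        using elim(2) section_k by (subst integrable_completion) auto
      then have "integrable lebesgue (K r)"
        by (rule integrable_cong_AE_imp)
           (use borel_measurable_lebesgue_AE[OF section_k ae] ae in \<open>auto simp: AE_lebesgue_iff elim: eventually_mono\<close>)
      then show "integrable lebesgue (K r) \<and> (LINT v|lebesgue. K r v) = k1 r"
        using integral_lebesgue_AE[OF section_k ae] by (simp add: k1_def)
    qed
  qed
  have k1_int: "integrable lebesgue k1" using k1 k1_meas by (subst integrable_completion) auto
  have k1_eq: "AE r in lborel. indicator {0<..} r * (LINT v|lebesgue. K r v) = k1 r"
    using kern unfolding AE_lebesgue_iff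
  proof eventually_elim
    case (elim r)
    then show ?case using k(4)[of r] by (cases "r > 0") (auto simp: k1_def)
  qed
  have K_int: "set_integrable lebesgue {0<..} (\<lambda>r. LINT v|lebesgue. K r v)"
    unfolding set_integrable_def
    by (rule integrable_cong_AE_imp[OF k1_int])
       (use borel_measurable_lebesgue_AE[OF k1_meas k1_eq] k1_eq in \<open>auto simp: AE_lebesgue_iff elim: eventually_mono\<close>)
  have Lip: "AE r in lebesgue. r > 0 \<longrightarrow> (AE v in lebesgue. \<bar>\<psi> u r v - \<psi> u' r v\<bar> \<le> K r v * norm (u - u'))"
    using AE_lborel_pair[OF density_Lipschitz[OF density]] unfolding AE_lebesgue_iff
    by eventually_elim (auto elim: eventually_mono)
  let ?J = "\<lambda>u r. interval_lebesgue_integral lebesgue 0 (ereal (\<phi> r)) (\<psi> u r)"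
  have inner: "AE r in lebesgue. r > 0 \<longrightarrow> \<bar>?J u r - ?J u' r\<bar> \<le> (LINT v|lebesgue. K r v) * norm (u - u')"
    using section_AE[of u] section_AE[of u'] kern Lip
  proof eventually_elim
    case (elim r)
    show ?case
    proof
      assume r: "r > 0"
      have i1: "integrable lebesgue (\<lambda>v. oriented (\<phi> r) v * \<psi> u r v)"
        using elim(1) r by (intro oriented_integrable) auto
      have i2: "integrable lebesgue (\<lambda>v. oriented (\<phi> r) v * \<psi> u' r v)"
        using elim(2) r by (intro oriented_integrable) auto
      have J_diff: "?J u r - ?J u' r = (LINT v|lebesgue. oriented (\<phi> r) v * \<psi> u r v - oriented (\<phi> r) v * \<psi> u' r v)"
        unfolding interval_lebesgue_integral_oriented by (simp add: Bochner_Integration.integral_diff[OF i1 i2])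
      have "\<bar>?J u r - ?J u' r\<bar> \<le> (LINT v|lebesgue. \<bar>oriented (\<phi> r) v * \<psi> u r v - oriented (\<phi> r) v * \<psi> u' r v\<bar>)"
        unfolding J_diff by (rule integral_abs_bound)
      also have "\<dots> \<le> (LINT v|lebesgue. K r v * norm (u - u'))"
      proof (rule integral_mono_AE)
        show "integrable lebesgue (\<lambda>v. \<bar>oriented (\<phi> r) v * \<psi> u r v - oriented (\<phi> r) v * \<psi> u' r v\<bar>)"
          by (intro integrable_abs Bochner_Integration.integrable_diff i1 i2)
        show "integrable lebesgue (\<lambda>v. K r v * norm (u - u'))" using elim(3) r by auto
        have "AE v in lebesgue. \<bar>\<psi> u r v - \<psi> u' r v\<bar> \<le> K r v * norm (u - u')" using elim(4) r by auto
        then show "AE v in lebesgue. \<bar>oriented (\<phi> r) v * \<psi> u r v - oriented (\<phi> r) v * \<psi> u' r v\<bar> \<le> K r v * norm (u - u')"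
        proof eventually_elim
          case (elim v)
          have "\<bar>oriented (\<phi> r) v\<bar> \<le> 1" by (auto simp: oriented_def indicator_def)
          then have "\<bar>oriented (\<phi> r) v\<bar> * \<bar>\<psi> u r v - \<psi> u' r v\<bar> \<le> 1 * \<bar>\<psi> u r v - \<psi> u' r v\<bar>"
            by (intro mult_right_mono) auto
          then show ?case using elim by (simp add: right_diff_distrib[symmetric] abs_mult)
        qed
      qed
      also have "\<dots> = (LINT v|lebesgue. K r v) * norm (u - u')" by simp
      finally show "\<bar>?J u r - ?J u' r\<bar> \<le> (LINT v|lebesgue. K r v) * norm (u - u')" .
    qed
  qed
  have "preisach_functional \<psi> u \<phi> - preisach_functional \<psi> u' \<phi> = (LINT r:{0<..}|lebesgue. ?J u r - ?J u' r)"
    unfolding preisach_functional_def using int by (simp add: set_integral_diff(2))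
  also have "\<bar>\<dots>\<bar> \<le> (LINT r:{0<..}|lebesgue. \<bar>?J u r - ?J u' r\<bar>)"
    unfolding set_lebesgue_integral_def by (rule order_trans[OF integral_abs_bound]) (simp add: abs_mult)
  also have "\<dots> \<le> (LINT r:{0<..}|lebesgue. (LINT v|lebesgue. K r v) * norm (u - u'))"
  proof (rule set_integral_mono_AE)
    show "set_integrable lebesgue {0<..} (\<lambda>r. \<bar>?J u r - ?J u' r\<bar>)"
      using int by (intro set_integrable_abs set_integral_diff(1))
    show "set_integrable lebesgue {0<..} (\<lambda>r. (LINT v|lebesgue. K r v) * norm (u - u'))"
      using K_int by (rule set_integrable_mult_left)
    show "AE r\<in>{0<..} in lebesgue. \<bar>?J u r - ?J u' r\<bar> \<le> (LINT v|lebesgue. K r v) * norm (u - u')"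
      using inner by eventually_elim auto
  qed
  also have "\<dots> = (LINT r:{0<..}|lebesgue. (LINT v|lebesgue. K r v)) * norm (u - u')"
    by (rule set_integral_mult_left)
  finally show ?thesis .
qed

end

section \<open>Piecewise constant trajectories of memory states\<close>

text \<open>One step of the play of radius \<open>r\<close> when the input jumps to \<open>x\<close>: the old value is projected onto
  \<open>[x - r, x + r]\<close>.\<close>

definition play_update :: "real \<Rightarrow> (real \<Rightarrow> real) \<Rightarrow> real \<Rightarrow> real" where
  "play_update x \<phi> r = max (x - r) (min (\<phi> r) (x + r))"

lemma play_update_0 [simp]: "play_update x \<phi> 0 = x"
  by (simp add: play_update_def)

lemma play_update_Lipschitz:
  "\<bar>play_update x \<phi> r - play_update y \<phi>' r\<bar> \<le> max \<bar>x - y\<bar> \<bar>\<phi> r - \<phi>' r\<bar>"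
  unfolding play_update_def by linarith

lemma play_update_mono: "x \<le> y \<Longrightarrow> play_update x \<phi> r \<le> play_update y \<phi> r"
  unfolding play_update_def by linarith

lemma play_update_idem: "0 \<le> r \<Longrightarrow> play_update x (play_update x \<phi>) r = play_update x \<phi> r"
  unfolding play_update_def by linarith

lemma play_update_uminus: "0 \<le> r \<Longrightarrow> play_update (- x) (\<lambda>r. - \<phi> r) r = - play_update x \<phi> r"
  unfolding play_update_def by linarith

lemma memory_state_zero: "memory_state (\<lambda>_. 0)"
  by (auto simp: memory_state_def)

lemma memory_state_Lipschitz: "memory_state \<phi> \<Longrightarrow> 0 \<le> r \<Longrightarrow> 0 \<le> s \<Longrightarrow> \<bar>\<phi> r - \<phi> s\<bar> \<le> \<bar>r - s\<bar>"
  by (simp add: memory_state_def)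

lemma memory_state_uminus: "memory_state \<phi> \<Longrightarrow> memory_state (\<lambda>r. - \<phi> r)"
  by (auto simp: memory_state_def abs_minus_commute)

lemma memory_state_play_update:
  assumes "memory_state \<phi>"
  shows "memory_state (play_update x \<phi>)"
  unfolding memory_state_def
proof (intro conjI allI impI)
  fix r s :: real assume rs: "0 \<le> r" "0 \<le> s"
  show "\<bar>play_update x \<phi> r - play_update x \<phi> s\<bar> \<le> \<bar>r - s\<bar>"
    using memory_state_Lipschitz[OF assms rs] unfolding play_update_def by linarith
next
  obtain C where C: "\<And>r. 0 \<le> r \<Longrightarrow> \<bar>\<phi> r\<bar> \<le> C" using memory_state_bounded[OF assms] by blast
  have "\<bar>play_update x \<phi> r\<bar> \<le> max \<bar>x\<bar> C" if "0 \<le> r" for r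
    using C[OF that] that unfolding play_update_def by linarith
  then show "\<exists>C. \<forall>r\<ge>0. \<bar>play_update x \<phi> r\<bar> \<le> C" by blast
qed

text \<open>The state is constant between grid points and is updated at grid points.  Both conditions only speak of
  intervals that contain few grid points, hence they become weaker when the grid is refined; two
  trajectories on different grids are therefore trajectories on the union of the grids.  The common bound
  \<open>R\<close> for the supports makes the Gronwall argument start at a finite radius.\<close>

definition step_trajectory :: "real set \<Rightarrow> (real \<Rightarrow> real \<Rightarrow> real) \<Rightarrow> bool" where
  "step_trajectory G \<Lambda> \<longleftrightarrow> finite G \<and>
     (\<forall>t\<ge>0. memory_state (\<Lambda> t)) \<and>
     (\<exists>R. \<forall>t\<ge>0. \<forall>r\<ge>R. \<Lambda> t r = 0) \<and>
     (\<forall>r\<ge>0. \<Lambda> 0 r = play_update (\<Lambda> 0 0) (\<lambda>_. 0) r) \<and>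
     (\<forall>s t. 0 \<le> s \<and> s < t \<and> G \<inter> {s<..t} = {} \<longrightarrow> \<Lambda> t = \<Lambda> s) \<and>
     (\<forall>s t. 0 \<le> s \<and> s < t \<and> G \<inter> {s<..t} \<subseteq> {t} \<longrightarrow> (\<forall>r\<ge>0. \<Lambda> t r = play_update (\<Lambda> t 0) (\<Lambda> s) r))"

lemma step_trajectory_refine:
  assumes "step_trajectory G \<Lambda>" "G \<subseteq> G'" "finite G'"
  shows "step_trajectory G' \<Lambda>"
proof -
  have const: "\<Lambda> t = \<Lambda> s" if "0 \<le> s \<and> s < t \<and> G' \<inter> {s<..t} = {}" for s t
  proof -
    have "G \<inter> {s<..t} = {}" using that assms(2) by blast
    then show ?thesis using that assms(1) unfolding step_trajectory_def by blast
  qed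
  have upd: "\<forall>r\<ge>0. \<Lambda> t r = play_update (\<Lambda> t 0) (\<Lambda> s) r" if "0 \<le> s \<and> s < t \<and> G' \<inter> {s<..t} \<subseteq> {t}" for s t
  proof -
    have "G \<inter> {s<..t} \<subseteq> {t}" using that assms(2) by blast
    then show ?thesis using that assms(1) unfolding step_trajectory_def by blast
  qed
  show ?thesis
    using assms(1,3) const upd unfolding step_trajectory_def by blast
qed

lemma step_trajectory_uminus:
  assumes "step_trajectory G \<Lambda>"
  shows "step_trajectory G (\<lambda>t r. - \<Lambda> t r)"
proof -
  have init: "\<forall>r\<ge>0. - \<Lambda> 0 r = play_update (- \<Lambda> 0 0) (\<lambda>_. 0) r"
  proof (intro allI impI)
    fix r :: real assume r: "0 \<le> r"
    have "\<Lambda> 0 r = play_update (\<Lambda> 0 0) (\<lambda>_. 0) r" using assms r unfolding step_trajectory_def by blast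
    then show "- \<Lambda> 0 r = play_update (- \<Lambda> 0 0) (\<lambda>_. 0) r"
      using play_update_uminus[OF r, of "\<Lambda> 0 0" "\<lambda>_. 0"] by simp
  qed
  have const: "(\<lambda>r. - \<Lambda> t r) = (\<lambda>r. - \<Lambda> s r)" if "0 \<le> s \<and> s < t \<and> G \<inter> {s<..t} = {}" for s t
  proof -
    have "\<Lambda> t = \<Lambda> s" using that assms unfolding step_trajectory_def by blast
    then show ?thesis by simp
  qed
  have upd: "\<forall>r\<ge>0. - \<Lambda> t r = play_update (- \<Lambda> t 0) (\<lambda>r. - \<Lambda> s r) r"
    if st: "0 \<le> s \<and> s < t \<and> G \<inter> {s<..t} \<subseteq> {t}" for s t
  proof (intro allI impI)
    fix r :: real assume r: "0 \<le> r"
    have "\<Lambda> t r = play_update (\<Lambda> t 0) (\<Lambda> s) r" using assms st r unfolding step_trajectory_def by blast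
    then show "- \<Lambda> t r = play_update (- \<Lambda> t 0) (\<lambda>r. - \<Lambda> s r) r"
      using play_update_uminus[OF r, of "\<Lambda> t 0" "\<Lambda> s"] by simp
  qed
  have mem: "\<forall>t\<ge>0. memory_state (\<lambda>r. - \<Lambda> t r)" and fin: "finite G"
    using assms memory_state_uminus unfolding step_trajectory_def by blast+
  have "\<exists>R. \<forall>t\<ge>0. \<forall>r\<ge>R. - \<Lambda> t r = 0"
    using assms unfolding step_trajectory_def neg_equal_0_iff_equal by blast
  with init const upd mem fin show ?thesis unfolding step_trajectory_def by blast
qed

lemma
  assumes "step_trajectory G \<Lambda>"
  shows step_trajectory_finite: "finite G"
    and step_trajectory_memory: "0 \<le> t \<Longrightarrow> memory_state (\<Lambda> t)"
    and step_trajectory_support: "\<exists>R. \<forall>t\<ge>0. \<forall>r\<ge>R. \<Lambda> t r = 0"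
    and step_trajectory_start: "0 \<le> r \<Longrightarrow> \<Lambda> 0 r = play_update (\<Lambda> 0 0) (\<lambda>_. 0) r"
    and step_trajectory_const: "0 \<le> s \<Longrightarrow> s < t \<Longrightarrow> G \<inter> {s<..t} = {} \<Longrightarrow> \<Lambda> t = \<Lambda> s"
    and step_trajectory_update:
      "0 \<le> s \<Longrightarrow> s < t \<Longrightarrow> G \<inter> {s<..t} \<subseteq> {t} \<Longrightarrow> 0 \<le> r \<Longrightarrow> \<Lambda> t r = play_update (\<Lambda> t 0) (\<Lambda> s) r"
  using assms unfolding step_trajectory_def by blast+

lemma grid_induct [consumes 3, case_names start step]:
  fixes G :: "real set"
  assumes "finite G" "a \<le> t" "t \<le> b" and start: "P a"
    and step: "\<And>s t. a \<le> s \<Longrightarrow> s < t \<Longrightarrow> t \<le> b \<Longrightarrow> G \<inter> {s<..t} \<subseteq> {t} \<Longrightarrow> P s \<Longrightarrow> P t"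
  shows "P t"
  using assms(2,3)
proof (induction "card (G \<inter> {a<..<t})" arbitrary: t rule: less_induct)
  case less
  show ?case
  proof (cases "G \<inter> {a<..<t} = {}")
    case True
    have "P t" if "a < t"
      using True that by (intro step[OF order_refl that less.prems(2) _ start]) auto
    then show ?thesis using start less.prems(1) by (cases "a = t") auto
  next
    case False
    let ?s = "Max (G \<inter> {a<..<t})"
    have fin: "finite (G \<inter> {a<..<t})" using \<open>finite G\<close> by simp
    have s: "?s \<in> G \<inter> {a<..<t}" using Max_in[OF fin False] .
    have "G \<inter> {a<..<?s} \<subset> G \<inter> {a<..<t}" using s by auto
    then have "card (G \<inter> {a<..<?s}) < card (G \<inter> {a<..<t})" using fin by (rule psubset_card_mono[rotated])
    then have "P ?s" using s less.prems by (intro less.hyps) auto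
    moreover have "G \<inter> {?s<..t} \<subseteq> {t}"
    proof
      fix x assume x: "x \<in> G \<inter> {?s<..t}"
      show "x \<in> {t}"
      proof (rule ccontr)
        assume "x \<notin> {t}"
        then have "x \<in> G \<inter> {a<..<t}" using x s by auto
        then have "x \<le> ?s" using fin by simp
        then show False using x by simp
      qed
    qed
    ultimately show ?thesis using s less.prems by (intro step[of ?s t]) auto
  qed
qed

text \<open>Take the last grid point in \<open>(a,t]\<close> at which the level \<open>r\<close> moved up: contact occurs there, and afterwards
  the level only moves down or stays.\<close>

lemma step_trajectory_increase:
  assumes traj: "step_trajectory G \<Lambda>" and r: "0 \<le> r" and a: "0 \<le> a" "a \<le> t" and less: "\<Lambda> a r < \<Lambda> t r"
  obtains \<tau> where "a < \<tau>" "\<tau> \<le> t" "\<Lambda> \<tau> 0 - \<Lambda> \<tau> r = r" "\<Lambda> \<tau> r \<ge> \<Lambda> t r"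
proof -
  have "finite G" by (rule step_trajectory_finite[OF traj])
  then have "\<Lambda> a r < \<Lambda> t r \<longrightarrow> (\<exists>\<tau>. a < \<tau> \<and> \<tau> \<le> t \<and> \<Lambda> \<tau> 0 - \<Lambda> \<tau> r = r \<and> \<Lambda> \<tau> r \<ge> \<Lambda> t r)"
    using a(2) order_refl
  proof (induction t rule: grid_induct)
    case (step s t)
    have upd: "\<Lambda> t r = play_update (\<Lambda> t 0) (\<Lambda> s) r"
      using step_trajectory_update[OF traj _ step(2,4) r] step(1) a(1) by simp
    show ?case
    proof (cases "\<Lambda> s r < \<Lambda> t r")
      case True
      then have "\<Lambda> t 0 - \<Lambda> t r = r" using upd unfolding play_update_def by linarith
      then show ?thesis using step(1,2) by (intro impI exI[of _ t]) auto
    next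
      case False
      show ?thesis
      proof
        assume "\<Lambda> a r < \<Lambda> t r"
        then obtain \<tau> where "a < \<tau>" "\<tau> \<le> s" "\<Lambda> \<tau> 0 - \<Lambda> \<tau> r = r" "\<Lambda> \<tau> r \<ge> \<Lambda> s r"
          using step(5) False by auto
        then show "\<exists>\<tau>. a < \<tau> \<and> \<tau> \<le> t \<and> \<Lambda> \<tau> 0 - \<Lambda> \<tau> r = r \<and> \<Lambda> \<tau> r \<ge> \<Lambda> t r"
          using step(2) False by (intro exI[of _ \<tau>]) auto
      qed
    qed
  qed simp
  then show ?thesis using less that by blast
qed

text \<open>Exact contact of the approximating trajectories becomes contact up to \<open>\<epsilon>\<close> in the limit.\<close>

lemma step_trajectory_limit_increase:
  assumes approx: "\<And>e. e > 0 \<Longrightarrow> \<exists>G \<Lambda>'. step_trajectory G \<Lambda>' \<and> (\<forall>t\<in>{0..T}. \<forall>r\<ge>0. \<bar>\<Lambda> t r - \<Lambda>' t r\<bar> \<le> e)"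
    and r: "0 \<le> r" and st: "0 \<le> s" "s < t" "t \<le> T" and \<epsilon>: "\<epsilon> > 0" and less: "\<Lambda> s r < \<Lambda> t r"
  shows "\<exists>\<tau>\<in>{s<..t}. \<Lambda> \<tau> 0 - \<Lambda> \<tau> r \<ge> r - \<epsilon> \<and> \<Lambda> \<tau> r \<ge> \<Lambda> t r - \<epsilon>"
proof -
  define e where "e = min (\<epsilon> / 2) ((\<Lambda> t r - \<Lambda> s r) / 3)"
  have e: "0 < e" "2 * e \<le> \<epsilon>" "3 * e \<le> \<Lambda> t r - \<Lambda> s r" using \<epsilon> less by (auto simp: e_def min_def)
  obtain G \<Lambda>' where a: "step_trajectory G \<Lambda>'" "\<forall>t\<in>{0..T}. \<forall>r\<ge>0. \<bar>\<Lambda> t r - \<Lambda>' t r\<bar> \<le> e"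
    using approx[OF e(1)] by blast
  have close: "\<bar>\<Lambda> \<tau> r' - \<Lambda>' \<tau> r'\<bar> \<le> e" if "0 \<le> \<tau>" "\<tau> \<le> T" "0 \<le> r'" for \<tau> r' using a(2) that by simp
  have s: "s \<le> t" "s \<le> T" "0 \<le> t" using st by auto
  have "\<Lambda>' s r < \<Lambda>' t r" using close[OF st(1) s(2) r] close[OF s(3) st(3) r] e by linarith
  from step_trajectory_increase[OF a(1) r st(1) s(1) this]
  obtain \<tau> where \<tau>: "s < \<tau>" "\<tau> \<le> t" "\<Lambda>' \<tau> 0 - \<Lambda>' \<tau> r = r" "\<Lambda>' \<tau> r \<ge> \<Lambda>' t r" .
  have \<tau>T: "0 \<le> \<tau>" "\<tau> \<le> T" using \<tau> st by auto
  have "\<Lambda> \<tau> 0 - \<Lambda> \<tau> r \<ge> r - \<epsilon>" "\<Lambda> \<tau> r \<ge> \<Lambda> t r - \<epsilon>"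
    using close[OF \<tau>T r] close[OF \<tau>T order_refl] close[OF s(3) st(3) r] \<tau> e by linarith+
  then show ?thesis using \<tau> by auto
qed

lemma finite_gap_right:
  fixes x :: real
  assumes "finite G"
  obtains d where "d > 0" "G \<inter> {x<..<x + d} = {}"
proof (cases "G \<inter> {x<..} = {}")
  case True
  then have "G \<inter> {x<..<x + 1} = {}" by auto
  then show ?thesis using that[of 1] by simp
next
  case False
  let ?m = "Min (G \<inter> {x<..})"
  have "?m \<in> G \<inter> {x<..}" "\<And>y. y \<in> G \<inter> {x<..} \<Longrightarrow> ?m \<le> y"
    using False assms by (auto intro: Min_in[THEN subsetD[OF subset_refl]] Min_le simp del: Int_iff)
  then show ?thesis using that[of "?m - x"] by force
qed

lemma finite_gap_left:
  fixes x :: real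
  assumes "finite G"
  obtains d where "d > 0" "G \<inter> {x - d<..<x} = {}"
proof -
  obtain d where d: "d > 0" "uminus ` G \<inter> {- x<..<- x + d} = {}"
    using finite_gap_right[of "uminus ` G" "- x"] assms by auto
  have "G \<inter> {x - d<..<x} = {}"
  proof (rule equals0I)
    fix y assume "y \<in> G \<inter> {x - d<..<x}"
    then have "- y \<in> uminus ` G \<inter> {- x<..<- x + d}" by auto
    then show False using d(2) by blast
  qed
  then show ?thesis using that d(1) by blast
qed

lemma step_trajectory_regulated:
  assumes traj: "step_trajectory G \<Lambda>"
  shows "(\<lambda>t. \<Lambda> t r) \<in> regulated_right T"
proof -
  have fin: "finite G" by (rule step_trajectory_finite[OF traj])
  have const: "\<Lambda> t = \<Lambda> s" if "0 \<le> s" "s \<le> t" "G \<inter> {s<..t} = {}" for s t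
    using step_trajectory_const[OF traj, of s t] that by (cases "s = t") auto
  have right: "((\<lambda>t. \<Lambda> t r) \<longlongrightarrow> \<Lambda> x r) (at_right x)" if x: "0 \<le> x" for x
  proof (rule tendsto_eventually)
    obtain d where d: "d > 0" "G \<inter> {x<..<x + d} = {}" using finite_gap_right[OF fin] .
    have "\<Lambda> y r = \<Lambda> x r" if "x < y" "y < x + d" for y
    proof -
      have "G \<inter> {x<..y} = {}" using d(2) that by auto
      then show ?thesis using const[of x y] x that by simp
    qed
    then show "\<forall>\<^sub>F y in at_right x. \<Lambda> y r = \<Lambda> x r"
      unfolding eventually_at_right_field using d(1) by (intro exI[of _ "x + d"]) auto
  qed
  have left: "\<exists>l. ((\<lambda>t. \<Lambda> t r) \<longlongrightarrow> l) (at_left x)" if x: "0 < x" for x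
  proof -
    obtain d where d: "d > 0" "G \<inter> {x - d<..<x} = {}" using finite_gap_left[OF fin] .
    define a where "a = max 0 (x - d / 2)"
    have a: "0 \<le> a" "a < x" "x - d < a" using x d(1) by (auto simp: a_def)
    have "\<Lambda> y r = \<Lambda> a r" if "a < y" "y < x" for y
    proof -
      have "G \<inter> {a<..y} = {}" using d(2) that a by auto
      then show ?thesis using const[of a y] a that by simp
    qed
    then have "\<forall>\<^sub>F y in at_left x. \<Lambda> y r = \<Lambda> a r"
      unfolding eventually_at_left_field using a(2) by (intro exI[of _ a]) auto
    from tendsto_eventually[OF this] show ?thesis by (rule exI)
  qed
  have "\<forall>x\<in>{0..<T}. ((\<lambda>t. \<Lambda> t r) \<longlongrightarrow> \<Lambda> x r) (at_right x)"
    "\<forall>x\<in>{0<..T}. \<exists>l. ((\<lambda>t. \<Lambda> t r) \<longlongrightarrow> l) (at_left x)"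
    using right left by simp_all
  then show ?thesis unfolding regulated_right_def regulated_def mem_Collect_eq by blast
qed

section \<open>A backward Gronwall inequality\<close>

lemma set_integrable_if_integrable:
  fixes f :: "real \<Rightarrow> real"
  shows "integrable M f \<Longrightarrow> A \<in> sets M \<Longrightarrow> set_integrable M A f"
  unfolding set_integrable_def by (rule integrable_mult_indicator)

lemma tail_integral_split:
  fixes f :: "real \<Rightarrow> real"
  assumes f: "integrable lebesgue f" and rs: "r \<le> s"
  shows "(LINT x:{r..}|lebesgue. f x) = (LINT x:{r..<s}|lebesgue. f x) + (LINT x:{s..}|lebesgue. f x)"
proof -
  have int: "set_integrable lebesgue A f" if "A \<in> sets lebesgue" for A
    by (rule set_integrable_if_integrable[OF f that])
  have "{r..} = {r..<s} \<union> {s..}" using rs by auto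
  then show ?thesis by (simp add: set_integral_Un int ivl_disj_int)
qed

lemma tail_integral_continuous:
  fixes f :: "real \<Rightarrow> real"
  assumes f: "integrable lebesgue f"
  shows "continuous_on {0..R} (\<lambda>r. LINT x:{r..}|lebesgue. f x)"
proof -
  have int: "set_integrable lebesgue A f" if "A \<in> sets lebesgue" for A
    by (rule set_integrable_if_integrable[OF f that])
  have eq: "(LINT x:{r..}|lebesgue. f x) = (LINT x:{0..}|lebesgue. f x) - integral {0..r} f" if "r \<in> {0..R}" for r
  proof -
    have "(LINT x:{0..<r}|lebesgue. f x) = integral {0..<r} f"
      by (rule set_lebesgue_integral_eq_integral(2)[OF int]) auto
    also have "\<dots> = integral {0..r} f"
    proof (rule integral_spike_set)
      show "negligible {x \<in> {0..<r} - {0..r}. f x \<noteq> 0}" by (rule negligible_subset[of "{}"]) auto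
      show "negligible {x \<in> {0..r} - {0..<r}. f x \<noteq> 0}" by (rule negligible_subset[of "{r}"]) auto
    qed
    finally show ?thesis using tail_integral_split[OF f, of 0 r] that by simp
  qed
  have "f integrable_on {0..R}" by (rule set_lebesgue_integral_eq_integral(1)[OF int]) auto
  then have "continuous_on {0..R} (\<lambda>r. (LINT x:{0..}|lebesgue. f x) - integral {0..r} f)"
    by (intro continuous_on_diff continuous_on_const indefinite_integral_continuous_1)
  then show ?thesis by (rule continuous_on_eq) (rule eq[symmetric])
qed

text \<open>The weight \<open>\<nu>\<close> is merely integrable, so the tail integrals cannot be differentiated at every point.
  Instead the radii are cut into \<open>n\<close> stretches of equal weight and \<open>(1 - m/n)\<^sup>n\<close> tends to \<open>e\<^sup>-\<^sup>m\<close>.\<close>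

lemma backward_Gronwall:
  fixes \<nu> S :: "real \<Rightarrow> real"
  assumes \<nu>: "integrable lebesgue \<nu>" "AE x in lebesgue. 0 \<le> \<nu> x"
    and \<nu>S: "integrable lebesgue (\<lambda>x. \<nu> x * S x)"
    and S: "\<And>r. 0 \<le> r \<Longrightarrow> 0 \<le> S r" "\<And>r. R \<le> r \<Longrightarrow> S r = 0" and R: "0 \<le> R" and F: "0 \<le> F"
    and bound: "\<And>r. 0 \<le> r \<Longrightarrow> S r \<le> F + (LINT x:{r..}|lebesgue. \<nu> x * S x)"
  shows "F + (LINT x:{0..}|lebesgue. \<nu> x * S x) \<le> F * exp (LINT x:{0..}|lebesgue. \<nu> x)"
proof -
  define h where "h r = F + (LINT x:{r..}|lebesgue. \<nu> x * S x)" for r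
  define m where "m r = (LINT x:{r..}|lebesgue. \<nu> x) - (LINT x:{R..}|lebesgue. \<nu> x)" for r
  have int: "set_integrable lebesgue A f" if "integrable lebesgue f" "A \<in> sets lebesgue" for A and f :: "real \<Rightarrow> real"
    by (rule set_integrable_if_integrable[OF that])
  have nonneg: "0 \<le> (LINT x:A|lebesgue. f x)" if "AE x in lebesgue. x \<in> A \<longrightarrow> 0 \<le> f x" for A and f :: "real \<Rightarrow> real"
    unfolding set_lebesgue_integral_def
    by (rule integral_nonneg_AE) (use that in eventually_elim, auto simp: indicator_def)
  have \<nu>S_nonneg: "AE x in lebesgue. 0 \<le> x \<longrightarrow> 0 \<le> \<nu> x * S x"
    using \<nu>(2) by eventually_elim (use S(1) in auto)
  have h_split: "h r = (LINT x:{r..<s}|lebesgue. \<nu> x * S x) + h s" if "r \<le> s" for r s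
    using tail_integral_split[OF \<nu>S that] by (simp add: h_def)
  have m_split: "m r = (LINT x:{r..<s}|lebesgue. \<nu> x) + m s" if "r \<le> s" for r s
    using tail_integral_split[OF \<nu>(1) that] by (simp add: m_def)
  have h_anti: "h s \<le> h r" if "0 \<le> r" "r \<le> s" for r s
  proof -
    have "0 \<le> (LINT x:{r..<s}|lebesgue. \<nu> x * S x)"
      by (rule nonneg) (use \<nu>S_nonneg in eventually_elim, use that in auto)
    then show ?thesis using h_split[OF that(2)] by simp
  qed
  have h_nonneg: "0 \<le> h r" if "0 \<le> r" for r
    using bound[OF that] S(1)[OF that] by (simp add: h_def)
  have hR: "h R = F"
  proof -
    have "(LINT x:{R..}|lebesgue. \<nu> x * S x) = (LINT x:{R..}|lebesgue. 0)"
      using S(2) by (intro set_lebesgue_integral_cong) auto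
    then show ?thesis by (simp add: h_def)
  qed
  have loc: "h r - h s \<le> h r * (m r - m s)" if rs: "0 \<le> r" "r \<le> s" for r s
  proof -
    have "(LINT x:{r..<s}|lebesgue. \<nu> x * S x) \<le> (LINT x:{r..<s}|lebesgue. h r * \<nu> x)"
    proof (rule set_integral_mono_AE)
      show "AE x\<in>{r..<s} in lebesgue. \<nu> x * S x \<le> h r * \<nu> x"
        using \<nu>(2)
      proof eventually_elim
        case (elim x)
        show ?case
        proof
          assume x: "x \<in> {r..<s}"
          then have "S x \<le> h r" using bound[of x] h_anti[of r x] rs by (simp add: h_def)
          from mult_left_mono[OF this elim] show "\<nu> x * S x \<le> h r * \<nu> x" by (simp add: mult.commute)
        qed
      qed
    qed (auto intro!: int \<nu>S integrable_mult_right \<nu>(1))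
    then show ?thesis using h_split[OF rs(2)] m_split[OF rs(2)] by simp
  qed
  have m_cont: "continuous_on {0..R} m"
    unfolding m_def by (intro continuous_intros tail_integral_continuous \<nu>(1))
  have mR: "m R = 0" by (simp add: m_def)
  have \<nu>_nonneg: "0 \<le> (LINT x:A|lebesgue. \<nu> x)" for A
    by (rule nonneg) (use \<nu>(2) in eventually_elim, auto)
  have m0: "0 \<le> m 0" "m 0 \<le> (LINT x:{0..}|lebesgue. \<nu> x)"
    using m_split[OF R] mR \<nu>_nonneg[of "{0..<R}"] \<nu>_nonneg[of "{R..}"] by (simp_all add: m_def)
  \<comment> \<open>Euler steps: over a stretch of weight \<open>\<delta>\<close> the function grows at most by the factor \<open>1 / (1 - \<delta>)\<close>.\<close>
  have steps: "h r * (1 - \<delta>) ^ i \<le> F" if \<delta>: "0 \<le> \<delta>" "\<delta> < 1" and "r \<in> {0..R}" "m r \<le> real i * \<delta>" for \<delta> i r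
    using that(3,4)
  proof (induction i arbitrary: r)
    case 0
    then have "h r * (m r - m R) \<le> 0" using h_nonneg[of r] mR by (simp add: mult_nonneg_nonpos)
    then show ?case using loc[of r R] 0 hR by simp
  next
    case (Suc i)
    have hr: "0 \<le> h r" using h_nonneg Suc.prems by simp
    show ?case
    proof (cases "m r \<le> real i * \<delta>")
      case True
      have "h r * (1 - \<delta>) ^ i * (1 - \<delta>) \<le> h r * (1 - \<delta>) ^ i * 1"
        using hr \<delta> by (intro mult_left_mono mult_nonneg_nonneg) auto
      then show ?thesis using Suc.IH[OF Suc.prems(1) True] by (simp add: ac_simps)
    next
      case False
      have "\<exists>s\<ge>r. s \<le> R \<and> m s = real i * \<delta>"
      proof (rule IVT2')
        show "continuous_on {r..R} m" by (rule continuous_on_subset[OF m_cont]) (use Suc.prems in auto)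
      qed (use False mR \<delta> Suc.prems in auto)
      then obtain s where s: "r \<le> s" "s \<le> R" "m s = real i * \<delta>" by blast
      have "m r - m s \<le> \<delta>" using s(3) Suc.prems(2) by (simp add: distrib_right)
      then have "h r * (m r - m s) \<le> h r * \<delta>" using hr by (rule mult_left_mono)
      then have "h r * (1 - \<delta>) \<le> h s" using loc[of r s] s Suc.prems by (simp add: right_diff_distrib)
      then have "h r * (1 - \<delta>) * (1 - \<delta>) ^ i \<le> h s * (1 - \<delta>) ^ i"
        using \<delta> by (intro mult_right_mono) auto
      also have "\<dots> \<le> F" using Suc.IH[of s] s Suc.prems by auto
      finally show ?thesis by (simp add: mult.assoc)
    qed
  qed
  have lim: "(\<lambda>n. h 0 * (1 + (- m 0) / real n) ^ n) \<longlonglongrightarrow> h 0 * exp (- m 0)"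
    by (intro tendsto_intros tendsto_exp_limit_sequentially)
  have "h 0 * exp (- m 0) \<le> F"
  proof (rule tendsto_upperbound[OF lim])
    show "\<forall>\<^sub>F n in sequentially. h 0 * (1 + (- m 0) / real n) ^ n \<le> F"
      using eventually_gt_at_top[of "nat \<lceil>m 0\<rceil>"]
    proof eventually_elim
      case (elim n)
      then have n: "real n > m 0" "n > 0" by linarith+
      then show ?case using steps[of "m 0 / real n" 0 n] m0 R by auto
    qed
  qed simp
  then have "h 0 \<le> F * exp (m 0)" by (simp add: exp_minus field_simps)
  also have "\<dots> \<le> F * exp (LINT x:{0..}|lebesgue. \<nu> x)" using m0(2) F by (intro mult_left_mono) auto
  finally show ?thesis by (simp add: h_def)
qed

section \<open>Comparison of two trajectories\<close>

context
  fixes \<psi> :: "real ^ 'n \<Rightarrow> real \<Rightarrow> real \<Rightarrow> real" and \<mu> :: "real \<Rightarrow> real" and K :: "real \<Rightarrow> real \<Rightarrow> real"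
  assumes density: "preisach_density \<psi> \<mu> K"
begin

lemma preisach_functional_mono:
  assumes "memory_state \<phi>" "memory_state \<phi>'" "\<And>r. 0 \<le> r \<Longrightarrow> \<phi>' r \<le> \<phi> r"
  shows "preisach_functional \<psi> u \<phi>' \<le> preisach_functional \<psi> u \<phi>"
proof -
  have "(LINT r:{0<..}|lebesgue. \<mu> r * max 0 (\<phi>' r - \<phi> r)) = (LINT r:{(0::real)<..}|lebesgue. 0)"
    using assms(3) by (intro set_lebesgue_integral_cong) auto
  then show ?thesis using preisach_functional_diff_le[OF density assms(1,2), of u] by simp
qed

lemma preisach_functional_Lipschitz:
  assumes "memory_state \<phi>" "memory_state \<phi>'" and e: "\<And>r. 0 \<le> r \<Longrightarrow> \<bar>\<phi> r - \<phi>' r\<bar> \<le> e"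
  shows "\<bar>preisach_functional \<psi> u \<phi> - preisach_functional \<psi> u \<phi>'\<bar> \<le> (LINT r:{0<..}|lebesgue. \<mu> r) * e"
proof -
  have e0: "0 \<le> e" using e[of 0] by simp
  have "preisach_functional \<psi> u \<phi>' - preisach_functional \<psi> u \<phi> \<le> (LINT r:{0<..}|lebesgue. \<mu> r) * e"
    if m: "memory_state \<phi>" "memory_state \<phi>'" and le: "\<And>r. 0 \<le> r \<Longrightarrow> \<bar>\<phi> r - \<phi>' r\<bar> \<le> e" for \<phi> \<phi>'
  proof -
    have max_le: "0 \<le> max 0 (\<phi>' r - \<phi> r) \<and> max 0 (\<phi>' r - \<phi> r) \<le> e" if "0 \<le> r" for r
      using le[OF that] e0 by auto
    have "(LINT r:{0<..}|lebesgue. \<mu> r * max 0 (\<phi>' r - \<phi> r)) \<le> (LINT r:{0<..}|lebesgue. \<mu> r * e)"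
    proof (rule set_integral_mono_AE)
      show "set_integrable lebesgue {0<..} (\<lambda>r. \<mu> r * max 0 (\<phi>' r - \<phi> r))"
      proof (rule weight_mult_integrable[OF density])
        show "continuous_on {0..} (\<lambda>r. max 0 (\<phi>' r - \<phi> r))"
          by (intro continuous_intros memory_state_continuous m)
        show "\<bar>max 0 (\<phi>' r - \<phi> r)\<bar> \<le> e" if "0 \<le> r" for r using max_le[OF that] by simp
      qed
      show "set_integrable lebesgue {0<..} (\<lambda>r. \<mu> r * e)"
        by (rule weight_mult_integrable[OF density, where C=e]) (use e0 in auto)
      show "AE r\<in>{0<..} in lebesgue. \<mu> r * max 0 (\<phi>' r - \<phi> r) \<le> \<mu> r * e"
        using weight_nonneg[OF density]
      proof eventually_elim
        case (elim r)
        show ?case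
        proof
          assume "r \<in> {0<..}"
          then have "0 \<le> \<mu> r" "0 \<le> r" using elim by auto
          from mult_left_mono[OF conjunct2[OF max_le[OF this(2)]] this(1)]
          show "\<mu> r * max 0 (\<phi>' r - \<phi> r) \<le> \<mu> r * e" .
        qed
      qed
    qed
    then show ?thesis using preisach_functional_diff_le[OF density m, of u] by simp
  qed
  note one = this
  have e': "\<bar>\<phi>' r - \<phi> r\<bar> \<le> e" if "0 \<le> r" for r using e[OF that] by (simp add: abs_minus_commute)
  from one[OF assms(1,2) e] one[OF assms(2,1) e'] show ?thesis by linarith
qed

text \<open>The left-hand side is continuous, and it grows at least as fast as \<open>x\<close> because the functional is
  monotone in the state.\<close>

lemma single_update_solvable:
  assumes \<phi>: "memory_state \<phi>"
  obtains x where "x + preisach_functional \<psi> u (play_update x \<phi>) = y"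
proof -
  let ?g = "\<lambda>x. x + preisach_functional \<psi> u (play_update x \<phi>)"
  let ?M = "LINT r:{0<..}|lebesgue. \<mu> r"
  note mem = memory_state_play_update[OF \<phi>]
  define c where "c = preisach_functional \<psi> u (play_update 0 \<phi>)"
  have cont: "continuous_on UNIV (\<lambda>x. preisach_functional \<psi> u (play_update x \<phi>))"
  proof (rule continuous_onI)
    fix x e :: real assume e: "e > 0"
    have "dist (preisach_functional \<psi> u (play_update y \<phi>)) (preisach_functional \<psi> u (play_update x \<phi>)) \<le> e"
      if "dist y x < e / (\<bar>?M\<bar> + 1)" for y
    proof -
      have "\<bar>preisach_functional \<psi> u (play_update y \<phi>) - preisach_functional \<psi> u (play_update x \<phi>)\<bar> \<le> ?M * \<bar>y - x\<bar>"
        by (rule preisach_functional_Lipschitz[OF mem mem]) (use play_update_Lipschitz[of y \<phi> _ x \<phi>] in auto)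
      also have "\<dots> \<le> (\<bar>?M\<bar> + 1) * \<bar>y - x\<bar>" by (intro mult_right_mono) auto
      also have "\<dots> \<le> e" using that by (simp add: dist_real_def pos_less_divide_eq mult.commute add_nonneg_pos)
      finally show ?thesis by (simp add: dist_real_def)
    qed
    moreover have "e / (\<bar>?M\<bar> + 1) > 0" using e by (simp add: add_nonneg_pos)
    ultimately show "\<exists>d>0. \<forall>y\<in>UNIV. dist y x < d \<longrightarrow>
        dist (preisach_functional \<psi> u (play_update y \<phi>)) (preisach_functional \<psi> u (play_update x \<phi>)) \<le> e" by blast
  qed
  have upper: "?g x \<ge> x + c" if "0 \<le> x" for x
    unfolding c_def using preisach_functional_mono[OF mem mem play_update_mono[OF that]] by simp
  have lower: "?g x \<le> x + c" if "x \<le> 0" for x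
    unfolding c_def using preisach_functional_mono[OF mem mem play_update_mono[OF that]] by simp
  have "\<exists>x\<ge>- \<bar>y - c\<bar>. x \<le> \<bar>y - c\<bar> \<and> ?g x = y"
  proof (rule IVT')
    show "?g (- \<bar>y - c\<bar>) \<le> y" using lower[of "- \<bar>y - c\<bar>"] by auto
    show "y \<le> ?g \<bar>y - c\<bar>" using upper[of "\<bar>y - c\<bar>"] by auto
    show "continuous_on {- \<bar>y - c\<bar>..\<bar>y - c\<bar>} ?g"
      by (intro continuous_intros continuous_on_subset[OF cont]) auto
  qed auto
  then show ?thesis using that by blast
qed

text \<open>The heart of the stability estimate.  If the difference at radius \<open>r\<close> exceeds the bound \<open>B\<close> after the
  update but not before, it has grown, so one of the two plays is pushed at radius \<open>r\<close>.  Then all smaller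
  radii have at least the same difference, and the equation for the inputs contradicts the excess.\<close>

lemma update_difference_bound:
  assumes mem: "memory_state N" "memory_state N'"
    and N: "N r = play_update (N 0) \<phi> r" and N': "N' r = play_update (N' 0) \<phi>' r" and r: "0 \<le> r"
    and S: "continuous_on {0..} S" "\<And>s. 0 \<le> s \<Longrightarrow> \<bar>N s - N' s\<bar> \<le> S s" "\<And>s. 0 \<le> s \<Longrightarrow> S s \<le> C"
    and B: "B = F + (LINT s:{r..}|lebesgue. (indicator {0<..} s * \<mu> s) * S s)"
    and eq: "(N 0 + preisach_functional \<psi> u N) - (N' 0 + preisach_functional \<psi> u N') \<le> F"
    and old: "\<phi> r - \<phi>' r \<le> B" and B0: "0 \<le> B"
  shows "N r - N' r \<le> B"
proof (rule ccontr)
  assume neg: "\<not> N r - N' r \<le> B"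
  \<comment> \<open>The difference grew at level \<open>r\<close>, so one of the two plays was pushed there.\<close>
  then have "N r = N 0 - r \<or> N' r = N' 0 + r"
    using N N' old unfolding play_update_def by linarith
  then have inner: "N s - N' s \<ge> N r - N' r" if "0 \<le> s" "s \<le> r" for s
    using memory_state_Lipschitz[OF mem(1) r that(1)] memory_state_Lipschitz[OF mem(2) r that(1)]
      memory_state_Lipschitz[OF mem(1) order_refl that(1)] memory_state_Lipschitz[OF mem(2) order_refl that(1)] that
    by linarith
  have S0: "0 \<le> S s" if "0 \<le> s" for s using S(2)[OF that] by linarith
  have "(LINT s:{0<..}|lebesgue. \<mu> s * max 0 (N' s - N s)) \<le>
     (LINT s:{r..}|lebesgue. (indicator {0<..} s * \<mu> s) * S s)"
    unfolding set_lebesgue_integral_def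
  proof (rule integral_mono_AE')
    have Sint: "integrable lebesgue (\<lambda>s. indicator {0<..} s *\<^sub>R (\<mu> s * S s))"
      using weight_mult_integrable[OF density S(1), of C] S(3) S0 by (simp add: set_integrable_def)
    have "integrable lebesgue (\<lambda>s. indicator {r..} s *\<^sub>R (indicator {0<..} s *\<^sub>R (\<mu> s * S s)))"
      by (rule integrable_mult_indicator[OF _ Sint]) auto
    then show "integrable lebesgue (\<lambda>s. indicator {r..} s *\<^sub>R (indicator {0<..} s * \<mu> s * S s))"
      by (simp add: mult.assoc)
    show "AE s in lebesgue. indicator {0<..} s *\<^sub>R (\<mu> s * max 0 (N' s - N s)) \<le> indicator {r..} s *\<^sub>R (indicator {0<..} s * \<mu> s * S s)"
      using weight_nonneg[OF density]
    proof eventually_elim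
      case (elim s)
      show ?case
      proof (cases "s > 0")
        case True
        show ?thesis
        proof (cases "r \<le> s")
          case True': True
          have "max 0 (N' s - N s) \<le> S s" using S(2)[of s] S0[of s] True by auto
          then show ?thesis using True True' elim by (simp add: mult_left_mono)
        next
          case False
          then have "N' s - N s \<le> 0" using inner[of s] True neg B0 by auto
          then show ?thesis using False by (simp add: max_absorb1)
        qed
      qed simp
    qed
    show "AE s in lebesgue. 0 \<le> indicator {r..} s *\<^sub>R (indicator {0<..} s * \<mu> s * S s)"
      using weight_nonneg[OF density] by eventually_elim (use S0 in \<open>auto simp: indicator_def\<close>)
  qed
  then have "preisach_functional \<psi> u N' - preisach_functional \<psi> u N \<le> B - F"
    using preisach_functional_diff_le[OF density mem, of u] B by simp
  then have "N 0 - N' 0 \<le> B" using eq by simp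
  then show False using inner[of 0] r neg by simp
qed

lemma step_trajectory_difference_bound:
  assumes traj: "step_trajectory G \<Lambda>" "step_trajectory G \<Lambda>'" and r: "0 \<le> r" and t: "0 \<le> t" "t \<le> b"
    and S: "continuous_on {0..} S" "\<And>\<tau> s. 0 \<le> \<tau> \<Longrightarrow> \<tau> \<le> b \<Longrightarrow> 0 \<le> s \<Longrightarrow> \<bar>\<Lambda> \<tau> s - \<Lambda>' \<tau> s\<bar> \<le> S s"
      "\<And>s. 0 \<le> s \<Longrightarrow> S s \<le> C"
    and eq: "\<And>\<tau>. 0 \<le> \<tau> \<Longrightarrow> \<tau> \<le> b \<Longrightarrow>
      (\<Lambda> \<tau> 0 + preisach_functional \<psi> (u \<tau>) (\<Lambda> \<tau>)) - (\<Lambda>' \<tau> 0 + preisach_functional \<psi> (u \<tau>) (\<Lambda>' \<tau>)) \<le> F"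
    and F: "0 \<le> F"
  shows "\<Lambda> t r - \<Lambda>' t r \<le> F + (LINT s:{r..}|lebesgue. (indicator {0<..} s * \<mu> s) * S s)"
proof -
  define B where "B = F + (LINT s:{r..}|lebesgue. (indicator {0<..} s * \<mu> s) * S s)"
  have fin: "finite G" by (rule step_trajectory_finite[OF traj(1)])
  have mem: "memory_state (\<Lambda> \<tau>)" "memory_state (\<Lambda>' \<tau>)" if "0 \<le> \<tau>" for \<tau>
    using step_trajectory_memory traj that by auto
  have S0: "0 \<le> S s" if "0 \<le> s" for s using S(2)[of 0 s] t that by force
  have "0 \<le> (LINT s:{r..}|lebesgue. (indicator {0<..} s * \<mu> s) * S s)"
    unfolding set_lebesgue_integral_def
    by (rule integral_nonneg_AE) (use weight_nonneg[OF density] in eventually_elim, use S0 in \<open>auto simp: indicator_def\<close>)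
  then have B0: "0 \<le> B" using F by (simp add: B_def)
  have "\<Lambda> t r - \<Lambda>' t r \<le> B"
    using fin t
  proof (induction t rule: grid_induct)
    case start
    have b: "0 \<le> b" using t by simp
    show ?case
    proof (rule update_difference_bound[where \<phi>="\<lambda>_. 0" and \<phi>'="\<lambda>_. 0", OF mem _ _ r S(1) _ S(3) B_def eq _ B0])
      show "\<Lambda> 0 r = play_update (\<Lambda> 0 0) (\<lambda>_. 0) r" "\<Lambda>' 0 r = play_update (\<Lambda>' 0 0) (\<lambda>_. 0) r"
        by (rule step_trajectory_start[OF _ r]; rule traj)+
    qed (use b B0 S(2) in auto)
  next
    case (step s t)
    show ?case
    proof (rule update_difference_bound[where \<phi>="\<Lambda> s" and \<phi>'="\<Lambda>' s", OF mem _ _ r S(1) _ S(3) B_def eq step(5) B0])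
      show "\<Lambda> t r = play_update (\<Lambda> t 0) (\<Lambda> s) r" "\<Lambda>' t r = play_update (\<Lambda>' t 0) (\<Lambda>' s) r"
        by (rule step_trajectory_update[OF _ step(1,2,4) r]; rule traj)+
    qed (use step S(2) in auto)
  qed
  then show ?thesis by (simp add: B_def)
qed

text \<open>The supremum over time is taken radius by radius.  It is again Lipschitz, so that it may be integrated,
  and it satisfies the hypothesis of the backward Gronwall inequality.\<close>

lemma step_trajectory_stability:
  assumes traj: "step_trajectory G \<Lambda>" "step_trajectory G' \<Lambda>'" and b: "0 \<le> b"
    and eq: "\<And>\<tau>. 0 \<le> \<tau> \<Longrightarrow> \<tau> \<le> b \<Longrightarrow>
      \<bar>(\<Lambda> \<tau> 0 + preisach_functional \<psi> (u \<tau>) (\<Lambda> \<tau>)) - (\<Lambda>' \<tau> 0 + preisach_functional \<psi> (u \<tau>) (\<Lambda>' \<tau>))\<bar> \<le> F"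
    and t: "0 \<le> t" "t \<le> b" and r: "0 \<le> r"
  shows "\<bar>\<Lambda> t r - \<Lambda>' t r\<bar> \<le> exp (LINT r:{0<..}|lebesgue. \<mu> r) * F"
proof -
  have fin: "finite (G \<union> G')" using step_trajectory_finite traj by blast
  have traj1: "step_trajectory (G \<union> G') \<Lambda>" by (rule step_trajectory_refine[OF traj(1) _ fin]) auto
  have traj2: "step_trajectory (G \<union> G') \<Lambda>'" by (rule step_trajectory_refine[OF traj(2) _ fin]) auto
  have F: "0 \<le> F" using eq[of 0] b by force
  obtain R1 where R1: "\<forall>t\<ge>0. \<forall>r\<ge>R1. \<Lambda> t r = 0" using step_trajectory_support[OF traj(1)] ..
  obtain R2 where R2: "\<forall>t\<ge>0. \<forall>r\<ge>R2. \<Lambda>' t r = 0" using step_trajectory_support[OF traj(2)] ..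
  define R where "R = max 0 (max R1 R2)"
  have R: "0 \<le> R" "\<And>t r. 0 \<le> t \<Longrightarrow> R \<le> r \<Longrightarrow> \<Lambda> t r = 0" "\<And>t r. 0 \<le> t \<Longrightarrow> R \<le> r \<Longrightarrow> \<Lambda>' t r = 0"
    using R1 R2 by (auto simp: R_def)
  have mem: "memory_state (\<Lambda> \<tau>)" "memory_state (\<Lambda>' \<tau>)" if "0 \<le> \<tau>" for \<tau>
    using step_trajectory_memory traj that by auto
  define e where "e \<tau> s = \<bar>\<Lambda> \<tau> s - \<Lambda>' \<tau> s\<bar>" for \<tau> s
  have e_Lip: "e \<tau> s \<le> e \<tau> s' + 2 * \<bar>s - s'\<bar>" if "0 \<le> \<tau>" "0 \<le> s" "0 \<le> s'" for \<tau> s s'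
    using memory_state_Lipschitz[OF mem(1)[OF that(1)] that(2,3)] memory_state_Lipschitz[OF mem(2)[OF that(1)] that(2,3)]
    unfolding e_def by (smt (verit))
  have e_bound: "e \<tau> s \<le> 2 * R" if "0 \<le> \<tau>" "0 \<le> s" for \<tau> s
  proof (cases "s \<le> R")
    case True
    then show ?thesis using e_Lip[OF that R(1)] R that by (simp add: e_def)
  next
    case False
    then show ?thesis using R that by (simp add: e_def)
  qed
  define S where "S s = (SUP \<tau>\<in>{0..b}. e \<tau> s)" for s
  have bdd: "bdd_above ((\<lambda>\<tau>. e \<tau> s) ` {0..b})" if "0 \<le> s" for s
    using e_bound that by (intro bdd_aboveI[of _ "2 * R"]) auto
  have S_upper: "e \<tau> s \<le> S s" if "0 \<le> \<tau>" "\<tau> \<le> b" "0 \<le> s" for \<tau> s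
    unfolding S_def by (rule cSUP_upper[OF _ bdd]) (use that in auto)
  have S_least: "S s \<le> c" if "\<And>\<tau>. 0 \<le> \<tau> \<Longrightarrow> \<tau> \<le> b \<Longrightarrow> e \<tau> s \<le> c" for s c
    unfolding S_def by (rule cSUP_least) (use that b in auto)
  have S0: "0 \<le> S s" if "0 \<le> s" for s using S_upper[of 0 s] b that by (simp add: e_def order_trans[OF abs_ge_zero])
  have S_Lip: "S s \<le> S s' + 2 * \<bar>s - s'\<bar>" if "0 \<le> s" "0 \<le> s'" for s s'
  proof (rule S_least)
    fix \<tau> :: real assume "0 \<le> \<tau>" "\<tau> \<le> b"
    from e_Lip[OF this(1) that] S_upper[OF this that(2)] show "e \<tau> s \<le> S s' + 2 * \<bar>s - s'\<bar>" by linarith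
  qed
  have S_cont: "continuous_on {0..} S"
  proof (rule Lipschitz_continuous_on_nonneg[where C=2])
    fix s s' :: real assume "0 \<le> s" "0 \<le> s'"
    from S_Lip[OF this] S_Lip[OF this(2,1)] show "\<bar>S s - S s'\<bar> \<le> 2 * \<bar>s - s'\<bar>"
      by (simp add: abs_le_iff abs_minus_commute)
  qed
  have S_le: "S s \<le> 2 * R" if "0 \<le> s" for s by (rule S_least) (use e_bound that in auto)
  have S_R: "S s = 0" if "R \<le> s" for s
  proof (rule antisym)
    show "S s \<le> 0" by (rule S_least) (use R that in \<open>auto simp: e_def\<close>)
  qed (use S0 R that in auto)
  let ?\<nu> = "\<lambda>s. indicator {0<..} s * \<mu> s"
  have one: "\<Lambda> \<tau> s - \<Lambda>' \<tau> s \<le> F + (LINT x:{s..}|lebesgue. ?\<nu> x * S x)" if "0 \<le> \<tau>" "\<tau> \<le> b" "0 \<le> s" for \<tau> s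
    using eq S_upper by (intro step_trajectory_difference_bound[OF traj1 traj2 that(3,1,2) S_cont _ S_le _ F, where u=u])
       (auto simp: e_def abs_le_iff)
  have two: "\<Lambda>' \<tau> s - \<Lambda> \<tau> s \<le> F + (LINT x:{s..}|lebesgue. ?\<nu> x * S x)" if "0 \<le> \<tau>" "\<tau> \<le> b" "0 \<le> s" for \<tau> s
    using eq S_upper by (intro step_trajectory_difference_bound[OF traj2 traj1 that(3,1,2) S_cont _ S_le _ F, where u=u])
       (auto simp: e_def abs_le_iff abs_minus_commute)
  have bound: "S s \<le> F + (LINT x:{s..}|lebesgue. ?\<nu> x * S x)" if "0 \<le> s" for s
    by (rule S_least) (use one two that in \<open>simp add: e_def abs_le_iff\<close>)
  have \<nu>: "integrable lebesgue ?\<nu>" by (rule weight_integrable[OF density])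
  have \<nu>0: "AE x in lebesgue. 0 \<le> ?\<nu> x"
    using weight_nonneg[OF density] by eventually_elim (auto simp: indicator_def)
  have \<nu>S: "integrable lebesgue (\<lambda>x. ?\<nu> x * S x)"
    using weight_mult_integrable[OF density S_cont, of "2 * R"] S_le S0 by (simp add: set_integrable_def mult.assoc)
  have "F + (LINT x:{0..}|lebesgue. ?\<nu> x * S x) \<le> F * exp (LINT x:{0..}|lebesgue. ?\<nu> x)"
    by (rule backward_Gronwall[OF \<nu> \<nu>0 \<nu>S S0 S_R R(1) F bound])
  moreover have "(LINT x:{0..}|lebesgue. ?\<nu> x) = (LINT r:{0<..}|lebesgue. \<mu> r)"
    unfolding set_lebesgue_integral_def by (intro Bochner_Integration.integral_cong) (auto simp: indicator_def)
  moreover have "(LINT x:{r..}|lebesgue. ?\<nu> x * S x) \<le> (LINT x:{0..}|lebesgue. ?\<nu> x * S x)"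
    unfolding set_lebesgue_integral_def
  proof (rule integral_mono_AE)
    show "integrable lebesgue (\<lambda>x. indicator {r..} x *\<^sub>R (?\<nu> x * S x))" "integrable lebesgue (\<lambda>x. indicator {0..} x *\<^sub>R (?\<nu> x * S x))"
      by (intro integrable_mult_indicator \<nu>S; simp)+
    show "AE x in lebesgue. indicator {r..} x *\<^sub>R (?\<nu> x * S x) \<le> indicator {0..} x *\<^sub>R (?\<nu> x * S x)"
      using \<nu>0 by eventually_elim (use r S0 in \<open>auto simp: indicator_def\<close>)
  qed
  ultimately have "S r \<le> exp (LINT r:{0<..}|lebesgue. \<mu> r) * F" using bound[OF r] by (simp add: mult.commute)
  then show ?thesis using S_upper[OF t r] by (simp add: e_def)
qed

end

section \<open>Approximate solutions and their limit\<close>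

context
  fixes \<psi> :: "real ^ 'n \<Rightarrow> real \<Rightarrow> real \<Rightarrow> real" and \<mu> :: "real \<Rightarrow> real" and K :: "real \<Rightarrow> real \<Rightarrow> real"
  assumes density: "preisach_density \<psi> \<mu> K"
begin

lemma step_solution_exists:
  assumes "finite G" "G \<subseteq> {0<..}"
  shows "\<exists>\<Lambda>. step_trajectory G \<Lambda> \<and> (\<forall>t\<in>insert 0 G. \<Lambda> t 0 + preisach_functional \<psi> (u t) (\<Lambda> t) = w t)"
  using assms
proof (induction G rule: finite_linorder_max_induct)
  case empty
  obtain x where x: "x + preisach_functional \<psi> (u 0) (play_update x (\<lambda>_. 0)) = w 0"
    using single_update_solvable[OF density memory_state_zero] .
  have "step_trajectory {} (\<lambda>_. play_update x (\<lambda>_. 0))"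
    unfolding step_trajectory_def
  proof (intro conjI allI impI)
    show "\<exists>R. \<forall>t\<ge>0::real. \<forall>r\<ge>R. play_update x (\<lambda>_. 0) r = 0"
      by (intro exI[of _ "\<bar>x\<bar>"]) (auto simp: play_update_def)
  qed (auto intro: memory_state_play_update memory_state_zero simp: play_update_idem)
  then show ?case using x by (intro exI[of _ "\<lambda>_. play_update x (\<lambda>_. 0)"]) simp
next
  case (insert b G)
  have b: "0 < b" "b \<notin> G" using insert by auto
  obtain \<Lambda> where \<Lambda>: "step_trajectory G \<Lambda>" "\<forall>t\<in>insert 0 G. \<Lambda> t 0 + preisach_functional \<psi> (u t) (\<Lambda> t) = w t"
    using insert.IH insert.prems by auto
  have mem: "memory_state (\<Lambda> t)" if "0 \<le> t" for t using step_trajectory_memory[OF \<Lambda>(1) that] .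
  obtain x where x: "x + preisach_functional \<psi> (u b) (play_update x (\<Lambda> b)) = w b"
    using single_update_solvable[OF density mem] b by (metis less_imp_le)
  define \<Lambda>' where "\<Lambda>' t = (if t < b then \<Lambda> t else play_update x (\<Lambda> b))" for t
  obtain R where R: "\<forall>t\<ge>0. \<forall>r\<ge>R. \<Lambda> t r = 0" using step_trajectory_support[OF \<Lambda>(1)] ..
  have "step_trajectory (insert b G) \<Lambda>'"
    unfolding step_trajectory_def
  proof (intro conjI allI impI)
    show "finite (insert b G)" using insert by simp
    show "memory_state (\<Lambda>' t)" if "0 \<le> t" for t
      using that b by (auto simp: \<Lambda>'_def intro!: mem memory_state_play_update)
    show "\<exists>R. \<forall>t\<ge>0. \<forall>r\<ge>R. \<Lambda>' t r = 0"
    proof (intro exI[of _ "max R \<bar>x\<bar>"] allI impI)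
      fix t r :: real assume t: "0 \<le> t" "max R \<bar>x\<bar> \<le> r"
      then have "\<Lambda> t r = 0" "\<Lambda> b r = 0" using R b by auto
      then show "\<Lambda>' t r = 0" using t by (auto simp: \<Lambda>'_def play_update_def)
    qed
    show "\<Lambda>' 0 r = play_update (\<Lambda>' 0 0) (\<lambda>_. 0) r" if "0 \<le> r" for r
      using step_trajectory_start[OF \<Lambda>(1) that] b by (simp add: \<Lambda>'_def)
    show "\<Lambda>' t = \<Lambda>' s" if st: "0 \<le> s \<and> s < t \<and> insert b G \<inter> {s<..t} = {}" for s t
    proof (cases "t < b")
      case True
      then show ?thesis using step_trajectory_const[OF \<Lambda>(1), of s t] st by (auto simp: \<Lambda>'_def)
    next
      case False
      then have "b \<le> s" using st by auto
      then show ?thesis using st by (simp add: \<Lambda>'_def)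
    qed
    show "\<Lambda>' t r = play_update (\<Lambda>' t 0) (\<Lambda>' s) r"
      if st: "0 \<le> s \<and> s < t \<and> insert b G \<inter> {s<..t} \<subseteq> {t}" and r: "0 \<le> r" for s t r
    proof -
      consider "t < b" | "b \<le> s" | "s < b" "b \<le> t" by linarith
      then show ?thesis
      proof cases
        case 1
        then show ?thesis using step_trajectory_update[OF \<Lambda>(1), of s t r] st r by (auto simp: \<Lambda>'_def)
      next
        case 2
        then show ?thesis using st r by (simp add: \<Lambda>'_def play_update_idem)
      next
        case 3
        then have "t = b" using st by auto
        have "\<Lambda> b = \<Lambda> s" using st b 3 \<open>t = b\<close> by (intro step_trajectory_const[OF \<Lambda>(1)]) auto
        then show ?thesis using 3 \<open>t = b\<close> by (simp add: \<Lambda>'_def)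
      qed
    qed
  qed
  moreover have "\<Lambda>' t 0 + preisach_functional \<psi> (u t) (\<Lambda>' t) = w t" if t: "t \<in> insert 0 (insert b G)" for t
  proof (cases "t = b")
    case True
    then show ?thesis using x by (simp add: \<Lambda>'_def)
  next
    case False
    then have "t \<in> insert 0 G" "t < b" using t insert.hyps(2) b by auto
    then show ?thesis using \<Lambda>(2)[rule_format, of t] by (simp add: \<Lambda>'_def)
  qed
  ultimately show ?case by blast
qed

text \<open>The trajectory is piecewise constant, but the residual is measured against the given data and not
  against piecewise constant versions of them.  This makes approximate solutions on different grids
  directly comparable.\<close>

definition approximate_solution ::
    "real \<Rightarrow> real \<Rightarrow> (real \<Rightarrow> real ^ 'n) \<Rightarrow> (real \<Rightarrow> real) \<Rightarrow> (real \<Rightarrow> real \<Rightarrow> real) \<Rightarrow> bool" where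
  "approximate_solution T \<epsilon> u w \<Lambda> \<longleftrightarrow> (\<exists>G. step_trajectory G \<Lambda>) \<and>
     (\<forall>t\<in>{0..T}. \<bar>\<Lambda> t 0 + preisach_functional \<psi> (u t) (\<Lambda> t) - w t\<bar> \<le> \<epsilon>)"

lemma approximate_solution_memory:
  "approximate_solution T \<epsilon> u w \<Lambda> \<Longrightarrow> 0 \<le> t \<Longrightarrow> memory_state (\<Lambda> t)"
  using step_trajectory_memory by (auto simp: approximate_solution_def)

text \<open>The Lipschitz estimate at two parameters at distance \<open>1\<close> forces the constant to be nonnegative.\<close>

lemma kernel_integral_nonneg: "0 \<le> (LINT r:{0<..}|lebesgue. (LINT v|lebesgue. K r v))"
proof -
  have "\<bar>preisach_functional \<psi> (axis undefined 1) (\<lambda>_. 0) - preisach_functional \<psi> 0 (\<lambda>_. 0)\<bar>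
    \<le> (LINT r:{0<..}|lebesgue. (LINT v|lebesgue. K r v)) * norm (axis undefined 1 - 0 :: real ^ 'n)"
    by (rule preisach_functional_parameter_Lipschitz[OF density memory_state_zero])
  then show ?thesis by simp
qed

text \<open>The equation holds exactly at the grid points; within a cell neither \<open>u\<close> nor \<open>w\<close> moves far and the
  memory state does not move at all.\<close>

lemma approximate_solution_exists:
  assumes T: "0 \<le> T" and u: "u \<in> regulated_right T" and w: "w \<in> regulated_right T" and \<epsilon>: "0 < \<epsilon>"
  obtains \<Lambda> where "approximate_solution T \<epsilon> u w \<Lambda>"
proof -
  define M1 where "M1 = (LINT r:{0<..}|lebesgue. (LINT v|lebesgue. K r v))"
  have M1: "0 \<le> M1" unfolding M1_def by (rule kernel_integral_nonneg)
  define e where "e = \<epsilon> / (2 * (M1 + 1))"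
  have "e * (2 * (M1 + 1)) = \<epsilon>" using M1 by (simp add: e_def)
  moreover have "0 < e" using \<epsilon> M1 by (simp add: e_def)
  ultimately have e: "0 < e" "2 * e + M1 * (2 * e) = \<epsilon>" by (simp_all add: algebra_simps)
  obtain Gw where Gw: "finite Gw" "Gw \<subseteq> {0..T}"
    "\<And>t. t \<in> {0..T} \<Longrightarrow> \<exists>g\<in>Gw. g \<le> t \<and> (\<forall>y\<in>{g..t}. norm (w y - w g) < e)"
    using regulated_right_fine_grid[OF w T e(1)] by blast
  obtain Gu where Gu: "finite Gu" "Gu \<subseteq> {0..T}"
    "\<And>t. t \<in> {0..T} \<Longrightarrow> \<exists>g\<in>Gu. g \<le> t \<and> (\<forall>y\<in>{g..t}. norm (u y - u g) < e)"
    using regulated_right_fine_grid[OF u T e(1)] by blast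
  define G where "G = (Gw \<union> Gu) - {0}"
  have G: "finite G" "G \<subseteq> {0<..}" using Gw(1,2) Gu(1,2) by (auto simp: G_def)
  obtain \<Lambda> where \<Lambda>: "step_trajectory G \<Lambda>" "\<forall>t\<in>insert 0 G. \<Lambda> t 0 + preisach_functional \<psi> (u t) (\<Lambda> t) = w t"
    using step_solution_exists[OF G] by blast
  have "\<bar>\<Lambda> t 0 + preisach_functional \<psi> (u t) (\<Lambda> t) - w t\<bar> \<le> \<epsilon>" if t: "t \<in> {0..T}" for t
  proof -
    define p where "p = Max (insert 0 G \<inter> {..t})"
    have fin: "finite (insert 0 G \<inter> {..t})" and "0 \<in> insert 0 G \<inter> {..t}" using G t by auto
    then have p: "p \<in> insert 0 G" "p \<le> t" and p_max: "\<And>g. g \<in> insert 0 G \<Longrightarrow> g \<le> t \<Longrightarrow> g \<le> p"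
      using Max_in[of "insert 0 G \<inter> {..t}"] Max_ge[of "insert 0 G \<inter> {..t}"] unfolding p_def by (blast, blast, blast)
    have p0: "0 \<le> p" using p_max t by auto
    have "G \<inter> {p<..t} = {}" using p_max by force
    then have const: "\<Lambda> t = \<Lambda> p"
      using step_trajectory_const[OF \<Lambda>(1) p0, of t] p(2) by (cases "p = t") auto
    have near: "norm (f t - f p) \<le> 2 * e"
      if g: "g \<in> Gw \<union> Gu" "g \<le> t" "\<forall>y\<in>{g..t}. norm (f y - f g) < e" for g and f :: "real \<Rightarrow> 'x::real_normed_vector"
    proof -
      have "g \<le> p" using p_max g by (auto simp: G_def)
      then have "norm (f t - f g) < e" "norm (f p - f g) < e" using g p by auto
      then show ?thesis using norm_triangle_ineq4[of "f t - f g" "f p - f g"] by simp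
    qed
    have w_near: "norm (w t - w p) \<le> 2 * e" using Gw(3)[OF t] near by blast
    have u_near: "norm (u t - u p) \<le> 2 * e" using Gu(3)[OF t] near by blast
    have "\<bar>preisach_functional \<psi> (u t) (\<Lambda> p) - preisach_functional \<psi> (u p) (\<Lambda> p)\<bar> \<le> M1 * norm (u t - u p)"
      unfolding M1_def
      by (rule preisach_functional_parameter_Lipschitz[OF density step_trajectory_memory[OF \<Lambda>(1) p0]])
    also have "\<dots> \<le> M1 * (2 * e)" using u_near M1 by (rule mult_left_mono)
    finally have "\<bar>preisach_functional \<psi> (u t) (\<Lambda> p) - preisach_functional \<psi> (u p) (\<Lambda> p)\<bar> \<le> M1 * (2 * e)" .
    moreover have "\<Lambda> p 0 + preisach_functional \<psi> (u p) (\<Lambda> p) = w p" using \<Lambda>(2) p(1) by blast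
    ultimately show ?thesis using w_near e(2) unfolding const real_norm_def by linarith
  qed
  then show ?thesis using that \<Lambda>(1) unfolding approximate_solution_def by blast
qed

lemma approximate_solution_stability:
  assumes 1: "approximate_solution T \<epsilon> u w \<Lambda>" and 2: "approximate_solution T \<epsilon>' u' w' \<Lambda>'"
    and b: "0 \<le> b" "b \<le> T"
    and W: "\<And>\<tau>. \<tau> \<in> {0..b} \<Longrightarrow> \<bar>w \<tau> - w' \<tau>\<bar> \<le> W" and U: "\<And>\<tau>. \<tau> \<in> {0..b} \<Longrightarrow> norm (u \<tau> - u' \<tau>) \<le> U"
    and t: "0 \<le> t" "t \<le> b" and r: "0 \<le> r"
  shows "\<bar>\<Lambda> t r - \<Lambda>' t r\<bar> \<le> exp (LINT r:{0<..}|lebesgue. \<mu> r) *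
    (W + (LINT r:{0<..}|lebesgue. (LINT v|lebesgue. K r v)) * U + \<epsilon> + \<epsilon>')"
proof -
  obtain G G' where traj: "step_trajectory G \<Lambda>" "step_trajectory G' \<Lambda>'"
    using 1 2 unfolding approximate_solution_def by blast
  let ?M1 = "LINT r:{0<..}|lebesgue. (LINT v|lebesgue. K r v)"
  show ?thesis
  proof (rule step_trajectory_stability[OF density traj b(1) _ t r, where u=u])
    fix \<tau> :: real assume \<tau>: "0 \<le> \<tau>" "\<tau> \<le> b"
    have "\<bar>preisach_functional \<psi> (u \<tau>) (\<Lambda>' \<tau>) - preisach_functional \<psi> (u' \<tau>) (\<Lambda>' \<tau>)\<bar> \<le> ?M1 * norm (u \<tau> - u' \<tau>)"
      by (rule preisach_functional_parameter_Lipschitz[OF density approximate_solution_memory[OF 2 \<tau>(1)]])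
    also have "\<dots> \<le> ?M1 * U" using U[of \<tau>] \<tau> kernel_integral_nonneg by (intro mult_left_mono) auto
    finally have "\<bar>preisach_functional \<psi> (u \<tau>) (\<Lambda>' \<tau>) - preisach_functional \<psi> (u' \<tau>) (\<Lambda>' \<tau>)\<bar> \<le> ?M1 * U" .
    moreover have "\<bar>\<Lambda> \<tau> 0 + preisach_functional \<psi> (u \<tau>) (\<Lambda> \<tau>) - w \<tau>\<bar> \<le> \<epsilon>"
      "\<bar>\<Lambda>' \<tau> 0 + preisach_functional \<psi> (u' \<tau>) (\<Lambda>' \<tau>) - w' \<tau>\<bar> \<le> \<epsilon>'"
      using 1 2 \<tau> b unfolding approximate_solution_def by auto
    moreover have "\<bar>w \<tau> - w' \<tau>\<bar> \<le> W" using W[of \<tau>] \<tau> by simp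
    ultimately show "\<bar>(\<Lambda> \<tau> 0 + preisach_functional \<psi> (u \<tau>) (\<Lambda> \<tau>)) - (\<Lambda>' \<tau> 0 + preisach_functional \<psi> (u \<tau>) (\<Lambda>' \<tau>))\<bar>
        \<le> W + ?M1 * U + \<epsilon> + \<epsilon>'" by linarith
  qed
qed

text \<open>The value off \<open>{0..T}\<close> is fixed so that every level of the limit is an extensional function.\<close>

definition limit_solution ::
    "real \<Rightarrow> (real \<Rightarrow> real ^ 'n) \<Rightarrow> (real \<Rightarrow> real) \<Rightarrow> (real \<Rightarrow> real \<Rightarrow> real) \<Rightarrow> bool" where
  "limit_solution T u w \<Lambda> \<longleftrightarrow> (\<forall>t r. t \<notin> {0..T} \<longrightarrow> \<Lambda> t r = undefined) \<and>
     (\<forall>\<epsilon>>0. \<exists>\<Lambda>'. approximate_solution T \<epsilon> u w \<Lambda>' \<and> (\<forall>t\<in>{0..T}. \<forall>r\<ge>0. \<bar>\<Lambda> t r - \<Lambda>' t r\<bar> \<le> \<epsilon>))"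

lemma limit_solution_exists:
  assumes T: "0 \<le> T" and u: "u \<in> regulated_right T" and w: "w \<in> regulated_right T"
  obtains \<Lambda> where "limit_solution T u w \<Lambda>"
proof -
  define E where "E = exp (LINT r:{0<..}|lebesgue. \<mu> r)"
  have E: "0 < E" by (simp add: E_def)
  have "\<exists>\<Lambda>. approximate_solution T (inverse (real (Suc n))) u w \<Lambda>" for n
    using approximate_solution_exists[OF T u w, of "inverse (real (Suc n))"] by auto
  then obtain L where L: "\<And>n. approximate_solution T (inverse (real (Suc n))) u w (L n)" by metis
  have close: "\<bar>L n t r - L m t r\<bar> \<le> E * (inverse (real (Suc n)) + inverse (real (Suc m)))"
    if "t \<in> {0..T}" "0 \<le> r" for n m t r
    using approximate_solution_stability[OF L[of n] L[of m] T order_refl, of 0 0 t r] that by (simp add: E_def)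
  have small: "(\<lambda>n. inverse (real (Suc n))) \<longlonglongrightarrow> 0" by (rule LIMSEQ_inverse_real_of_nat)
  define \<Lambda> where "\<Lambda> t r = (if t \<in> {0..T} then lim (\<lambda>n. L n t r) else undefined)" for t r
  have limit: "\<bar>\<Lambda> t r - L n t r\<bar> \<le> E * inverse (real (Suc n))" if tr: "t \<in> {0..T}" "0 \<le> r" for t r n
  proof -
    have "Cauchy (\<lambda>n. L n t r)"
    proof (rule metric_CauchyI)
      fix e :: real assume e: "0 < e"
      have "(\<lambda>n. 2 * E * inverse (real (Suc n))) \<longlonglongrightarrow> 0" by (rule tendsto_mult_right_zero[OF small])
      then have "\<forall>\<^sub>F n in sequentially. 2 * E * inverse (real (Suc n)) < e" using e by (rule order_tendstoD(2))
      then obtain N where N: "2 * E * inverse (real (Suc N)) < e" by (auto simp: eventually_sequentially)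
      have "dist (L m t r) (L n t r) < e" if "N \<le> m" "N \<le> n" for m n
      proof -
        have "\<bar>L m t r - L n t r\<bar> \<le> E * (inverse (real (Suc m)) + inverse (real (Suc n)))" by (rule close[OF tr])
        also have "\<dots> \<le> E * (inverse (real (Suc N)) + inverse (real (Suc N)))"
          using that E by (intro mult_left_mono add_mono le_imp_inverse_le) auto
        also have "\<dots> < e" using N by (simp add: algebra_simps)
        finally show ?thesis by (simp add: dist_real_def)
      qed
      then show "\<exists>M. \<forall>m\<ge>M. \<forall>n\<ge>M. dist (L m t r) (L n t r) < e" by blast
    qed
    then have conv: "(\<lambda>n. L n t r) \<longlonglongrightarrow> \<Lambda> t r"
      using tr by (simp add: \<Lambda>_def Cauchy_convergent_iff convergent_LIMSEQ_iff)
    show ?thesis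
    proof (rule tendsto_le)
      show "(\<lambda>m. E * (inverse (real (Suc m)) + inverse (real (Suc n)))) \<longlonglongrightarrow> E * inverse (real (Suc n))"
        by (rule tendsto_eq_intros small refl | simp)+
      show "(\<lambda>m. \<bar>L m t r - L n t r\<bar>) \<longlonglongrightarrow> \<bar>\<Lambda> t r - L n t r\<bar>" by (intro tendsto_intros conv)
      show "\<forall>\<^sub>F m in sequentially. \<bar>L m t r - L n t r\<bar> \<le> E * (inverse (real (Suc m)) + inverse (real (Suc n)))"
        by (intro always_eventually allI close[OF tr])
    qed simp
  qed
  have "\<exists>\<Lambda>'. approximate_solution T \<epsilon> u w \<Lambda>' \<and> (\<forall>t\<in>{0..T}. \<forall>r\<ge>0. \<bar>\<Lambda> t r - \<Lambda>' t r\<bar> \<le> \<epsilon>)"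
    if \<epsilon>: "0 < \<epsilon>" for \<epsilon>
  proof -
    have "(\<lambda>n. (E + 1) * inverse (real (Suc n))) \<longlonglongrightarrow> 0" by (rule tendsto_mult_right_zero[OF small])
    then have "\<forall>\<^sub>F n in sequentially. (E + 1) * inverse (real (Suc n)) < \<epsilon>" using \<epsilon> by (rule order_tendstoD(2))
    then obtain n where n: "(E + 1) * inverse (real (Suc n)) < \<epsilon>" by (auto simp: eventually_sequentially)
    define d where "d = inverse (real (Suc n))"
    have "0 < d" "E * d + d < \<epsilon>" using n by (simp_all add: d_def distrib_right)
    moreover from this(1) have "0 < E * d" using E by simp
    ultimately have d: "d \<le> \<epsilon>" "E * d \<le> \<epsilon>" by linarith+
    have "approximate_solution T \<epsilon> u w (L n)"
      using L[of n] d(1) unfolding approximate_solution_def d_def by fastforce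
    moreover have "\<forall>t\<in>{0..T}. \<forall>r\<ge>0. \<bar>\<Lambda> t r - L n t r\<bar> \<le> \<epsilon>"
      using limit[of _ _ n] d(2) unfolding d_def by fastforce
    ultimately show ?thesis by blast
  qed
  moreover have "\<Lambda> t r = undefined" if "t \<notin> {0..T}" for t r unfolding \<Lambda>_def using that by (rule if_not_P)
  ultimately have "limit_solution T u w \<Lambda>" unfolding limit_solution_def by blast
  then show ?thesis by (rule that)
qed

context
  fixes T :: real and u :: "real \<Rightarrow> real ^ 'n" and w :: "real \<Rightarrow> real" and \<Lambda> :: "real \<Rightarrow> real \<Rightarrow> real"
  assumes T: "0 \<le> T" and limit: "limit_solution T u w \<Lambda>"
begin

lemma limit_solution_approx:
  assumes "0 < \<epsilon>"
  obtains G \<Lambda>' where "step_trajectory G \<Lambda>'" "approximate_solution T \<epsilon> u w \<Lambda>'"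
    "\<And>t r. t \<in> {0..T} \<Longrightarrow> 0 \<le> r \<Longrightarrow> \<bar>\<Lambda> t r - \<Lambda>' t r\<bar> \<le> \<epsilon>"
proof -
  obtain \<Lambda>' where "approximate_solution T \<epsilon> u w \<Lambda>'" "\<forall>t\<in>{0..T}. \<forall>r\<ge>0. \<bar>\<Lambda> t r - \<Lambda>' t r\<bar> \<le> \<epsilon>"
    using limit assms unfolding limit_solution_def by blast
  then show ?thesis using that unfolding approximate_solution_def by blast
qed

lemma limit_solution_regulated:
  assumes "0 \<le> r"
  shows "(\<lambda>t. \<Lambda> t r) \<in> regulated_right T"
proof (rule regulated_right_uniform_limit)
  fix e :: real assume "0 < e"
  then obtain G \<Lambda>' where "step_trajectory G \<Lambda>'" "approximate_solution T e u w \<Lambda>'"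
    "\<And>t r. t \<in> {0..T} \<Longrightarrow> 0 \<le> r \<Longrightarrow> \<bar>\<Lambda> t r - \<Lambda>' t r\<bar> \<le> e"
    using limit_solution_approx by blast
  then show "\<exists>v\<in>regulated_right T. \<forall>t\<in>{0..T}. norm (\<Lambda> t r - v t) \<le> e"
    using assms by (intro bexI[of _ "\<lambda>t. \<Lambda>' t r"] step_trajectory_regulated) auto
qed

lemma limit_solution_memory:
  assumes t: "t \<in> {0..T}"
  shows "memory_state (\<Lambda> t)"
  unfolding memory_state_def
proof (intro conjI allI impI)
  fix r s :: real assume rs: "0 \<le> r" "0 \<le> s"
  show "\<bar>\<Lambda> t r - \<Lambda> t s\<bar> \<le> \<bar>r - s\<bar>"
  proof (rule field_le_epsilon)
    fix e :: real assume "0 < e"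
    then have "0 < e / 2" by simp
    then obtain G \<Lambda>' where a: "step_trajectory G \<Lambda>'" "approximate_solution T (e/2) u w \<Lambda>'"
      "\<And>t r. t \<in> {0..T} \<Longrightarrow> 0 \<le> r \<Longrightarrow> \<bar>\<Lambda> t r - \<Lambda>' t r\<bar> \<le> e/2"
      using limit_solution_approx by blast
    have "\<bar>\<Lambda>' t r - \<Lambda>' t s\<bar> \<le> \<bar>r - s\<bar>"
      using memory_state_Lipschitz[OF step_trajectory_memory[OF a(1)] rs] t by simp
    then show "\<bar>\<Lambda> t r - \<Lambda> t s\<bar> \<le> \<bar>r - s\<bar> + e" using a(3)[OF t rs(1)] a(3)[OF t rs(2)] by linarith
  qed
next
  obtain G \<Lambda>' where a: "step_trajectory G \<Lambda>'" "approximate_solution T 1 u w \<Lambda>'"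
    "\<And>t r. t \<in> {0..T} \<Longrightarrow> 0 \<le> r \<Longrightarrow> \<bar>\<Lambda> t r - \<Lambda>' t r\<bar> \<le> 1"
    using limit_solution_approx zero_less_one by blast
  have "memory_state (\<Lambda>' t)" using step_trajectory_memory[OF a(1)] t by simp
  then obtain C where C: "\<And>r. 0 \<le> r \<Longrightarrow> \<bar>\<Lambda>' t r\<bar> \<le> C" using memory_state_bounded by blast
  have "\<bar>\<Lambda> t r\<bar> \<le> C + 1" if "0 \<le> r" for r using C[OF that] a(3)[OF t that] by linarith
  then show "\<exists>C. \<forall>r\<ge>0. \<bar>\<Lambda> t r\<bar> \<le> C" by blast
qed

lemma limit_solution_equation:
  assumes t: "t \<in> {0..T}"
  shows "\<Lambda> t 0 + preisach_functional \<psi> (u t) (\<Lambda> t) = w t"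
proof -
  let ?M = "LINT r:{0<..}|lebesgue. \<mu> r"
  have "\<bar>\<Lambda> t 0 + preisach_functional \<psi> (u t) (\<Lambda> t) - w t\<bar> \<le> 0 + \<kappa>" if \<kappa>: "0 < \<kappa>" for \<kappa>
  proof -
    define e where "e = \<kappa> / (2 + \<bar>?M\<bar>)"
    have "2 + \<bar>?M\<bar> \<noteq> 0" using abs_ge_zero[of ?M] by linarith
    then have "e * (2 + \<bar>?M\<bar>) = \<kappa>" by (simp add: e_def)
    moreover have "0 < e" using \<kappa> by (simp add: e_def add_pos_nonneg)
    ultimately have e: "0 < e" "2 * e + \<bar>?M\<bar> * e = \<kappa>" by (simp_all add: distrib_left mult.commute)
    obtain G \<Lambda>' where a: "step_trajectory G \<Lambda>'" "approximate_solution T e u w \<Lambda>'"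
      "\<And>t r. t \<in> {0..T} \<Longrightarrow> 0 \<le> r \<Longrightarrow> \<bar>\<Lambda> t r - \<Lambda>' t r\<bar> \<le> e"
      using limit_solution_approx[OF e(1)] by blast
    have mem: "memory_state (\<Lambda>' t)" using step_trajectory_memory[OF a(1)] t by simp
    have "\<bar>preisach_functional \<psi> (u t) (\<Lambda> t) - preisach_functional \<psi> (u t) (\<Lambda>' t)\<bar> \<le> ?M * e"
      by (rule preisach_functional_Lipschitz[OF density limit_solution_memory[OF t] mem a(3)[OF t]])
    moreover have "?M * e \<le> \<bar>?M\<bar> * e" using e(1) by (intro mult_right_mono) auto
    moreover have "\<bar>\<Lambda>' t 0 + preisach_functional \<psi> (u t) (\<Lambda>' t) - w t\<bar> \<le> e"
      using a(2) t unfolding approximate_solution_def by blast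
    ultimately show ?thesis using a(3)[OF t order_refl] e(2) by linarith
  qed
  then have "\<bar>\<Lambda> t 0 + preisach_functional \<psi> (u t) (\<Lambda> t) - w t\<bar> \<le> 0" by (rule field_le_epsilon)
  then show ?thesis by simp
qed

lemma limit_solution_obeys_play:
  assumes r: "0 \<le> r"
  shows "obeys_play T r (\<lambda>t. \<Lambda> t 0) (\<lambda>t. \<Lambda> t r)"
proof -
  have T0: "0 \<in> {0..T}" using T by simp
  have "\<bar>\<Lambda> 0 r - play_update (\<Lambda> 0 0) (\<lambda>_. 0) r\<bar> \<le> 0 + e" if "0 < e" for e
  proof -
    have "0 < e / 2" using that by simp
    then obtain G \<Lambda>' where a: "step_trajectory G \<Lambda>'" "approximate_solution T (e/2) u w \<Lambda>'"
      "\<And>t r. t \<in> {0..T} \<Longrightarrow> 0 \<le> r \<Longrightarrow> \<bar>\<Lambda> t r - \<Lambda>' t r\<bar> \<le> e/2"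
      using limit_solution_approx by blast
    have "\<bar>play_update (\<Lambda> 0 0) (\<lambda>_. 0) r - play_update (\<Lambda>' 0 0) (\<lambda>_. 0) r\<bar> \<le> \<bar>\<Lambda> 0 0 - \<Lambda>' 0 0\<bar>"
      using play_update_Lipschitz[of "\<Lambda> 0 0" "\<lambda>_. 0" r "\<Lambda>' 0 0" "\<lambda>_. 0"] by simp
    then show ?thesis
      using a(3)[OF T0 r] a(3)[OF T0 order_refl] step_trajectory_start[OF a(1) r] by linarith
  qed
  then have "\<bar>\<Lambda> 0 r - play_update (\<Lambda> 0 0) (\<lambda>_. 0) r\<bar> \<le> 0" by (rule field_le_epsilon)
  then have init: "\<Lambda> 0 r = max (\<Lambda> 0 0 - r) (min 0 (\<Lambda> 0 0 + r))" by (simp add: play_update_def)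
  have near: "\<bar>\<Lambda> t 0 - \<Lambda> t r\<bar> \<le> r" if "t \<in> {0..T}" for t
    using memory_state_Lipschitz[OF limit_solution_memory[OF that] order_refl r] r by simp
  have approx: "\<exists>G \<Lambda>'. step_trajectory G \<Lambda>' \<and> (\<forall>t\<in>{0..T}. \<forall>r\<ge>0. \<bar>\<Lambda> t r - \<Lambda>' t r\<bar> \<le> e)" if "e > 0" for e
    using limit_solution_approx[OF that] by metis
  have flip: "\<bar>- x - - y\<bar> = \<bar>x - y\<bar>" for x y :: real by linarith
  have approx': "\<exists>G \<Lambda>'. step_trajectory G \<Lambda>' \<and> (\<forall>t\<in>{0..T}. \<forall>r\<ge>0. \<bar>- \<Lambda> t r - \<Lambda>' t r\<bar> \<le> e)" if e: "e > 0" for e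
  proof -
    obtain G \<Lambda>' where a: "step_trajectory G \<Lambda>'" "\<forall>t\<in>{0..T}. \<forall>r\<ge>0. \<bar>\<Lambda> t r - \<Lambda>' t r\<bar> \<le> e"
      using approx[OF e] by blast
    then show ?thesis
      by (intro exI[of _ G] exI[of _ "\<lambda>t r. - \<Lambda>' t r"]) (simp add: step_trajectory_uminus flip abs_minus_commute)
  qed
  have up: "\<exists>\<tau>\<in>{s<..t}. \<Lambda> \<tau> 0 - \<Lambda> \<tau> r \<ge> r - \<epsilon> \<and> \<Lambda> \<tau> r \<ge> \<Lambda> t r - \<epsilon>"
    if "0 \<le> s \<and> s < t \<and> t \<le> T \<and> \<epsilon> > 0 \<and> \<Lambda> s r < \<Lambda> t r" for s t \<epsilon>
    using step_trajectory_limit_increase[OF approx r] that by blast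
  have down: "\<exists>\<tau>\<in>{s<..t}. \<Lambda> \<tau> r - \<Lambda> \<tau> 0 \<ge> r - \<epsilon> \<and> \<Lambda> \<tau> r \<le> \<Lambda> t r + \<epsilon>"
    if st: "0 \<le> s \<and> s < t \<and> t \<le> T \<and> \<epsilon> > 0 \<and> \<Lambda> t r < \<Lambda> s r" for s t \<epsilon>
  proof -
    have "\<exists>\<tau>\<in>{s<..t}. - \<Lambda> \<tau> 0 - - \<Lambda> \<tau> r \<ge> r - \<epsilon> \<and> - \<Lambda> \<tau> r \<ge> - \<Lambda> t r - \<epsilon>"
      using st by (intro step_trajectory_limit_increase[OF approx' r]) auto
    then show ?thesis by (elim bexE) (rule bexI, auto)
  qed
  show ?thesis unfolding obeys_play_def using init near up down by blast
qed

lemma limit_solution_play: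
  assumes "0 < r"
  shows "play T r (\<lambda>t. \<Lambda> t 0) = (\<lambda>t. \<Lambda> t r)"
proof (rule play_eqI[OF T])
  show "is_play T r (\<lambda>t. \<Lambda> t 0) (\<lambda>t. \<Lambda> t r)"
    using assms by (intro obeys_play_imp_is_play T limit_solution_obeys_play limit_solution_regulated) auto
  show "(\<lambda>t. \<Lambda> t r) \<in> extensional {0..T}"
    using limit by (auto simp: limit_solution_def extensional_def)
qed (rule limit_solution_regulated, simp)

lemma limit_solution_preisach:
  assumes t: "t \<in> {0..T}"
  shows "\<Lambda> t 0 + preisach T \<psi> u (\<lambda>t. \<Lambda> t 0) t = w t"
proof -
  have "preisach T \<psi> u (\<lambda>t. \<Lambda> t 0) t = preisach_functional \<psi> (u t) (\<Lambda> t)"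
    unfolding preisach_def preisach_functional_def
    by (rule set_lebesgue_integral_cong) (auto simp: limit_solution_play)
  then show ?thesis using limit_solution_equation[OF t] by simp
qed

end

text \<open>The residuals of the approximating solutions only add a term that tends to \<open>0\<close>.\<close>

lemma limit_solution_stability:
  assumes T: "0 \<le> T" and 1: "limit_solution T u w \<Lambda>" and 2: "limit_solution T u' w' \<Lambda>'" and t: "t \<in> {0..T}"
    and W: "\<And>\<tau>. \<tau> \<in> {0..t} \<Longrightarrow> \<bar>w \<tau> - w' \<tau>\<bar> \<le> W" and U: "\<And>\<tau>. \<tau> \<in> {0..t} \<Longrightarrow> norm (u \<tau> - u' \<tau>) \<le> U"
  shows "\<bar>\<Lambda> t 0 - \<Lambda>' t 0\<bar> \<le> exp (LINT r:{0<..}|lebesgue. \<mu> r) *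
    (W + (LINT r:{0<..}|lebesgue. (LINT v|lebesgue. K r v)) * U)"
proof (rule field_le_epsilon)
  let ?M1 = "LINT r:{0<..}|lebesgue. (LINT v|lebesgue. K r v)"
  define E where "E = exp (LINT r:{0<..}|lebesgue. \<mu> r)"
  have E: "0 < E" by (simp add: E_def)
  fix \<kappa> :: real assume \<kappa>: "0 < \<kappa>"
  define e where "e = \<kappa> / (2 * (E + 1))"
  have "e * (2 * (E + 1)) = \<kappa>" using E by (simp add: e_def)
  moreover have "0 < e" using \<kappa> E by (simp add: e_def)
  ultimately have e: "0 < e" "2 * e + E * (2 * e) = \<kappa>" by (simp_all add: algebra_simps)
  obtain L where L: "approximate_solution T e u w L" "\<forall>t\<in>{0..T}. \<forall>r\<ge>0. \<bar>\<Lambda> t r - L t r\<bar> \<le> e"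
    using 1 e(1) unfolding limit_solution_def by blast
  obtain L' where L': "approximate_solution T e u' w' L'" "\<forall>t\<in>{0..T}. \<forall>r\<ge>0. \<bar>\<Lambda>' t r - L' t r\<bar> \<le> e"
    using 2 e(1) unfolding limit_solution_def by blast
  have t': "0 \<le> t" "t \<le> T" using t by auto
  have "\<bar>L t 0 - L' t 0\<bar> \<le> E * (W + ?M1 * U + e + e)"
    unfolding E_def by (rule approximate_solution_stability[OF L(1) L'(1) t' W U t'(1) order_refl order_refl])
  also have "\<dots> = E * (W + ?M1 * U) + E * (2 * e)" by (simp add: algebra_simps)
  finally have "\<bar>L t 0 - L' t 0\<bar> \<le> E * (W + ?M1 * U) + E * (2 * e)" .
  moreover have "\<bar>\<Lambda> t 0 - L t 0\<bar> \<le> e" "\<bar>\<Lambda>' t 0 - L' t 0\<bar> \<le> e" using L(2) L'(2) t by auto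
  ultimately have "\<bar>\<Lambda> t 0 - \<Lambda>' t 0\<bar> \<le> E * (W + ?M1 * U) + \<kappa>" using e(2) by linarith
  then show "\<bar>\<Lambda> t 0 - \<Lambda>' t 0\<bar> \<le> exp (LINT r:{0<..}|lebesgue. \<mu> r) * (W + ?M1 * U) + \<kappa>" by (simp add: E_def)
qed

end

theorem theorem4p7:
  fixes T M M\<^sub>1 :: real
    and \<psi> :: "real ^ 'n \<Rightarrow> real \<Rightarrow> real \<Rightarrow> real"
    and \<mu> :: "real \<Rightarrow> real" and K :: "real \<Rightarrow> real \<Rightarrow> real"
    and u u' :: "real \<Rightarrow> real ^ 'n"
    and w w' :: "real \<Rightarrow> real"
  assumes "T > 0"
    and "preisach_density \<psi> \<mu> K"
    and "M = (LINT r:{0<..}|lebesgue. \<mu> r)"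
    and "M\<^sub>1 = (LINT r:{0<..}|lebesgue. (LINT v|lebesgue. K r v))"
    and "u \<in> regulated_right T" and "u' \<in> regulated_right T"
    and "w \<in> regulated_right T" and "w' \<in> regulated_right T"
  shows "\<exists>q\<in>regulated_right T. \<exists>q'\<in>regulated_right T.
           (\<forall>t\<in>{0..T}. q t + preisach T \<psi> u q t = w t) \<and>
           (\<forall>t\<in>{0..T}. q' t + preisach T \<psi> u' q' t = w' t) \<and>
           (\<forall>t\<in>{0..T}. \<bar>q t - q' t\<bar> \<le>
              exp M * (sup_norm 0 t (\<lambda>\<tau>. w \<tau> - w' \<tau>) +
                       M\<^sub>1 * sup_norm 0 t (\<lambda>\<tau>. u \<tau> - u' \<tau>)))"
proof -
  have T: "0 \<le> T" using assms(1) by simp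
  note density = assms(2)
  obtain \<Lambda> where \<Lambda>: "limit_solution \<psi> T u w \<Lambda>"
    using limit_solution_exists[OF density T assms(5,7)] .
  obtain \<Lambda>' where \<Lambda>': "limit_solution \<psi> T u' w' \<Lambda>'"
    using limit_solution_exists[OF density T assms(6,8)] .
  have w_diff: "(\<lambda>\<tau>. w \<tau> - w' \<tau>) \<in> regulated T"
    by (intro regulated_right_imp_regulated regulated_right_diff assms)
  have u_diff: "(\<lambda>\<tau>. u \<tau> - u' \<tau>) \<in> regulated T"
    by (intro regulated_right_imp_regulated regulated_right_diff assms)
  have "\<bar>\<Lambda> t 0 - \<Lambda>' t 0\<bar> \<le> exp M * (sup_norm 0 t (\<lambda>\<tau>. w \<tau> - w' \<tau>) + M\<^sub>1 * sup_norm 0 t (\<lambda>\<tau>. u \<tau> - u' \<tau>))"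
    if t: "t \<in> {0..T}" for t
    unfolding assms(3,4)
  proof (rule limit_solution_stability[OF density T \<Lambda> \<Lambda>' t])
    show "\<bar>w \<tau> - w' \<tau>\<bar> \<le> sup_norm 0 t (\<lambda>\<tau>. w \<tau> - w' \<tau>)" if "\<tau> \<in> {0..t}" for \<tau>
      using sup_norm_upper[OF w_diff _ that] t by simp
    show "norm (u \<tau> - u' \<tau>) \<le> sup_norm 0 t (\<lambda>\<tau>. u \<tau> - u' \<tau>)" if "\<tau> \<in> {0..t}" for \<tau>
      using sup_norm_upper[OF u_diff _ that] t by simp
  qed
  then show ?thesis
    using limit_solution_regulated[OF density T \<Lambda> order_refl] limit_solution_regulated[OF density T \<Lambda>' order_refl]
      limit_solution_preisach[OF density T \<Lambda>] limit_solution_preisach[OF density T \<Lambda>']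
    by (intro bexI[of _ "\<lambda>t. \<Lambda> t 0"] bexI[of _ "\<lambda>t. \<Lambda>' t 0"] conjI ballI)
qed

end
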